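(* Let $d\ge2$, $1<p<\infty$, and let $\omega_{\varepsilon,\eta}=\mathbb{R}^d\setminus\bigcup_{k\in\mathbb{Z}^d}\varepsilon(k+\eta T)$ be a periodically perforated domain with hole $T$ as in the context, $\varepsilon,\eta\in(0,1]$. Let $$D_p(\varepsilon,\eta)=\sup\|u\|_{L^p(\omega_{\varepsilon,\eta})},$$ where the supremum is over all weak solutions $u\in W^{1,2}_0(\omega_{\varepsilon,\eta})$ of $-\Delta u=F$ in $\omega_{\varepsilon,\eta}$ with $F\in L^p(\omega_{\varepsilon,\eta})\cap L^2(\omega_{\varepsilon,\eta})$ and $\|F\|_{L^p(\omega_{\varepsilon,\eta})}=1$. Then, for $d\ge3$, $$c\,\varepsilon^2\eta^{2-d}\le D_p(\varepsilon,\eta)\le C\,\varepsilon^2\eta^{2-d},$$ and for $d=2$, $$c\,\varepsilon^2|\ln(\eta/2)|\le D_p(\varepsilon,\eta)\le C\,\varepsilon^2|\ln(\eta/2)|,$$ where $C,c>0$ depend only on $d$, $p$ and $c_0$.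
   Context: $Y=[-1/2,1/2]^d$. The hole $T$ is the closure of a bounded Lipschitz subdomain of $Y$ such that $Y\setminus T$ is connected, $B(0,c_0)\subset T$ and $\mathrm{dist}(\partial T,\partial Y)\ge c_0$ for some $c_0>0$. $W^{1,2}_0(\Omega)$ is the completion of $C_0^\infty(\Omega)$ with respect to the norm $\|\nabla\psi\|_{L^2(\Omega)}$; a weak solution of $-\Delta u=F$ satisfies $\int\nabla u\cdot\nabla\phi=\int F\phi$ for all $\phi\in C_0^\infty$. *)

theory Defs
  imports "HOL-Analysis.Analysis"
begin

text \<open>Throughout, the space dimension d is \<open>CARD('n)\<close>, and functions and vector fields are
  real-valued.\<close>

section \<open>Lebesgue norms\<close>

text \<open>The norm takes the value \<open>\<infinity>\<close> when the integral diverges. It is only meaningful for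
  \<open>f\<close> measurable on \<open>\<Omega>\<close> and \<open>0 < p < \<infinity>\<close>.\<close>

definition Lp_norm :: "real \<Rightarrow> 'a::euclidean_space set \<Rightarrow> ('a \<Rightarrow> 'b::real_normed_vector) \<Rightarrow> ennreal" where
  "Lp_norm p \<Omega> f =
     (let I = (\<integral>\<^sup>+ x. ennreal (norm (f x) powr p) \<partial>lebesgue_on \<Omega>)
      in if I = \<infinity> then \<infinity> else ennreal (enn2real I powr (1 / p)))"

definition Lp_space :: "real \<Rightarrow> 'a::euclidean_space set \<Rightarrow> ('a \<Rightarrow> 'b::euclidean_space) set" where
  "Lp_space p \<Omega> = {f. f \<in> borel_measurable (lebesgue_on \<Omega>) \<and> Lp_norm p \<Omega> f < \<infinity>}"

section \<open>Test functions\<close>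

definition partial_deriv :: "'n \<Rightarrow> (real^'n \<Rightarrow> real) \<Rightarrow> real^'n \<Rightarrow> real" where
  "partial_deriv i f x = frechet_derivative f (at x) (axis i 1)"

definition gradient :: "(real^'n \<Rightarrow> real) \<Rightarrow> real^'n \<Rightarrow> real^'n" where
  "gradient f x = (\<chi> i. partial_deriv i f x)"

primrec k_times_cont_diff :: "nat \<Rightarrow> (real^'n \<Rightarrow> real) \<Rightarrow> bool" where
  "k_times_cont_diff 0 f \<longleftrightarrow> continuous_on UNIV f"
| "k_times_cont_diff (Suc k) f \<longleftrightarrow>
     (\<forall>x. f differentiable (at x)) \<and> (\<forall>i. k_times_cont_diff k (partial_deriv i f))"

text \<open>An element of $C_0^\infty(\Omega)$ is represented by its extension by zero to the whole space.\<close>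

definition test_functions :: "(real^'n) set \<Rightarrow> (real^'n \<Rightarrow> real) set" where
  "test_functions \<Omega> =
     {\<phi>. (\<forall>k. k_times_cont_diff k \<phi>) \<and>
         compact (closure {x. \<phi> x \<noteq> 0}) \<and> closure {x. \<phi> x \<noteq> 0} \<subseteq> \<Omega>}"

section \<open>The energy space and weak solutions\<close>

text \<open>
  An element of the completion of $C_0^\infty(\Omega)$ in the norm $\|\nabla\psi\|_{L^2(\Omega)}$ is
  the class of a gradient-Cauchy sequence \<open>\<psi>\<close> of test functions. It is realised as a function
  \<open>u\<close>, the limit of \<open>\<psi>\<close> in $L^1_{loc}(\Omega)$, together with its gradient \<open>g\<close>, the limit of
  the gradients of \<open>\<psi>\<close> in $L^2(\Omega)$. The field \<open>g\<close> is the weak gradient of \<open>u\<close> and hence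
  is determined almost everywhere by \<open>u\<close>. Convergence of \<open>\<psi>\<close> in $L^2(\Omega)$ is deliberately not
  required: on perforated domains it is a consequence of the Poincare inequality.
\<close>

definition W12_0_with_gradient ::
    "(real^'n) set \<Rightarrow> (real^'n \<Rightarrow> real) \<Rightarrow> (real^'n \<Rightarrow> real^'n) \<Rightarrow> bool" where
  "W12_0_with_gradient \<Omega> u g \<longleftrightarrow>
     u \<in> borel_measurable (lebesgue_on \<Omega>) \<and> g \<in> Lp_space 2 \<Omega> \<and>
     (\<exists>\<psi>. (\<forall>m::nat. \<psi> m \<in> test_functions \<Omega>) \<and>
          (\<lambda>m. Lp_norm 2 \<Omega> (\<lambda>x. gradient (\<psi> m) x - g x)) \<longlonglongrightarrow> 0 \<and>
          (\<forall>K. compact K \<and> K \<subseteq> \<Omega> \<longrightarrow>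
               (\<lambda>m. Lp_norm 1 K (\<lambda>x. \<psi> m x - u x)) \<longlonglongrightarrow> 0))"

text \<open>\<open>u\<close> belongs to $W^{1,2}_0(\Omega)$ and solves $-\Delta u = F$ weakly in \<open>\<Omega>\<close>.\<close>

definition weak_solution :: "(real^'n) set \<Rightarrow> (real^'n \<Rightarrow> real) \<Rightarrow> (real^'n \<Rightarrow> real) \<Rightarrow> bool" where
  "weak_solution \<Omega> F u \<longleftrightarrow>
     (\<exists>g. W12_0_with_gradient \<Omega> u g \<and>
          (\<forall>\<phi>\<in>test_functions \<Omega>.
             (LINT x|lebesgue_on \<Omega>. g x \<bullet> gradient \<phi> x) = (LINT x|lebesgue_on \<Omega>. F x * \<phi> x)))"

section \<open>Holes and perforated domains\<close>

text \<open>Near each boundary point, in coordinates with last axis along a unit vector \<open>e\<close>, the domain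
  is the part of a ball above the graph of a Lipschitz function \<open>h\<close> on the hyperplane
  orthogonal to \<open>e\<close>.\<close>

definition bounded_Lipschitz_domain :: "'a::euclidean_space set \<Rightarrow> bool" where
  "bounded_Lipschitz_domain D \<longleftrightarrow>
     open D \<and> connected D \<and> D \<noteq> {} \<and> bounded D \<and>
     (\<forall>z\<in>frontier D. \<exists>e r L h.
        norm e = 1 \<and> 0 < r \<and> L-lipschitz_on {y. y \<bullet> e = 0} h \<and>
        D \<inter> ball z r = {x \<in> ball z r. h (x - (x \<bullet> e) *\<^sub>R e) < x \<bullet> e})"

definition unit_cell :: "(real^'n) set" where
  "unit_cell = cbox (\<chi> i. - 1/2) (\<chi> i. 1/2)"

definition admissible_hole :: "real \<Rightarrow> (real^'n) set \<Rightarrow> bool" where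
  "admissible_hole c0 T \<longleftrightarrow>
     (\<exists>D. bounded_Lipschitz_domain D \<and> D \<subseteq> unit_cell \<and> T = closure D) \<and>
     connected (unit_cell - T) \<and> ball 0 c0 \<subseteq> T \<and>
     c0 \<le> setdist (frontier T) (frontier unit_cell)"

definition integer_lattice :: "(real^'n) set" where
  "integer_lattice = {k. \<forall>i. k $ i \<in> \<int>}"

definition perforated_domain :: "(real^'n) set \<Rightarrow> real \<Rightarrow> real \<Rightarrow> (real^'n) set" where
  "perforated_domain T \<epsilon> \<eta> =
     UNIV - (\<Union>k\<in>integer_lattice. (\<lambda>y. \<epsilon> *\<^sub>R (k + \<eta> *\<^sub>R y)) ` T)"

definition D_const :: "real \<Rightarrow> (real^'n) set \<Rightarrow> real \<Rightarrow> real \<Rightarrow> ennreal" where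
  "D_const p T \<epsilon> \<eta> =
     (let \<omega> = perforated_domain T \<epsilon> \<eta>
      in Sup {Lp_norm p \<omega> u | u F.
                F \<in> Lp_space p \<omega> \<inter> Lp_space 2 \<omega> \<and> Lp_norm p \<omega> F = 1 \<and> weak_solution \<omega> F u})"

end

theory Submission
  imports Defs "HOL-Real_Asymp.Real_Asymp"
begin

text \<open>
  Upper bound: integrating along rays shows that a smooth function vanishing near the lattice satisfies a Poincare
  inequality in every cell, with constant of the order of the claimed rate. Testing the equation with a regularised
  \<open>\<bar>u\<bar> powr (p - 2) * u\<close> and applying this inequality to \<open>\<bar>u\<bar> powr (p / 2)\<close> yields the bound for every \<open>p\<close> directly.

  Lower bound: by the variational characterisation of the energy, the solution whose source is the indicator of a large
  periodic set has an energy that is bounded below through any test function equal to \<open>1\<close> on that set. A rescaled cutoff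
  around each hole, averaged over dyadic scales in the plane, has an energy of the right order.
\<close>

section \<open>Smooth functions\<close>

text \<open>The two regimes of the rate have one source on each side. Above, it is the integral of
  t^(1-d) over [\<tau>, 1] with \<tau> of order \<eta>: logarithmic for d = 2, of order \<eta>^(2-d)
  otherwise. Below, it is the energy of a layer at scale r around a hole, of order r^(d-2): for d at
  least 3 the smallest scale is cheapest, while in the plane all dyadic scales cost the same. The
  obstacle above is that powers of \<open>u\<close> are not admissible in the weak formulation,
  which allows only smooth compactly supported test functions. The nonlinearity is therefore applied
  to the smooth approximants \<open>\<psi> m\<close>. The error made by replacing their gradients
  with \<open>g\<close> tends to 0 because the nonlinearity has a bounded derivative; this is why it
  is regularised both at 0 and at infinity. Fatou's lemma then removes the approximations in turn:
  first m tends to infinity at fixed \<delta>, then \<delta> tends to 0. The estimates see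
  \<open>T\<close> only through the ball of radius \<open>c0\<close> inside it and the cube of
  half-width \<open>1/2 - c0\<close> around it, so the constants are uniform in
  \<open>T\<close>.\<close>

lemma partial_deriv_eq:
  assumes "(f has_derivative f') (at x)"
  shows "partial_deriv i f x = f' (axis i 1)"
  using frechet_derivative_at[OF assms] by (simp add: partial_deriv_def)

lemma has_derivative_gradient:
  assumes "f differentiable (at x)"
  shows "(f has_derivative (\<lambda>h. gradient f x \<bullet> h)) (at x)"
proof -
  let ?D = "frechet_derivative f (at x)"
  have D: "(f has_derivative ?D) (at x)"
    using assms frechet_derivative_works by blast
  then have lin: "linear ?D" by (rule has_derivative_linear)
  have "?D h = gradient f x \<bullet> h" for h
  proof -
    have "?D h = ?D (\<Sum>i\<in>UNIV. h $ i *\<^sub>R axis i 1)"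
      by (subst basis_expansion[of h, symmetric]) (simp add: scalar_mult_eq_scaleR)
    also have "\<dots> = (\<Sum>i\<in>UNIV. h $ i * ?D (axis i 1))"
      by (simp add: linear_sum[OF lin] linear_scale[OF lin])
    finally show ?thesis
      by (simp add: gradient_def partial_deriv_def inner_vec_def mult.commute)
  qed
  then show ?thesis using D by (metis ext)
qed

lemma gradient_unique:
  assumes "(f has_derivative (\<lambda>h. v \<bullet> h)) (at x)"
  shows "gradient f x = v"
  by (simp add: vec_eq_iff gradient_def partial_deriv_eq[OF assms] inner_axis)

lemma k_times_cont_diff_Suc_imp:
  "k_times_cont_diff (Suc k) f \<Longrightarrow> k_times_cont_diff k f"
proof (induction k arbitrary: f)
  case 0
  then show ?case
    by (simp add: differentiable_imp_continuous_within continuous_at_imp_continuous_on)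
next
  case (Suc k)
  then show ?case by (metis k_times_cont_diff.simps(2))
qed

lemma k_times_cont_diff_const: "k_times_cont_diff k (\<lambda>x::real^'n. c)"
proof (induction k arbitrary: c)
  case (Suc k)
  have "partial_deriv i (\<lambda>x::real^'n. c) = (\<lambda>x. 0)" for i
    by (rule ext) (simp add: partial_deriv_eq[OF has_derivative_const])
  then show ?case using Suc by simp
qed simp

lemma k_times_cont_diff_coord: "k_times_cont_diff k (\<lambda>x::real^'n. x $ j)"
proof (cases k)
  case (Suc m)
  have D: "((\<lambda>x::real^'n. x $ j) has_derivative (\<lambda>h. h $ j)) (at x)" for x
    by (rule bounded_linear_imp_has_derivative) (rule bounded_linear_vec_nth)
  then have "partial_deriv i (\<lambda>x::real^'n. x $ j) = (\<lambda>x. axis i 1 $ j)" for i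
    by (intro ext partial_deriv_eq)
  then show ?thesis using Suc D k_times_cont_diff_const by (auto simp: differentiable_def)
qed (simp add: continuous_on_component)

lemma k_times_cont_diff_add:
  "k_times_cont_diff k f \<Longrightarrow> k_times_cont_diff k g \<Longrightarrow> k_times_cont_diff k (\<lambda>x. f x + g x)"
proof (induction k arbitrary: f g)
  case 0
  then show ?case by (simp add: continuous_on_add)
next
  case (Suc k)
  have "partial_deriv i (\<lambda>x. f x + g x) = (\<lambda>x. partial_deriv i f x + partial_deriv i g x)" for i
    using Suc.prems
    by (intro ext)
      (simp add: partial_deriv_eq[OF has_derivative_add[OF has_derivative_gradient has_derivative_gradient]]
        inner_axis gradient_def)
  then show ?case using Suc by simp
qed

lemma k_times_cont_diff_mult:
  "k_times_cont_diff k f \<Longrightarrow> k_times_cont_diff k g \<Longrightarrow> k_times_cont_diff k (\<lambda>x. f x * g x)"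
proof (induction k arbitrary: f g)
  case 0
  then show ?case by (simp add: continuous_on_mult)
next
  case (Suc k)
  have "partial_deriv i (\<lambda>x. f x * g x) =
      (\<lambda>x. f x * partial_deriv i g x + partial_deriv i f x * g x)" for i
    using Suc.prems
    by (intro ext)
      (simp add: partial_deriv_eq[OF has_derivative_mult[OF has_derivative_gradient has_derivative_gradient]]
        inner_axis gradient_def)
  moreover have "k_times_cont_diff k f" "k_times_cont_diff k g"
    using Suc.prems k_times_cont_diff_Suc_imp by blast+
  ultimately show ?case using Suc by (simp add: k_times_cont_diff_add)
qed

lemma k_times_cont_diff_diff:
  assumes "k_times_cont_diff k f" "k_times_cont_diff k g"
  shows "k_times_cont_diff k (\<lambda>x. f x - g x)"
  using k_times_cont_diff_add[OF assms(1) k_times_cont_diff_mult[OF k_times_cont_diff_const[of k "- 1"] assms(2)]]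
  by simp

lemma partial_deriv_compose:
  assumes "f differentiable (at x)" "(h has_real_derivative D) (at (f x))"
  shows "partial_deriv i (\<lambda>x. h (f x)) x = D * partial_deriv i f x"
    and "(\<lambda>x. h (f x)) differentiable (at x)"
    and "gradient (\<lambda>x. h (f x)) x = D *\<^sub>R gradient f x"
proof -
  have *: "((\<lambda>x. h (f x)) has_derivative (\<lambda>y. D * (gradient f x \<bullet> y))) (at x)"
    by (rule has_derivative_compose[OF has_derivative_gradient[OF assms(1)]])
       (use assms(2) in \<open>simp add: has_field_derivative_def\<close>)
  then show "partial_deriv i (\<lambda>x. h (f x)) x = D * partial_deriv i f x"
    by (simp add: partial_deriv_eq[OF *] inner_axis gradient_def)
  show "(\<lambda>x. h (f x)) differentiable (at x)" using * differentiable_def by blast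
  show "gradient (\<lambda>x. h (f x)) x = D *\<^sub>R gradient f x"
    by (rule gradient_unique) (use * in simp)
qed

text \<open>The exponent is generalised in the induction because each derivative lowers it by
  1.\<close>

lemma k_times_cont_diff_powr:
  "k_times_cont_diff k f \<Longrightarrow> (\<And>x. 0 < f x) \<Longrightarrow> k_times_cont_diff k (\<lambda>x. f x powr a)"
proof (induction k arbitrary: a)
  case 0
  then show ?case by (auto intro!: continuous_intros) (metis less_irrefl)
next
  case (Suc k)
  have d: "((\<lambda>y. y powr a) has_real_derivative a * f x powr (a - 1)) (at (f x))" for x
    using Suc.prems(2) by (intro has_real_derivative_powr)
  have "partial_deriv i (\<lambda>x. f x powr a) = (\<lambda>x. a * f x powr (a - 1) * partial_deriv i f x)" for i
    using Suc.prems(1) by (intro ext partial_deriv_compose(1)[OF _ d]) simp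
  moreover have "(\<lambda>x. f x powr a) differentiable (at x)" for x
    using Suc.prems(1) by (intro partial_deriv_compose(2)[OF _ d]) simp
  ultimately show ?case
    using Suc k_times_cont_diff_Suc_imp[OF Suc.prems(1)]
    by (auto intro!: k_times_cont_diff_mult k_times_cont_diff_const)
qed

text \<open>The derivatives of exp(-1/x), extended by 0, are combinations of these functions. The
  index \<open>j\<close> makes the family closed under differentiation, so one induction gives
  smoothness.\<close>

definition flat_function :: "nat \<Rightarrow> real \<Rightarrow> real" where
  "flat_function j x = (if x \<le> 0 then 0 else inverse x ^ j * exp (- inverse x))"

lemma flat_function_tendsto_0: "(flat_function j \<longlongrightarrow> 0) (at 0)"
proof -
  have "((\<lambda>x. inverse x ^ j * exp (- inverse x)) \<longlongrightarrow> (0::real)) (at_right 0)"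
    by real_asymp
  moreover have "eventually (\<lambda>x. flat_function j x = inverse x ^ j * exp (- inverse x)) (at_right 0)"
    by (simp add: eventually_at_filter flat_function_def)
  ultimately have "(flat_function j \<longlongrightarrow> 0) (at_right 0)"
    by (simp cong: filterlim_cong add: tendsto_cong)
  moreover have "(flat_function j \<longlongrightarrow> 0) (at_left 0)"
    by (rule tendsto_eventually) (simp add: eventually_at_filter flat_function_def)
  ultimately show ?thesis by (simp add: filterlim_split_at)
qed

lemma flat_function_deriv:
  "(flat_function j has_real_derivative
      flat_function (j + 2) x - real j * flat_function (j + 1) x) (at x)"
proof -
  consider "x < 0" | "x = 0" | "x > 0" by linarith
  then show ?thesis
  proof cases
    case 1
    have "((\<lambda>x. 0) has_real_derivative 0) (at x)" by simp
    then have "(flat_function j has_real_derivative 0) (at x)"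
      by (rule has_field_derivative_transform_within_open[of _ _ _ "{..<0}"])
        (use 1 in \<open>auto simp: flat_function_def\<close>)
    then show ?thesis using 1 by (simp add: flat_function_def)
  next
    case 2
    \<comment> \<open>The difference quotient at 0 is itself the next member of the family, whose
      limit at 0 is known.\<close>
    have "(\<lambda>h. flat_function j h / h) = flat_function (j + 1)"
      by (auto simp: flat_function_def fun_eq_iff divide_inverse mult_ac)
    then have "((\<lambda>h. (flat_function j (0 + h) - flat_function j 0) / h) \<longlongrightarrow> 0) (at 0)"
      using flat_function_tendsto_0[of "j + 1"] by (simp add: flat_function_def)
    then show ?thesis using 2 by (simp add: DERIV_def flat_function_def)
  next
    case 3
    have "((\<lambda>x. inverse x ^ j * exp (- inverse x)) has_real_derivative
        inverse x ^ (j + 2) * exp (- inverse x) - real j * (inverse x ^ (j + 1) * exp (- inverse x))) (at x)"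
      
    proof -
      have i: "(inverse has_real_derivative - (inverse x * inverse x)) (at x)"
        using DERIV_inverse[of x UNIV] 3 by (simp add: power2_eq_square)
      have e: "((\<lambda>x. exp (- inverse x)) has_real_derivative
          exp (- inverse x) * (inverse x * inverse x)) (at x)"
        using DERIV_fun_exp[OF DERIV_minus[OF i]] by simp
      show ?thesis
        using DERIV_mult[OF DERIV_power[OF i, of j] e] by (cases j) (simp_all add: algebra_simps)
    qed
    then have "(flat_function j has_real_derivative
        inverse x ^ (j + 2) * exp (- inverse x) - real j * (inverse x ^ (j + 1) * exp (- inverse x))) (at x)"
      by (rule has_field_derivative_transform_within_open[of _ _ _ "{0<..}"])
        (use 3 in \<open>auto simp: flat_function_def\<close>)
    then show ?thesis using 3 by (simp add: flat_function_def)
  qed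
qed

lemma k_times_cont_diff_flat_function:
  "k_times_cont_diff k f \<Longrightarrow> k_times_cont_diff k (\<lambda>x. flat_function j (f x))"
proof (induction k arbitrary: j)
  case 0
  have "continuous_on UNIV (flat_function j)"
    using flat_function_deriv by (intro continuous_at_imp_continuous_on ballI DERIV_isCont) auto
  then show ?case using 0 continuous_on_compose2[of UNIV "flat_function j" UNIV f] by auto
next
  case (Suc k)
  have "partial_deriv i (\<lambda>x. flat_function j (f x)) =
      (\<lambda>x. (flat_function (j + 2) (f x) - real j * flat_function (j + 1) (f x)) * partial_deriv i f x)" for i
    using Suc.prems
    by (intro ext) (subst partial_deriv_compose(1)[OF _ flat_function_deriv], simp_all)
  moreover have "(\<lambda>x. flat_function j (f x)) differentiable (at x)" for x
    using Suc.prems by (intro partial_deriv_compose(2)[OF _ flat_function_deriv]) simp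
  ultimately show ?case
    using Suc k_times_cont_diff_Suc_imp[OF Suc.prems(1)]
    by (auto intro!: k_times_cont_diff_mult k_times_cont_diff_const k_times_cont_diff_diff)
qed

section \<open>The class of smooth functions and its closure rules\<close>

definition smooth :: "(real^'n \<Rightarrow> real) \<Rightarrow> bool" where
  "smooth f \<longleftrightarrow> (\<forall>k. k_times_cont_diff k f)"

named_theorems smooth_intros

lemma smooth_const [smooth_intros]: "smooth (\<lambda>x. c)"
  and smooth_coord [smooth_intros]: "smooth (\<lambda>x. x $ i)"
  and smooth_add [smooth_intros]: "smooth f \<Longrightarrow> smooth g \<Longrightarrow> smooth (\<lambda>x. f x + g x)"
  and smooth_mult [smooth_intros]: "smooth f \<Longrightarrow> smooth g \<Longrightarrow> smooth (\<lambda>x. f x * g x)"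
  and smooth_powr [smooth_intros]: "smooth f \<Longrightarrow> (\<And>x. 0 < f x) \<Longrightarrow> smooth (\<lambda>x. f x powr a)"
  and smooth_flat_function [smooth_intros]: "smooth f \<Longrightarrow> smooth (\<lambda>x. flat_function j (f x))"
  by (simp_all add: smooth_def k_times_cont_diff_const k_times_cont_diff_coord k_times_cont_diff_add
      k_times_cont_diff_mult k_times_cont_diff_powr k_times_cont_diff_flat_function)

lemma smooth_diff [smooth_intros]: "smooth f \<Longrightarrow> smooth g \<Longrightarrow> smooth (\<lambda>x. f x - g x)"
  by (simp add: smooth_def k_times_cont_diff_diff)

lemma smooth_power [smooth_intros]: "smooth f \<Longrightarrow> smooth (\<lambda>x. f x ^ n)"
  by (induction n) (auto intro: smooth_intros)

lemma smooth_sum [smooth_intros]: "(\<And>i. i \<in> A \<Longrightarrow> smooth (f i)) \<Longrightarrow> smooth (\<lambda>x. \<Sum>i\<in>A. f i x)"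
  by (induction A rule: infinite_finite_induct) (auto intro: smooth_intros)

lemma smooth_prod [smooth_intros]: "(\<And>i. i \<in> A \<Longrightarrow> smooth (f i)) \<Longrightarrow> smooth (\<lambda>x. \<Prod>i\<in>A. f i x)"
  by (induction A rule: infinite_finite_induct) (auto intro: smooth_intros)

lemma smooth_differentiable: "smooth f \<Longrightarrow> f differentiable (at x)"
  unfolding smooth_def by (metis k_times_cont_diff.simps(2))

lemma smooth_continuous_on: "smooth f \<Longrightarrow> continuous_on S f"
  unfolding smooth_def by (metis k_times_cont_diff.simps(1) continuous_on_subset subset_UNIV)

lemma smooth_partial_deriv: "smooth f \<Longrightarrow> smooth (partial_deriv i f)"
  unfolding smooth_def by (metis k_times_cont_diff.simps(2))

lemma smooth_gradient_continuous_on: "smooth f \<Longrightarrow> continuous_on S (gradient f)"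
  unfolding gradient_def
  by (intro continuous_intros smooth_continuous_on smooth_partial_deriv)

lemma smooth_compose_affine: "smooth f \<Longrightarrow> smooth (\<lambda>x. f (c *\<^sub>R x + z))"
proof -
  have "k_times_cont_diff k f \<Longrightarrow> k_times_cont_diff k (\<lambda>x. f (c *\<^sub>R x + z))" for k
  proof (induction k arbitrary: f)
    case 0
    then show ?case by (auto intro!: continuous_on_compose2[of UNIV f] continuous_intros)
  next
    case (Suc k)
    have D: "((\<lambda>x. f (c *\<^sub>R x + z)) has_derivative (\<lambda>h. gradient f (c *\<^sub>R x + z) \<bullet> (c *\<^sub>R h))) (at x)" for x
      by (rule has_derivative_compose[OF _ has_derivative_gradient])
        (use Suc.prems in \<open>auto intro!: derivative_eq_intros\<close>)
    then have "partial_deriv i (\<lambda>x. f (c *\<^sub>R x + z)) = (\<lambda>x. c * partial_deriv i f (c *\<^sub>R x + z))" for i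
      by (intro ext) (simp add: partial_deriv_eq[OF D] gradient_def inner_axis)
    moreover have "(\<lambda>x. f (c *\<^sub>R x + z)) differentiable (at x)" for x
      using D differentiable_def by blast
    ultimately show ?case
      using Suc by (simp add: k_times_cont_diff_mult k_times_cont_diff_const)
  qed
  then show "smooth f \<Longrightarrow> smooth (\<lambda>x. f (c *\<^sub>R x + z))" by (simp add: smooth_def)
qed

lemma gradient_compose_affine:
  assumes "f differentiable (at (c *\<^sub>R x + z))"
  shows "gradient (\<lambda>x. f (c *\<^sub>R x + z)) x = c *\<^sub>R gradient f (c *\<^sub>R x + z)"
proof (rule gradient_unique)
  have "((\<lambda>x. f (c *\<^sub>R x + z)) has_derivative (\<lambda>h. gradient f (c *\<^sub>R x + z) \<bullet> (c *\<^sub>R h))) (at x)"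
    by (rule has_derivative_compose[of "\<lambda>x. c *\<^sub>R x + z" _ _ _ f, OF _ has_derivative_gradient[OF assms]])
      (auto intro!: derivative_eq_intros)
  then show "((\<lambda>x. f (c *\<^sub>R x + z)) has_derivative (\<lambda>h. (c *\<^sub>R gradient f (c *\<^sub>R x + z)) \<bullet> h)) (at x)"
    by simp
qed

section \<open>The Poincare inequality for functions vanishing near a lattice\<close>

lemma nn_integral_lborel_affine:
  fixes f :: "'a::euclidean_space \<Rightarrow> ennreal"
  assumes [measurable]: "f \<in> borel_measurable borel" and c: "c \<noteq> 0"
  shows "(\<integral>\<^sup>+x. f x \<partial>lborel) = ennreal (\<bar>c\<bar> ^ DIM('a)) * (\<integral>\<^sup>+x. f (t + c *\<^sub>R x) \<partial>lborel)"
  by (subst lborel_affine[OF c, of t])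
     (simp add: nn_integral_density nn_integral_distr nn_integral_cmult)

text \<open>Half open, so that the integer translates partition the space exactly and no null sets
  have to be discarded.\<close>

definition half_open_cell :: "(real^'n) set" where
  "half_open_cell = {x. \<forall>i. - 1/2 \<le> x $ i \<and> x $ i < 1/2}"

lemma half_open_cell_sets [measurable]: "half_open_cell \<in> sets borel"
proof -
  have "half_open_cell = (\<Inter>i. {x::real^'n. - 1/2 \<le> x $ i} \<inter> {x. x $ i < 1/2})"
    by (auto simp: half_open_cell_def)
  also have "\<dots> \<in> sets borel"
    by (intro sets.countable_INT'' sets.Int borel_closed borel_open closed_halfspace_component_ge_cart
        open_halfspace_component_lt_cart) auto
  finally show ?thesis .
qed

lemma norm_le_sqrt_card:
  fixes x :: "real^'n"
  assumes "\<And>i. \<bar>x $ i\<bar> \<le> r"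
  shows "norm x \<le> sqrt (CARD('n)) * r"
proof -
  have r: "0 \<le> r" using assms[of undefined] by linarith
  have "(norm x)\<^sup>2 = (\<Sum>i\<in>UNIV. (x $ i)\<^sup>2)"
    by (simp add: norm_vec_def L2_set_def sum_nonneg)
  also have "\<dots> \<le> (\<Sum>i\<in>(UNIV::'n set). r\<^sup>2)"
    using assms r by (intro sum_mono) (metis abs_le_square_iff abs_of_nonneg)
  also have "\<dots> = (sqrt (CARD('n)) * r)\<^sup>2" by (simp add: power_mult_distrib)
  finally show ?thesis by (rule power2_le_imp_le) (use r in simp)
qed

text \<open>The fundamental theorem of calculus along the segment from
  \<open>\<tau> *\<^sub>R y\<close> to \<open>y\<close>, followed by the Cauchy-Schwarz inequality
  with weight t^m. For m = d - 1 the weight matches the Jacobian that appears when the bound is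
  integrated over \<open>y\<close>, and its dual t^(-m) produces the constant
  \<open>A\<close>.\<close>

lemma radial_bound:
  fixes f :: "real^'n \<Rightarrow> real"
  assumes f: "\<And>x. f differentiable (at x)" "continuous_on UNIV (gradient f)"
    and \<tau>: "0 < \<tau>" "\<tau> \<le> 1" and zero: "f (\<tau> *\<^sub>R y) = 0"
    and A: "(\<integral>\<^sup>+t. ennreal (inverse t ^ m) * indicator {\<tau>..1} t \<partial>lborel) \<le> A"
  shows "ennreal ((f y)\<^sup>2) \<le>
    A * (\<integral>\<^sup>+t. ennreal (t ^ m * (norm y)\<^sup>2 * (norm (gradient f (t *\<^sub>R y)))\<^sup>2) * indicator {\<tau>..1} t \<partial>lborel)"
proof -
  let ?g = "\<lambda>t. gradient f (t *\<^sub>R y)"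
  let ?I = "indicator {\<tau>..1} :: real \<Rightarrow> ennreal"
  have cont: "continuous_on S ?g" for S
    by (intro continuous_on_compose2[OF f(2)] continuous_intros) auto
  have [measurable]: "?g \<in> borel_measurable borel"
    by (intro borel_measurable_continuous_onI cont)
  have deriv: "((\<lambda>t. f (t *\<^sub>R y)) has_vector_derivative ?g t \<bullet> y) (at t within {\<tau>..1})" for t
  proof -
    have "((\<lambda>t. f (t *\<^sub>R y)) has_derivative (\<lambda>h. ?g t \<bullet> (h *\<^sub>R y))) (at t within {\<tau>..1})"
      by (rule has_derivative_compose[of "\<lambda>t. t *\<^sub>R y" _ _ _ f, OF _ has_derivative_gradient[OF f(1)]])
        (auto intro!: derivative_eq_intros)
    then show ?thesis by (simp add: has_vector_derivative_def mult.commute)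
  qed
  have "has_bochner_integral lborel (\<lambda>t. indicator {\<tau>..1} t *\<^sub>R (?g t \<bullet> y)) (f (1 *\<^sub>R y) - f (\<tau> *\<^sub>R y))"
    by (rule has_bochner_integral_FTC_Icc[OF \<tau>(2) deriv]) (intro continuous_intros cont)
  then have hb: "has_bochner_integral lborel (\<lambda>t. indicator {\<tau>..1} t *\<^sub>R (?g t \<bullet> y)) (f y)"
    using zero by simp
  then have "ennreal \<bar>f y\<bar> \<le> (\<integral>\<^sup>+t. ennreal (norm (indicator {\<tau>..1} t *\<^sub>R (?g t \<bullet> y))) \<partial>lborel)"
    using integral_norm_bound_ennreal[of lborel "\<lambda>t. indicator {\<tau>..1} t *\<^sub>R (?g t \<bullet> y)"]
    by (simp add: has_bochner_integral_iff)
  \<comment> \<open>The factor 1 is split as t^(-m/2) times t^(m/2), one half for each factor of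
    Cauchy-Schwarz.\<close>
  also have "\<dots> \<le> (\<integral>\<^sup>+t. (ennreal (sqrt (inverse t ^ m)) * ?I t) *
      (ennreal (sqrt (t ^ m) * norm y * norm (?g t)) * ?I t) \<partial>lborel)"
  proof (rule nn_integral_mono)
    fix t :: real
    show "ennreal (norm (indicator {\<tau>..1} t *\<^sub>R (?g t \<bullet> y))) \<le>
      (ennreal (sqrt (inverse t ^ m)) * ?I t) * (ennreal (sqrt (t ^ m) * norm y * norm (?g t)) * ?I t)"
    proof (cases "t \<in> {\<tau>..1}")
      case True
      then have t: "0 < t" using \<tau> by simp
      then have "sqrt (inverse t ^ m) * (sqrt (t ^ m) * norm y * norm (?g t)) = norm (?g t) * norm y"
        by (simp add: real_sqrt_mult[symmetric] power_mult_distrib[symmetric] mult.assoc[symmetric])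
      then have "\<bar>?g t \<bullet> y\<bar> \<le> sqrt (inverse t ^ m) * (sqrt (t ^ m) * norm y * norm (?g t))"
        using Cauchy_Schwarz_ineq2[of "?g t" y] by linarith
      then show ?thesis using True t
        by (auto simp: ennreal_mult'[symmetric] intro!: ennreal_leI)
    qed simp
  qed
  finally have "(ennreal \<bar>f y\<bar>)\<^sup>2 \<le> \<dots>\<^sup>2" by (rule power_mono) simp
  also have "\<dots> \<le> (\<integral>\<^sup>+t. (ennreal (sqrt (inverse t ^ m)) * ?I t)\<^sup>2 \<partial>lborel) *
      (\<integral>\<^sup>+t. (ennreal (sqrt (t ^ m) * norm y * norm (?g t)) * ?I t)\<^sup>2 \<partial>lborel)"
    by (rule Cauchy_Schwarz_nn_integral) measurable
  also have "\<dots> \<le> A * (\<integral>\<^sup>+t. (ennreal (sqrt (t ^ m) * norm y * norm (?g t)) * ?I t)\<^sup>2 \<partial>lborel)"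
  proof (intro mult_right_mono)
    have "(\<integral>\<^sup>+t. (ennreal (sqrt (inverse t ^ m)) * ?I t)\<^sup>2 \<partial>lborel) =
        (\<integral>\<^sup>+t. ennreal (inverse t ^ m) * ?I t \<partial>lborel)"
      using \<tau> by (intro nn_integral_cong) (auto simp: ennreal_power split: split_indicator)
    then show "(\<integral>\<^sup>+t. (ennreal (sqrt (inverse t ^ m)) * ?I t)\<^sup>2 \<partial>lborel) \<le> A" using A by simp
  qed simp
  also have "(\<integral>\<^sup>+t. (ennreal (sqrt (t ^ m) * norm y * norm (?g t)) * ?I t)\<^sup>2 \<partial>lborel) =
      (\<integral>\<^sup>+t. ennreal (t ^ m * (norm y)\<^sup>2 * (norm (?g t))\<^sup>2) * ?I t \<partial>lborel)"
    using \<tau> by (intro nn_integral_cong) (auto simp: ennreal_power power_mult_distrib split: split_indicator)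
  finally show ?thesis by (simp add: ennreal_power)
qed

text \<open>The integral over the dilation parameter that remains in \<open>poincare_cell\<close>
  once the cell variable has been rescaled.\<close>

lemma nn_integral_inverse_cube:
  assumes "0 < s"
  shows "(\<integral>\<^sup>+t. ennreal (inverse t ^ 3) * indicator {s..} t \<partial>lborel) = ennreal (1 / (2 * s\<^sup>2))"
proof -
  have "(\<integral>\<^sup>+t. ennreal (inverse t ^ 3) * indicator {s..} t \<partial>lborel) = ennreal (0 - (- (inverse s ^ 2 / 2)))"
  proof (rule nn_integral_FTC_atLeast[where F = "\<lambda>t. - (inverse t ^ 2 / 2)"])
    show "((\<lambda>t. - (inverse t ^ 2 / 2)) has_real_derivative inverse t ^ 3) (at t)" if "s \<le> t" for t :: real
      using that assms by (auto intro!: derivative_eq_intros simp: field_simps power2_eq_square power3_eq_cube)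
    show "((\<lambda>t. - (inverse t ^ 2 / 2)) \<longlongrightarrow> (0::real)) at_top" by real_asymp
  qed (use assms in auto)
  then show ?thesis by (simp add: field_simps power_inverse)
qed

text \<open>The radial bound is integrated over the cell, and w = t y is substituted at fixed t. The
  powers of t combine to t^(d-1) t^(-2) t^(-d) = t^(-3), and w stays in the cell because the cell is
  star-shaped. The t-integral then starts at a multiple of norm w, so it cancels the factor (norm
  w)^2 and leaves d/8. Thus \<open>A\<close> is the only factor that depends on \<rho>.\<close>

lemma poincare_cell:
  fixes f :: "real^'n \<Rightarrow> real"
  assumes f: "\<And>x. f differentiable (at x)" "continuous_on UNIV (gradient f)"
    and \<rho>: "0 < \<rho>" "\<rho> \<le> 1" and zero: "\<And>x. x \<in> ball 0 \<rho> \<Longrightarrow> f x = 0"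
    and A: "(\<integral>\<^sup>+t. ennreal (inverse t ^ (CARD('n) - 1)) * indicator {\<rho> / CARD('n)..1} t \<partial>lborel) \<le> A"
  shows "(\<integral>\<^sup>+x. ennreal ((f x)\<^sup>2) * indicator half_open_cell x \<partial>lborel) \<le>
    A * ennreal (CARD('n) / 8) * (\<integral>\<^sup>+x. ennreal ((norm (gradient f x))\<^sup>2) * indicator half_open_cell x \<partial>lborel)"
proof -
  let ?d = "CARD('n)"
  let ?Q = "half_open_cell :: (real^'n) set"
  let ?h = "\<lambda>x. (norm (gradient f x))\<^sup>2"
  \<comment> \<open>On the cell, norm y is at most sqrt d / 2, hence at most d / 2; so
    \<open>\<tau> *\<^sub>R y\<close> lies in the ball where \<open>f\<close> vanishes.\<close>
  define \<tau> where "\<tau> = \<rho> / ?d"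
  have d1: "1 \<le> real ?d" by (simp add: Suc_le_eq)
  have \<tau>: "0 < \<tau>" "\<tau> \<le> 1" using \<rho> d1 by (auto simp: \<tau>_def intro: order_trans[of \<rho> 1])
  have contf: "continuous_on UNIV f"
    using f(1) differentiable_imp_continuous_within by (auto intro!: continuous_at_imp_continuous_on)
  have [measurable]: "f \<in> borel_measurable borel" "gradient f \<in> borel_measurable borel"
    by (intro borel_measurable_continuous_onI contf f(2))+
  have Qnorm: "norm x \<le> sqrt ?d / 2" if "x \<in> ?Q" for x
  proof -
    have "\<bar>x $ i\<bar> \<le> 1/2" for i
      using that[unfolded half_open_cell_def] by (auto simp: abs_le_iff dest!: spec[of _ i])
    then show ?thesis using norm_le_sqrt_card[of x "1/2"] by simp
  qed
  have pt: "ennreal ((f y)\<^sup>2) * indicator ?Q y \<le>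
      A * (\<integral>\<^sup>+t. ennreal (t ^ (?d - 1) * (norm y)\<^sup>2 * ?h (t *\<^sub>R y)) * indicator {\<tau>..1} t * indicator ?Q y \<partial>lborel)" for y
  proof (cases "y \<in> ?Q")
    case True
    have "sqrt ?d \<le> ?d" using d1 by (simp add: real_sqrt_le_iff' sqrt_le_D real_le_lsqrt power2_eq_square)
    then have "\<tau> * norm y \<le> \<tau> * (?d / 2)" using Qnorm[OF True] \<tau> by (intro mult_left_mono) auto
    also have "\<dots> < \<rho>" using \<rho> by (simp add: \<tau>_def)
    finally have "f (\<tau> *\<^sub>R y) = 0" using \<tau> by (intro zero) simp
    then show ?thesis using radial_bound[OF f \<tau> _ A[folded \<tau>_def]] True by simp
  qed simp
  have "(\<integral>\<^sup>+x. ennreal ((f x)\<^sup>2) * indicator ?Q x \<partial>lborel) \<le>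
      (\<integral>\<^sup>+y. A * (\<integral>\<^sup>+t. ennreal (t ^ (?d - 1) * (norm y)\<^sup>2 * ?h (t *\<^sub>R y)) * indicator {\<tau>..1} t * indicator ?Q y \<partial>lborel) \<partial>lborel)"
    by (intro nn_integral_mono pt)
  also have "\<dots> = A * (\<integral>\<^sup>+y. (\<integral>\<^sup>+t. ennreal (t ^ (?d - 1) * (norm y)\<^sup>2 * ?h (t *\<^sub>R y)) * indicator {\<tau>..1} t * indicator ?Q y \<partial>lborel) \<partial>lborel)"
    by (rule nn_integral_cmult) measurable
  also have "(\<integral>\<^sup>+y. (\<integral>\<^sup>+t. ennreal (t ^ (?d - 1) * (norm y)\<^sup>2 * ?h (t *\<^sub>R y)) * indicator {\<tau>..1} t * indicator ?Q y \<partial>lborel) \<partial>lborel) =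
      (\<integral>\<^sup>+t. (\<integral>\<^sup>+y. ennreal (t ^ (?d - 1) * (norm y)\<^sup>2 * ?h (t *\<^sub>R y)) * indicator {\<tau>..1} t * indicator ?Q y \<partial>lborel) \<partial>lborel)"
    by (rule lborel_pair.Fubini'[symmetric]) measurable
  \<comment> \<open>The substitution w = t y in the inner integral.\<close>
  also have "\<dots> = (\<integral>\<^sup>+t. (\<integral>\<^sup>+w. ennreal (?h w * ((norm w)\<^sup>2 * inverse t ^ 3)) * indicator {\<tau>..1} t *
      indicator ?Q (inverse t *\<^sub>R w) \<partial>lborel) \<partial>lborel)"
  proof (rule nn_integral_cong)
    fix t :: real
    show "(\<integral>\<^sup>+y. ennreal (t ^ (?d - 1) * (norm y)\<^sup>2 * ?h (t *\<^sub>R y)) * indicator {\<tau>..1} t * indicator ?Q y \<partial>lborel) =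
      (\<integral>\<^sup>+w. ennreal (?h w * ((norm w)\<^sup>2 * inverse t ^ 3)) * indicator {\<tau>..1} t * indicator ?Q (inverse t *\<^sub>R w) \<partial>lborel)"
    proof (cases "t \<in> {\<tau>..1}")
      case True
      then have t: "0 < t" using \<tau> by simp
      have d: "t ^ ?d = t * t ^ (?d - 1)" by (simp flip: power_Suc)
      have "(\<integral>\<^sup>+w. ennreal (?h w * ((norm w)\<^sup>2 * inverse t ^ 3)) * indicator {\<tau>..1} t * indicator ?Q (inverse t *\<^sub>R w) \<partial>lborel) =
        ennreal (t ^ ?d) * (\<integral>\<^sup>+w. ennreal (?h (t *\<^sub>R w) * ((norm (t *\<^sub>R w))\<^sup>2 * inverse t ^ 3)) * indicator {\<tau>..1} t * indicator ?Q (inverse t *\<^sub>R t *\<^sub>R w) \<partial>lborel)"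
        using t by (subst nn_integral_lborel_affine[where c = t and t = 0]) auto
      also have "\<dots> = (\<integral>\<^sup>+w. ennreal (t ^ ?d) * (ennreal (?h (t *\<^sub>R w) * ((norm (t *\<^sub>R w))\<^sup>2 * inverse t ^ 3)) * indicator {\<tau>..1} t * indicator ?Q (inverse t *\<^sub>R t *\<^sub>R w)) \<partial>lborel)"
        by (rule nn_integral_cmult[symmetric]) measurable
      also have "\<dots> = (\<integral>\<^sup>+y. ennreal (t ^ (?d - 1) * (norm y)\<^sup>2 * ?h (t *\<^sub>R y)) * indicator {\<tau>..1} t * indicator ?Q y \<partial>lborel)"
        using t unfolding d
        by (intro nn_integral_cong)
          (auto split: split_indicator simp: ennreal_mult'[symmetric] field_simps power2_eq_square power3_eq_cube)
      finally show ?thesis by simp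
    qed simp
  qed
  also have "\<dots> = (\<integral>\<^sup>+w. (\<integral>\<^sup>+t. ennreal (?h w * ((norm w)\<^sup>2 * inverse t ^ 3)) * indicator {\<tau>..1} t *
      indicator ?Q (inverse t *\<^sub>R w) \<partial>lborel) \<partial>lborel)"
    by (rule lborel_pair.Fubini'[symmetric]) measurable
  also have "\<dots> \<le> (\<integral>\<^sup>+w. ennreal (?d / 8) * (ennreal (?h w) * indicator ?Q w) \<partial>lborel)"
  proof (rule nn_integral_mono)
    fix w :: "real^'n"
    have scale: "w \<in> ?Q" if "inverse t *\<^sub>R w \<in> ?Q" "t \<in> {\<tau>..1}" for t
    proof -
      have "0 < t" using that \<tau> by simp
      then have "- t / 2 \<le> w $ i" "w $ i < t / 2" for i
        using that(1) by (auto simp: half_open_cell_def field_simps)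
      then have "- 1 / 2 \<le> w $ i \<and> w $ i < 1 / 2" for i
        using that(2) \<open>- t / 2 \<le> w $ i\<close> \<open>w $ i < t / 2\<close> unfolding atLeastAtMost_iff by linarith
      then show ?thesis by (simp add: half_open_cell_def)
    qed
    show "(\<integral>\<^sup>+t. ennreal (?h w * ((norm w)\<^sup>2 * inverse t ^ 3)) * indicator {\<tau>..1} t * indicator ?Q (inverse t *\<^sub>R w) \<partial>lborel)
      \<le> ennreal (?d / 8) * (ennreal (?h w) * indicator ?Q w)"
    proof (cases "w \<in> ?Q \<and> w \<noteq> 0")
      case True
      \<comment> \<open>If w / t lies in the cell, then norm w / t is at most sqrt d / 2, that is, t
        is at least \<open>s\<close>. With this \<open>s\<close>, (norm w)^2 / (2 s^2) = d /
        8.\<close>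
      define s where "s = 2 * norm w / sqrt ?d"
      have s: "0 < s" using True by (simp add: s_def)
      have "(\<integral>\<^sup>+t. ennreal (?h w * ((norm w)\<^sup>2 * inverse t ^ 3)) * indicator {\<tau>..1} t * indicator ?Q (inverse t *\<^sub>R w) \<partial>lborel)
        \<le> (\<integral>\<^sup>+t. ennreal (?h w * (norm w)\<^sup>2) * (ennreal (inverse t ^ 3) * indicator {s..} t) \<partial>lborel)"
      proof (rule nn_integral_mono)
        fix t :: real
        show "ennreal (?h w * ((norm w)\<^sup>2 * inverse t ^ 3)) * indicator {\<tau>..1} t * indicator ?Q (inverse t *\<^sub>R w) \<le>
          ennreal (?h w * (norm w)\<^sup>2) * (ennreal (inverse t ^ 3) * indicator {s..} t)"
        proof (cases "t \<in> {\<tau>..1} \<and> inverse t *\<^sub>R w \<in> ?Q")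
          case True
          then have t: "0 < t" using \<tau> by simp
          have "norm (inverse t *\<^sub>R w) \<le> sqrt ?d / 2" using True by (intro Qnorm) simp
          then have "s \<le> t" using t d1 by (simp add: s_def field_simps)
          then show ?thesis using True t
            by (simp add: ennreal_mult'[symmetric] mult_ac)
        qed auto
      qed
      also have "\<dots> = ennreal (?h w * (norm w)\<^sup>2) * ennreal (1 / (2 * s\<^sup>2))"
        by (subst nn_integral_cmult) (simp_all add: nn_integral_inverse_cube[OF s])
      also have "\<dots> = ennreal (?d / 8) * ennreal (?h w)"
        using True by (simp add: ennreal_mult'[symmetric] s_def power_divide power_mult_distrib field_simps)
      finally show ?thesis using True by simp
    next
      case False
      then have "(\<integral>\<^sup>+t. ennreal (?h w * ((norm w)\<^sup>2 * inverse t ^ 3)) * indicator {\<tau>..1} t * indicator ?Q (inverse t *\<^sub>R w) \<partial>lborel) =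
        (\<integral>\<^sup>+t. 0 \<partial>(lborel::real measure))"
        using scale by (intro nn_integral_cong) (auto split: split_indicator)
      then show ?thesis by simp
    qed
  qed
  also have "\<dots> = ennreal (?d / 8) * (\<integral>\<^sup>+w. ennreal (?h w) * indicator ?Q w \<partial>lborel)"
    by (rule nn_integral_cmult) measurable
  finally show ?thesis by (simp add: mult.assoc mult_left_mono)
qed

text \<open>The cell inequality has the same constant in every translated cell, so the inequalities
  can be summed over the lattice.\<close>

lemma poincare_lattice_unit:
  fixes f :: "real^'n \<Rightarrow> real"
  assumes f: "\<And>x. f differentiable (at x)" "continuous_on UNIV (gradient f)"
    and \<rho>: "0 < \<rho>" "\<rho> \<le> 1"
    and zero: "\<And>k x. k \<in> integer_lattice \<Longrightarrow> x \<in> ball k \<rho> \<Longrightarrow> f x = 0"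
    and A: "(\<integral>\<^sup>+t. ennreal (inverse t ^ (CARD('n) - 1)) * indicator {\<rho> / CARD('n)..1} t \<partial>lborel) \<le> A"
  shows "(\<integral>\<^sup>+x. ennreal ((f x)\<^sup>2) \<partial>lborel) \<le>
    A * ennreal (CARD('n) / 8) * (\<integral>\<^sup>+x. ennreal ((norm (gradient f x))\<^sup>2) \<partial>lborel)"
proof -
  let ?Q = "half_open_cell :: (real^'n) set"
  define v :: "('n \<Rightarrow> int) \<Rightarrow> real^'n" where "v k = (\<chi> i. of_int (k i))" for k
  have contf: "continuous_on UNIV f"
    using f(1) differentiable_imp_continuous_within by (auto intro!: continuous_at_imp_continuous_on)
  have [measurable]: "f \<in> borel_measurable borel" "gradient f \<in> borel_measurable borel"
    by (intro borel_measurable_continuous_onI contf f(2))+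
  have split: "(\<integral>\<^sup>+x. F x \<partial>lborel) =
      (\<integral>\<^sup>+k. (\<integral>\<^sup>+x. F (v k + x) * indicator ?Q x \<partial>lborel) \<partial>count_space UNIV)"
    if [measurable]: "F \<in> borel_measurable borel" for F :: "real^'n \<Rightarrow> ennreal"
  proof -
    have pt: "(\<integral>\<^sup>+k. F x * indicator ?Q (x - v k) \<partial>count_space UNIV) = F x" for x
    proof -
      \<comment> \<open>The index of the only translate of the half-open cell that contains
        \<open>x\<close>.\<close>
      define k0 where "k0 = (\<lambda>i. \<lfloor>x $ i + 1/2\<rfloor>)"
      have "x - v k \<in> ?Q \<longleftrightarrow> k = k0" for k
      proof -
        have "x - v k \<in> ?Q \<longleftrightarrow> (\<forall>i. of_int (k i) \<le> x $ i + 1/2 \<and> x $ i + 1/2 < of_int (k i) + 1)"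
          by (simp add: half_open_cell_def v_def) (rule all_cong1, linarith)
        also have "\<dots> \<longleftrightarrow> (\<forall>i. \<lfloor>x $ i + 1/2\<rfloor> = k i)" by (simp add: floor_eq_iff)
        finally show ?thesis by (auto simp: k0_def fun_eq_iff)
      qed
      then have "(\<integral>\<^sup>+k. F x * indicator ?Q (x - v k) \<partial>count_space UNIV) = (\<integral>\<^sup>+k. F x * indicator {k0} k \<partial>count_space UNIV)"
        by (intro nn_integral_cong) (auto split: split_indicator)
      then show ?thesis by (simp add: nn_integral_cmult)
    qed
    have "(\<integral>\<^sup>+x. F x \<partial>lborel) = (\<integral>\<^sup>+x. (\<integral>\<^sup>+k. F x * indicator ?Q (x - v k) \<partial>count_space UNIV) \<partial>lborel)"
      by (simp add: pt)
    also have "\<dots> = (\<integral>\<^sup>+k. (\<integral>\<^sup>+x. F x * indicator ?Q (x - v k) \<partial>lborel) \<partial>count_space UNIV)"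
      by (rule nn_integral_count_space_nn_integral) auto
    also have "\<dots> = (\<integral>\<^sup>+k. (\<integral>\<^sup>+x. F (v k + x) * indicator ?Q x \<partial>lborel) \<partial>count_space UNIV)"
    proof (rule nn_integral_cong)
      fix k
      show "(\<integral>\<^sup>+x. F x * indicator ?Q (x - v k) \<partial>lborel) = (\<integral>\<^sup>+x. F (v k + x) * indicator ?Q x \<partial>lborel)"
        by (subst nn_integral_lborel_affine[where c = 1 and t = "v k"]) auto
    qed
    finally show ?thesis .
  qed
  have cell: "(\<integral>\<^sup>+x. ennreal ((f (v k + x))\<^sup>2) * indicator ?Q x \<partial>lborel) \<le>
      A * ennreal (CARD('n) / 8) * (\<integral>\<^sup>+x. ennreal ((norm (gradient f (v k + x)))\<^sup>2) * indicator ?Q x \<partial>lborel)" for k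
  proof -
    let ?f = "\<lambda>x. f (1 *\<^sub>R x + v k)"
    have g: "gradient ?f = (\<lambda>x. gradient f (x + v k))"
      by (rule ext, subst gradient_compose_affine[OF f(1)]) simp
    have "(\<integral>\<^sup>+x. ennreal ((?f x)\<^sup>2) * indicator ?Q x \<partial>lborel) \<le>
      A * ennreal (CARD('n) / 8) * (\<integral>\<^sup>+x. ennreal ((norm (gradient ?f x))\<^sup>2) * indicator ?Q x \<partial>lborel)"
    proof (rule poincare_cell[OF _ _ \<rho> _ A])
      show "?f differentiable at x" for x
        by (rule differentiable_compose[of f "\<lambda>x. 1 *\<^sub>R x + v k"]) (auto intro!: f(1) derivative_intros)
      show "continuous_on UNIV (gradient ?f)" unfolding g
        by (intro continuous_on_compose2[OF f(2)] continuous_intros) auto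
      show "?f x = 0" if "x \<in> ball 0 \<rho>" for x
        using that by (intro zero[of "v k"]) (auto simp: v_def integer_lattice_def dist_norm)
    qed
    then show ?thesis unfolding g by (simp add: add.commute)
  qed
  have "(\<integral>\<^sup>+x. ennreal ((f x)\<^sup>2) \<partial>lborel) \<le> (\<integral>\<^sup>+k. A * ennreal (CARD('n) / 8) *
      (\<integral>\<^sup>+x. ennreal ((norm (gradient f (v k + x)))\<^sup>2) * indicator ?Q x \<partial>lborel) \<partial>count_space UNIV)"
    by (subst split) (auto intro!: nn_integral_mono cell)
  also have "\<dots> = A * ennreal (CARD('n) / 8) * (\<integral>\<^sup>+x. ennreal ((norm (gradient f x))\<^sup>2) \<partial>lborel)"
    by (subst (2) split) (auto simp: nn_integral_cmult)
  finally show ?thesis .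
qed

text \<open>Rescaling from spacing 1 to spacing \<epsilon>: the volume factors on both sides agree,
  and the squared gradient contributes \<epsilon>^2.\<close>

lemma poincare_lattice:
  fixes f :: "real^'n \<Rightarrow> real"
  assumes f: "\<And>x. f differentiable (at x)" "continuous_on UNIV (gradient f)"
    and \<rho>: "0 < \<rho>" "\<rho> \<le> 1" and \<epsilon>: "0 < \<epsilon>"
    and zero: "\<And>k x. k \<in> integer_lattice \<Longrightarrow> x \<in> ball (\<epsilon> *\<^sub>R k) (\<epsilon> * \<rho>) \<Longrightarrow> f x = 0"
    and A: "(\<integral>\<^sup>+t. ennreal (inverse t ^ (CARD('n) - 1)) * indicator {\<rho> / CARD('n)..1} t \<partial>lborel) \<le> A"
  shows "(\<integral>\<^sup>+x. ennreal ((f x)\<^sup>2) \<partial>lborel) \<le>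
    ennreal (\<epsilon>\<^sup>2) * (A * ennreal (CARD('n) / 8)) * (\<integral>\<^sup>+x. ennreal ((norm (gradient f x))\<^sup>2) \<partial>lborel)"
proof -
  let ?f = "\<lambda>x. f (\<epsilon> *\<^sub>R x + 0)"
  let ?e = "ennreal (\<epsilon> ^ CARD('n))"
  have contf: "continuous_on UNIV f"
    using f(1) differentiable_imp_continuous_within by (auto intro!: continuous_at_imp_continuous_on)
  have [measurable]: "f \<in> borel_measurable borel" "gradient f \<in> borel_measurable borel"
    by (intro borel_measurable_continuous_onI contf f(2))+
  have g: "gradient ?f = (\<lambda>x. \<epsilon> *\<^sub>R gradient f (\<epsilon> *\<^sub>R x))"
    by (rule ext, subst gradient_compose_affine[OF f(1)]) simp
  have scale: "(\<integral>\<^sup>+x. F x \<partial>lborel) = ?e * (\<integral>\<^sup>+x. F (\<epsilon> *\<^sub>R x) \<partial>lborel)"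
    if [measurable]: "F \<in> borel_measurable borel" for F :: "real^'n \<Rightarrow> ennreal"
    using \<epsilon> by (subst nn_integral_lborel_affine[where c = \<epsilon> and t = 0]) auto
  have "(\<integral>\<^sup>+x. ennreal ((?f x)\<^sup>2) \<partial>lborel) \<le>
    A * ennreal (CARD('n) / 8) * (\<integral>\<^sup>+x. ennreal ((norm (gradient ?f x))\<^sup>2) \<partial>lborel)"
  proof (rule poincare_lattice_unit[OF _ _ \<rho> _ A])
    show "?f differentiable at x" for x
      by (rule differentiable_compose[of f "\<lambda>x. \<epsilon> *\<^sub>R x + 0"]) (auto intro!: f(1) derivative_intros)
    show "continuous_on UNIV (gradient ?f)" unfolding g
      by (intro continuous_on_compose2[OF f(2)] continuous_intros) auto
    show "?f x = 0" if "k \<in> integer_lattice" "x \<in> ball k \<rho>" for k x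
    proof (rule zero[OF that(1)])
      have "dist (\<epsilon> *\<^sub>R k) (\<epsilon> *\<^sub>R x) = \<epsilon> * dist k x"
        using \<epsilon> by (simp add: dist_norm flip: scaleR_diff_right)
      then show "\<epsilon> *\<^sub>R x + 0 \<in> ball (\<epsilon> *\<^sub>R k) (\<epsilon> * \<rho>)" using that(2) \<epsilon> by simp
    qed
  qed
  also have "(\<integral>\<^sup>+x. ennreal ((norm (gradient ?f x))\<^sup>2) \<partial>lborel) =
      (\<integral>\<^sup>+x. ennreal (\<epsilon>\<^sup>2) * ennreal ((norm (gradient f (\<epsilon> *\<^sub>R x)))\<^sup>2) \<partial>lborel)"
    unfolding g by (simp add: power_mult_distrib ennreal_mult)
  also have "\<dots> = ennreal (\<epsilon>\<^sup>2) * (\<integral>\<^sup>+x. ennreal ((norm (gradient f (\<epsilon> *\<^sub>R x)))\<^sup>2) \<partial>lborel)"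
    by (rule nn_integral_cmult) measurable
  finally have "?e * (\<integral>\<^sup>+x. ennreal ((f (\<epsilon> *\<^sub>R x))\<^sup>2) \<partial>lborel) \<le> ?e * (A * ennreal (CARD('n) / 8) *
     (ennreal (\<epsilon>\<^sup>2) * (\<integral>\<^sup>+x. ennreal ((norm (gradient f (\<epsilon> *\<^sub>R x)))\<^sup>2) \<partial>lborel)))"
    by (simp add: mult_left_mono)
  also have "\<dots> = ennreal (\<epsilon>\<^sup>2) * (A * ennreal (CARD('n) / 8)) *
      (?e * (\<integral>\<^sup>+x. ennreal ((norm (gradient f (\<epsilon> *\<^sub>R x)))\<^sup>2) \<partial>lborel))"
    by (simp only: mult_ac)
  finally show ?thesis
    by (simp only: scale[of "\<lambda>x. ennreal ((f x)\<^sup>2)", symmetric, simplified]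
        scale[of "\<lambda>x. ennreal ((norm (gradient f x))\<^sup>2)", symmetric, simplified])
qed

section \<open>Perforated domains\<close>

lemma test_functions_iff:
  "\<phi> \<in> test_functions \<Omega> \<longleftrightarrow>
    smooth \<phi> \<and> compact (closure {x. \<phi> x \<noteq> 0}) \<and> closure {x. \<phi> x \<noteq> 0} \<subseteq> \<Omega>"
  by (simp add: test_functions_def smooth_def)

lemma test_functions_smooth: "\<phi> \<in> test_functions \<Omega> \<Longrightarrow> smooth \<phi>"
  by (simp add: test_functions_iff)

lemma test_functionsI:
  assumes "smooth \<phi>" "compact S" "S \<subseteq> \<Omega>" "\<And>x. \<phi> x \<noteq> 0 \<Longrightarrow> x \<in> S"
  shows "\<phi> \<in> test_functions \<Omega>"
proof -
  have "closure {x. \<phi> x \<noteq> 0} \<subseteq> S"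
    using assms by (intro closure_minimal compact_imp_closed) auto
  then show ?thesis
    using assms compact_Int_closed[OF assms(2) closed_closure, of "{x. \<phi> x \<noteq> 0}"]
    by (auto simp: test_functions_iff Int_absorb1)
qed

lemma test_functions_support:
  assumes "\<phi> \<in> test_functions \<Omega>"
  obtains S where "compact S" "S \<subseteq> \<Omega>" "\<And>x. x \<notin> S \<Longrightarrow> \<phi> x = 0" "\<And>x. x \<notin> S \<Longrightarrow> gradient \<phi> x = 0"
proof
  let ?S = "closure {x. \<phi> x \<noteq> 0}"
  show "compact ?S" "?S \<subseteq> \<Omega>" using assms by (auto simp: test_functions_iff)
  show "\<phi> x = 0" if "x \<notin> ?S" for x
    using that closure_subset[of "{x. \<phi> x \<noteq> 0}"] by auto
  show "gradient \<phi> x = 0" if "x \<notin> ?S" for x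
  proof (rule gradient_unique)
    have "((\<lambda>x. 0) has_derivative (\<lambda>h. 0 \<bullet> h)) (at x)" by simp
    then show "(\<phi> has_derivative (\<lambda>h. 0 \<bullet> h)) (at x)"
      by (rule has_derivative_transform_within_open[of _ _ _ _ "- ?S"])
        (use that closure_subset[of "{x. \<phi> x \<noteq> 0}"] in auto)
  qed
qed

lemma test_functions_zero_outside:
  assumes "\<phi> \<in> test_functions \<Omega>" "x \<notin> \<Omega>"
  shows "\<phi> x = 0" "gradient \<phi> x = 0"
  using assms by (metis test_functions_support subsetD)+

lemma test_functions_compose:
  assumes "\<phi> \<in> test_functions \<Omega>" "smooth (\<lambda>x. h (\<phi> x))" "h 0 = 0"
  shows "(\<lambda>x. h (\<phi> x)) \<in> test_functions \<Omega>"
proof -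
  obtain S where "compact S" "S \<subseteq> \<Omega>" "\<And>x. x \<notin> S \<Longrightarrow> \<phi> x = 0"
    using test_functions_support[OF assms(1)] by metis
  then show ?thesis using assms(2,3) by (intro test_functionsI[of _ S]) metis+
qed

lemma test_functions_lincomb:
  assumes "\<phi> \<in> test_functions \<Omega>" "\<psi> \<in> test_functions \<Omega>"
  shows "(\<lambda>x. a * \<phi> x + b * \<psi> x) \<in> test_functions \<Omega>"
    and "gradient (\<lambda>x. a * \<phi> x + b * \<psi> x) = (\<lambda>x. a *\<^sub>R gradient \<phi> x + b *\<^sub>R gradient \<psi> x)"
proof -
  obtain S where S: "compact S" "S \<subseteq> \<Omega>" "\<And>x. x \<notin> S \<Longrightarrow> \<phi> x = 0"
    using test_functions_support[OF assms(1)] by metis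
  obtain S' where S': "compact S'" "S' \<subseteq> \<Omega>" "\<And>x. x \<notin> S' \<Longrightarrow> \<psi> x = 0"
    using test_functions_support[OF assms(2)] by metis
  note sm = test_functions_smooth[OF assms(1)] test_functions_smooth[OF assms(2)]
  show "(\<lambda>x. a * \<phi> x + b * \<psi> x) \<in> test_functions \<Omega>"
  proof (rule test_functionsI[of _ "S \<union> S'"])
    show "x \<in> S \<union> S'" if "a * \<phi> x + b * \<psi> x \<noteq> 0" for x
      using that S(3)[of x] S'(3)[of x] by force
  qed (use S S' sm in \<open>auto intro!: smooth_intros\<close>)
  have "((\<lambda>x. a * \<phi> x + b * \<psi> x) has_derivative
      (\<lambda>h. (a *\<^sub>R gradient \<phi> x + b *\<^sub>R gradient \<psi> x) \<bullet> h)) (at x)" for x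
    by (auto intro!: derivative_eq_intros has_derivative_gradient smooth_differentiable sm
        simp: inner_add_left)
  then show "gradient (\<lambda>x. a * \<phi> x + b * \<psi> x) = (\<lambda>x. a *\<^sub>R gradient \<phi> x + b *\<^sub>R gradient \<psi> x)"
    by (intro ext gradient_unique)
qed

lemma borel_measurable_smooth:
  assumes "smooth \<phi>"
  shows "\<phi> \<in> borel_measurable borel" "gradient \<phi> \<in> borel_measurable borel"
  using assms by (auto intro!: borel_measurable_continuous_onI smooth_continuous_on smooth_gradient_continuous_on)

text \<open>For the coordinate bound, walk from a point of \<open>T\<close> straight to the nearer
  face of the unit cell in direction \<open>i\<close>. The walk meets the frontier of
  \<open>T\<close>, and from there at least \<open>c0\<close> remains to the face.\<close>

lemma admissible_holeD:
  fixes T :: "(real^'n) set"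
  assumes "admissible_hole c0 T" "0 < c0"
  shows "compact T" "ball 0 c0 \<subseteq> T"
    and "\<And>x i. x \<in> T \<Longrightarrow> \<bar>x $ i\<bar> \<le> 1/2 - c0"
proof -
  from assms(1) obtain D where D: "bounded_Lipschitz_domain D" "D \<subseteq> unit_cell" "T = closure D"
    and b: "ball 0 c0 \<subseteq> T" and dist: "c0 \<le> setdist (frontier T) (frontier (unit_cell :: (real^'n) set))"
    by (auto simp: admissible_hole_def)
  show "compact T" using D by (simp add: bounded_Lipschitz_domain_def)
  show "ball 0 c0 \<subseteq> T" by (rule b)
  let ?Y = "unit_cell :: (real^'n) set"
  have Y: "x \<in> ?Y \<longleftrightarrow> (\<forall>i. \<bar>x $ i\<bar> \<le> 1/2)" for x
    by (simp add: unit_cell_def mem_box_cart) (rule all_cong1, linarith)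
  have clY: "closed ?Y" unfolding unit_cell_def by (rule closed_cbox)
  have TY: "T \<subseteq> ?Y" using D closure_minimal[OF _ clY] by simp
  have clT: "closed T" using D by simp
  have edge: "z \<in> frontier ?Y" if "z \<in> ?Y" "\<bar>z $ i\<bar> = 1/2" for z i
  proof -
    have "z \<notin> interior ?Y"
    proof
      assume "z \<in> interior ?Y"
      then have "\<bar>z $ i\<bar> < 1/2"
        unfolding unit_cell_def interior_cbox mem_box_cart(1) by (auto simp: abs_less_iff dest!: spec[of _ i])
      then show False using that by simp
    qed
    then show ?thesis using that clY by (simp add: frontier_def closure_closed)
  qed
  fix x :: "real^'n" and i assume x: "x \<in> T"
  \<comment> \<open>The orthogonal projection of \<open>x\<close> onto the nearer face in direction
    \<open>i\<close>.\<close>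
  define z where "z = (\<chi> j. if j = i then (if x $ i \<ge> 0 then 1/2 else - 1/2) else x $ j)"
  have xY: "x \<in> ?Y" using x TY by auto
  have zY: "z \<in> ?Y" using xY unfolding Y z_def by auto
  have z: "z \<in> frontier ?Y" by (rule edge[OF zY, of i]) (simp add: z_def)
  have zx: "dist x z = 1/2 - \<bar>x $ i\<bar>"
  proof -
    have "x - z = axis i (x $ i - z $ i)" by (auto simp: vec_eq_iff z_def axis_def)
    then have "dist x z = \<bar>x $ i - z $ i\<bar>" by (simp add: dist_norm norm_eq_sqrt_inner inner_axis)
    also have "\<dots> = 1/2 - \<bar>x $ i\<bar>" using xY unfolding Y by (auto simp: z_def abs_if dest!: spec[of _ i])
    finally show ?thesis .
  qed
  have zT: "z \<notin> interior T"
    using interior_mono[OF TY] z by (auto simp: frontier_def)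
  \<comment> \<open>Either the end point \<open>z\<close> is itself in \<open>T\<close>, and then on
    its frontier because it is not interior, or the connected segment joins a point of
    \<open>T\<close> to a point outside.\<close>
  have "\<exists>y \<in> closed_segment x z. y \<in> frontier T"
  proof (cases "z \<in> T")
    case True
    then show ?thesis using zT clT by (intro bexI[of _ z]) (auto simp: frontier_def closure_closed)
  next
    case False
    have "closed_segment x z \<inter> frontier T \<noteq> {}"
      by (rule connected_Int_frontier) (use x False in \<open>auto\<close>)
    then show ?thesis by auto
  qed
  then obtain y where y: "y \<in> closed_segment x z" "y \<in> frontier T" by auto
  have "c0 \<le> dist y z"
    using dist setdist_le_dist[OF y(2) z] by linarith
  also have "\<dots> \<le> dist x z"
    using dist_in_closed_segment[OF y(1)] by (simp add: dist_commute)
  finally show "\<bar>x $ i\<bar> \<le> 1/2 - c0" using zx by linarith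
qed

section \<open>The perforated domain and the growth rate\<close>

lemma perforated_domain_iff:
  "x \<in> perforated_domain T \<epsilon> \<eta> \<longleftrightarrow> (\<forall>k\<in>integer_lattice. \<forall>y\<in>T. x \<noteq> \<epsilon> *\<^sub>R k + (\<epsilon> * \<eta>) *\<^sub>R y)"
  by (auto simp: perforated_domain_def algebra_simps)

text \<open>The union of infinitely many holes is closed because it is the sum of a closed set (the
  scaled lattice) and a compact set (the scaled hole).\<close>

lemma open_perforated_domain:
  fixes T :: "(real^'n) set"
  assumes "compact T"
  shows "open (perforated_domain T \<epsilon> \<eta>)"
proof -
  have "closed ((\<lambda>k. \<epsilon> *\<^sub>R k) ` (integer_lattice :: (real^'n) set))"
  proof (rule closed_scaling)
    have *: "integer_lattice = (\<Inter>i. (\<lambda>x::real^'n. x $ i) -` \<int>)"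
      by (auto simp: integer_lattice_def)
    show "closed (integer_lattice :: (real^'n) set)"
      unfolding * by (intro closed_INT ballI closed_vimage closed_Ints continuous_on_component continuous_on_id)
  qed
  then have "closed (\<Union>x\<in>(\<lambda>k. \<epsilon> *\<^sub>R k) ` (integer_lattice :: (real^'n) set). \<Union>y\<in>(\<lambda>y. (\<epsilon> * \<eta>) *\<^sub>R y) ` T. {x + y})"
    by (rule closed_compact_sums) (rule compact_scaling[OF assms])
  moreover have "perforated_domain T \<epsilon> \<eta> =
      - (\<Union>x\<in>(\<lambda>k. \<epsilon> *\<^sub>R k) ` (integer_lattice :: (real^'n) set). \<Union>y\<in>(\<lambda>y. (\<epsilon> * \<eta>) *\<^sub>R y) ` T. {x + y})"
    unfolding set_eq_iff perforated_domain_iff Compl_iff UN_iff by blast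
  ultimately show ?thesis by (simp only: open_Compl)
qed

lemma ball_disjoint_perforated_domain:
  assumes "ball 0 c0 \<subseteq> T" "0 < \<epsilon>" "0 < \<eta>" "k \<in> integer_lattice" "x \<in> ball (\<epsilon> *\<^sub>R k) (\<epsilon> * (\<eta> * c0))"
  shows "x \<notin> perforated_domain T \<epsilon> \<eta>"
proof -
  define y where "y = (1 / (\<epsilon> * \<eta>)) *\<^sub>R (x - \<epsilon> *\<^sub>R k)"
  have "norm y < c0"
    using assms by (simp add: y_def dist_norm norm_minus_commute divide_simps mult_ac)
  then have "y \<in> T" using assms(1) by auto
  moreover have "x = \<epsilon> *\<^sub>R k + (\<epsilon> * \<eta>) *\<^sub>R y" using assms by (simp add: y_def)
  ultimately show ?thesis using assms(4) perforated_domain_iff by blast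
qed

text \<open>Both regimes in one expression, so that the argument is run once for all dimensions. The
  2 inside the logarithm keeps the planar rate positive at \<eta> = 1.\<close>

definition rate :: "nat \<Rightarrow> real \<Rightarrow> real \<Rightarrow> real" where
  "rate d \<epsilon> \<eta> = (if d = 2 then \<epsilon>\<^sup>2 * \<bar>ln (\<eta> / 2)\<bar> else \<epsilon>\<^sup>2 * \<eta> powi (2 - int d))"

lemma rate_pos: "0 < \<epsilon> \<Longrightarrow> 0 < \<eta> \<Longrightarrow> \<eta> \<le> 1 \<Longrightarrow> 0 < rate d \<epsilon> \<eta>"
  using ln_less_zero[of "\<eta> / 2"] by (auto simp: rate_def mult_pos_neg)

text \<open>This is where the logarithm separates from the power: the antiderivative of t^(1-d) is
  ln t for d = 2 and a multiple of t^(2-d) otherwise. For larger d the factor 1/(d-2) is bounded by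
  1.\<close>

lemma radial_weight_bound:
  assumes "2 \<le> d" "0 < \<tau>" "\<tau> \<le> 1"
  shows "(\<integral>\<^sup>+t. ennreal (inverse t ^ (d - 1)) * indicator {\<tau>..1} t \<partial>lborel)
    \<le> ennreal (if d = 2 then ln (1 / \<tau>) else inverse \<tau> ^ (d - 2))"
proof (cases "d = 2")
  case True
  have "(\<integral>\<^sup>+t. ennreal (inverse t ^ (d - 1)) * indicator {\<tau>..1} t \<partial>lborel) = ennreal (ln 1 - ln \<tau>)"
    using True assms(2,3)
    by (intro nn_integral_FTC_Icc) (auto intro!: derivative_eq_intros simp: divide_inverse)
  then show ?thesis using True assms by (simp add: ln_div)
next
  case False
  then obtain e where e: "d = e + 3" using assms(1) by (metis add.commute le_Suc_ex numeral_2_eq_2 numeral_3_eq_3 not_less_eq_eq le_antisym)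
  let ?F = "\<lambda>t::real. - (inverse t ^ (e + 1) / (e + 1))"
  have "(\<integral>\<^sup>+t. ennreal (inverse t ^ (d - 1)) * indicator {\<tau>..1} t \<partial>lborel) = ennreal (?F 1 - ?F \<tau>)"
  proof (rule nn_integral_FTC_Icc)
    fix t :: real assume t: "t \<in> {\<tau>..1}"
    then have i: "(inverse has_real_derivative - (inverse t * inverse t)) (at t)"
      using DERIV_inverse[of t UNIV] assms by (simp add: power2_eq_square)
    show "(?F has_real_derivative inverse t ^ (d - 1)) (at t)"
      using DERIV_minus[OF DERIV_cdivide[OF DERIV_power[OF i, of "e + 1"], of "real (e + 1)"]]
      by (simp add: e power_add power2_eq_square numeral_2_eq_2 mult_ac del: of_nat_add of_nat_Suc)
    show "0 \<le> inverse t ^ (d - 1)" using t assms by auto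
  qed (use assms in auto)
  also have "\<dots> \<le> ennreal (inverse \<tau> ^ (e + 1))"
  proof (rule ennreal_leI)
    have "inverse \<tau> ^ (e + 1) / (e + 1) \<le> inverse \<tau> ^ (e + 1) / 1"
      using assms by (intro divide_left_mono) auto
    moreover have "0 \<le> inverse (1::real) ^ (e + 1) / (e + 1)" by simp
    ultimately show "?F 1 - ?F \<tau> \<le> inverse \<tau> ^ (e + 1)" by linarith
  qed
  finally show ?thesis using e by simp
qed

text \<open>A test function vanishes on the holes, hence on balls of radius \<epsilon> \<eta>
  \<open>c0\<close> around the lattice points, which is the setting of
  \<open>poincare_lattice\<close>.\<close>

lemma poincare_perforated:
  assumes d: "2 \<le> CARD('n::finite)" and c0: "0 < c0"
  obtains C where "0 < C"
    "\<And>(T :: (real^'n) set) \<epsilon> \<eta> \<psi>. admissible_hole c0 T \<Longrightarrow> 0 < \<epsilon> \<Longrightarrow> 0 < \<eta> \<Longrightarrow> \<eta> \<le> 1 \<Longrightarrow>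
      \<psi> \<in> test_functions (perforated_domain T \<epsilon> \<eta>) \<Longrightarrow>
      (\<integral>\<^sup>+x. ennreal ((\<psi> x)\<^sup>2) \<partial>lborel) \<le>
        ennreal (C * rate (CARD('n)) \<epsilon> \<eta>) * (\<integral>\<^sup>+x. ennreal ((norm (gradient \<psi> x))\<^sup>2) \<partial>lborel)"
proof
  let ?d = "CARD('n)"
  \<comment> \<open>Capped at 1 so that \<rho> = \<eta> \<open>c1\<close> is at most 1.\<close>
  define c1 where "c1 = min c0 1"
  \<comment> \<open>Compares the weight integral with the rate. In the plane it equals ln (2 /
    \<open>c1\<close>) - ln \<eta>, and the constant ln (2 / \<open>c1\<close>) is absorbed because
    the absolute value of ln (\<eta> / 2) is at least ln 2.\<close>
  define C1 where "C1 = (if ?d = 2 then 1 + \<bar>ln (?d / c1)\<bar> / ln 2 else (?d / c1) ^ (?d - 2))"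
  have c1: "0 < c1" "c1 \<le> 1" "c1 \<le> c0" using c0 by (auto simp: c1_def)
  have C1: "0 < C1" unfolding C1_def using c1 d by (auto intro: add_pos_nonneg)
  show "0 < C1 * (?d / 8)" using C1 by simp
  fix T :: "(real^'n) set" and \<epsilon> \<eta> \<psi>
  assume T: "admissible_hole c0 T" and \<epsilon>: "0 < \<epsilon>" and \<eta>: "0 < \<eta>" "\<eta> \<le> 1"
    and \<psi>: "\<psi> \<in> test_functions (perforated_domain T \<epsilon> \<eta>)"
  define \<rho> where "\<rho> = \<eta> * c1"
  have \<rho>: "0 < \<rho>" "\<rho> \<le> 1" using \<eta> c1 by (auto simp: \<rho>_def mult_le_one)
  define \<tau> where "\<tau> = \<rho> / ?d"
  have \<tau>: "0 < \<tau>" "\<tau> \<le> 1" using \<rho> d by (auto simp: \<tau>_def intro: order_trans[of \<rho> 1])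
  define A where "A = (if ?d = 2 then ln (1 / \<tau>) else inverse \<tau> ^ (?d - 2))"
  have A0: "0 \<le> A" using \<tau> by (simp add: A_def)
  have A: "\<epsilon>\<^sup>2 * A \<le> C1 * rate ?d \<epsilon> \<eta>"
  proof (cases "?d = 2")
    case True
    have "ln (1 / \<tau>) = ln (2 / c1) - ln \<eta>"
      using \<eta> c1 True by (simp add: \<tau>_def \<rho>_def ln_div ln_mult)
    also have "\<dots> \<le> \<bar>ln (2 / c1)\<bar> * (\<bar>ln (\<eta> / 2)\<bar> / ln 2) + \<bar>ln (\<eta> / 2)\<bar>"
    proof -
      have l: "\<bar>ln (\<eta> / 2)\<bar> = ln 2 - ln \<eta>" "ln \<eta> \<le> 0" using \<eta> by (auto simp: ln_div)
      then have "1 \<le> \<bar>ln (\<eta> / 2)\<bar> / ln 2" by simp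
      then have "\<bar>ln (2 / c1)\<bar> * 1 \<le> \<bar>ln (2 / c1)\<bar> * (\<bar>ln (\<eta> / 2)\<bar> / ln 2)"
        by (rule mult_left_mono) simp
      moreover have "0 < ln (2::real)" by simp
      ultimately show ?thesis using l by linarith
    qed
    finally have "ln (1 / \<tau>) \<le> C1 * \<bar>ln (\<eta> / 2)\<bar>"
      using True by (simp add: C1_def algebra_simps)
    then have "\<epsilon>\<^sup>2 * ln (1 / \<tau>) \<le> \<epsilon>\<^sup>2 * (C1 * \<bar>ln (\<eta> / 2)\<bar>)" by (rule mult_left_mono) simp
    then show ?thesis using True by (simp add: A_def rate_def mult_ac)
  next
    case False
    have "\<eta> powi (2 - int ?d) = inverse \<eta> ^ (?d - 2)"
      using d by (simp add: power_int_def nat_diff_distrib)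
    then show ?thesis using False \<epsilon>
      by (simp add: A_def rate_def C1_def \<tau>_def \<rho>_def power_mult_distrib power_divide field_simps)
  qed
  have sm: "smooth \<psi>" by (rule test_functions_smooth[OF \<psi>])
  have "(\<integral>\<^sup>+x. ennreal ((\<psi> x)\<^sup>2) \<partial>lborel) \<le>
    ennreal (\<epsilon>\<^sup>2) * (ennreal A * ennreal (?d / 8)) * (\<integral>\<^sup>+x. ennreal ((norm (gradient \<psi> x))\<^sup>2) \<partial>lborel)"
  proof (rule poincare_lattice[OF smooth_differentiable[OF sm] smooth_gradient_continuous_on[OF sm] \<rho> \<epsilon>])
    show "\<psi> x = 0" if "k \<in> integer_lattice" "x \<in> ball (\<epsilon> *\<^sub>R k) (\<epsilon> * \<rho>)" for k x
    proof (rule test_functions_zero_outside(1)[OF \<psi>])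
      have "ball 0 c1 \<subseteq> T" using admissible_holeD(2)[OF T c0] c1 by auto
      then show "x \<notin> perforated_domain T \<epsilon> \<eta>"
        by (rule ball_disjoint_perforated_domain) (use \<epsilon> \<eta> that in \<open>auto simp: \<rho>_def\<close>)
    qed
    show "(\<integral>\<^sup>+t. ennreal (inverse t ^ (?d - 1)) * indicator {\<rho> / ?d..1} t \<partial>lborel) \<le> ennreal A"
      using radial_weight_bound[OF d \<tau>] unfolding A_def \<tau>_def .
  qed
  also have "ennreal (\<epsilon>\<^sup>2) * (ennreal A * ennreal (?d / 8)) = ennreal (\<epsilon>\<^sup>2 * A * (?d / 8))"
    using A0 by (simp only: ennreal_mult zero_le_power2 mult_nonneg_nonneg divide_nonneg_nonneg
        of_nat_0_le_iff zero_le_numeral mult.assoc)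
  also have "ennreal (\<epsilon>\<^sup>2 * A * (?d / 8)) * (\<integral>\<^sup>+x. ennreal ((norm (gradient \<psi> x))\<^sup>2) \<partial>lborel) \<le>
      ennreal (C1 * (?d / 8) * rate ?d \<epsilon> \<eta>) * (\<integral>\<^sup>+x. ennreal ((norm (gradient \<psi> x))\<^sup>2) \<partial>lborel)"
    using mult_right_mono[OF A, of "?d / 8"] by (intro mult_right_mono ennreal_leI) (simp_all add: mult_ac)
  finally show "(\<integral>\<^sup>+x. ennreal ((\<psi> x)\<^sup>2) \<partial>lborel) \<le>
        ennreal (C1 * (?d / 8) * rate ?d \<epsilon> \<eta>) * (\<integral>\<^sup>+x. ennreal ((norm (gradient \<psi> x))\<^sup>2) \<partial>lborel)" .
qed

section \<open>Regularised powers\<close>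

text \<open>For nonzero s and \<delta> tending to 0 this tends to s^(j+1) (s^2)^b. The factor with
  exponent \<open>b\<close> removes the singularity of the power at 0, and the factor with exponent
  \<open>- c\<close> damps the growth at infinity.\<close>

definition power_nonlinearity :: "nat \<Rightarrow> real \<Rightarrow> real \<Rightarrow> real \<Rightarrow> real \<Rightarrow> real" where
  "power_nonlinearity j b c \<delta> s = s ^ (j + 1) * (s\<^sup>2 + \<delta>) powr b * (1 + \<delta> * s\<^sup>2) powr (- c)"

text \<open>The derivative is factored so that the second factor is affine in two fractions with
  values in [0, 1]. Its sign and size can then be read off without looking at the powers.\<close>

lemma power_nonlinearity_deriv:
  assumes "0 < \<delta>"
  shows "(power_nonlinearity j b c \<delta> has_real_derivative
    (s ^ j * (s\<^sup>2 + \<delta>) powr b * (1 + \<delta> * s\<^sup>2) powr (- c)) *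
      (1 + real j + 2 * b * (s\<^sup>2 / (s\<^sup>2 + \<delta>)) - 2 * c * (\<delta> * s\<^sup>2 / (1 + \<delta> * s\<^sup>2)))) (at s)"
proof -
  have pos: "0 < s\<^sup>2 + \<delta>" "0 < 1 + \<delta> * s\<^sup>2"
    using assms by (auto intro: add_nonneg_pos add_pos_nonneg)
  let ?P = "(s\<^sup>2 + \<delta>) powr b" and ?Q = "(1 + \<delta> * s\<^sup>2) powr (- c)"
  have P: "((\<lambda>s. (s\<^sup>2 + \<delta>) powr b) has_real_derivative (b * (?P / (s\<^sup>2 + \<delta>))) * (2 * s)) (at s)"
    using pos by (auto intro!: derivative_eq_intros simp: powr_diff)
  have Q: "((\<lambda>s. (1 + \<delta> * s\<^sup>2) powr (- c)) has_real_derivative (- c * (?Q / (1 + \<delta> * s\<^sup>2))) * (\<delta> * (2 * s))) (at s)"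
    using pos by (auto intro!: derivative_eq_intros simp: powr_diff)
  have S: "((\<lambda>s. s ^ (j + 1)) has_real_derivative (1 + real j) * s ^ j) (at s)"
    using DERIV_pow[of "j + 1" s] by simp
  have eq: "((1 + real j) * s ^ j * ?P + (b * (?P / (s\<^sup>2 + \<delta>))) * (2 * s) * s ^ (j + 1)) * ?Q +
      (- c * (?Q / (1 + \<delta> * s\<^sup>2))) * (\<delta> * (2 * s)) * (s ^ (j + 1) * ?P) =
      s ^ j * ?P * ?Q * (1 + real j + 2 * b * (s\<^sup>2 / (s\<^sup>2 + \<delta>)) - 2 * c * (\<delta> * s\<^sup>2 / (1 + \<delta> * s\<^sup>2)))"
    by (simp add: algebra_simps power2_eq_square)
  show ?thesis
    using DERIV_mult[OF DERIV_mult[OF S P] Q] unfolding eq power_nonlinearity_def[abs_def] .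
qed

lemma smooth_power_nonlinearity:
  assumes "smooth f" "0 < \<delta>"
  shows "smooth (\<lambda>x. power_nonlinearity j b c \<delta> (f x))"
  unfolding power_nonlinearity_def using assms
  by (intro smooth_intros) (auto intro: add_nonneg_pos add_pos_nonneg)

text \<open>For \<open>1 < p\<close> and small \<open>\<delta>\<close>, \<open>\<phi> \<delta>\<close> and \<open>G \<delta>\<close> are smooth regularisations of \<open>\<bar>s\<bar> powr (p - 2) * s\<close> and of
  \<open>\<bar>s\<bar> powr (p / 2)\<close> with linear growth. The high power of \<open>s\<close> makes \<open>\<phi> \<delta>\<close> vanish to the right order at \<open>0\<close> when \<open>p > 2\<close>.\<close>

lemma regularised_powers:
  fixes p q :: real
  assumes p: "1 < p" and q: "q = p / (p - 1)"
  obtains C and \<phi> \<phi>' G G' :: "real \<Rightarrow> real \<Rightarrow> real" and B :: "real \<Rightarrow> real" where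
    "0 < C"
    "\<And>\<delta> s. 0 < \<delta> \<Longrightarrow> (\<phi> \<delta> has_real_derivative \<phi>' \<delta> s) (at s)"
    "\<And>\<delta> s. 0 < \<delta> \<Longrightarrow> (G \<delta> has_real_derivative G' \<delta> s) (at s)"
    "\<And>\<delta>. 0 < \<delta> \<Longrightarrow> \<phi> \<delta> 0 = 0" "\<And>\<delta>. 0 < \<delta> \<Longrightarrow> G \<delta> 0 = 0"
    "\<And>\<delta> s. 0 < \<delta> \<Longrightarrow> (G' \<delta> s)\<^sup>2 \<le> C * \<phi>' \<delta> s"
    "\<And>\<delta> s. 0 < \<delta> \<Longrightarrow> \<bar>\<phi>' \<delta> s\<bar> \<le> B \<delta>"
    "\<And>\<delta> s. 0 < \<delta> \<Longrightarrow> \<bar>\<phi> \<delta> s\<bar> powr q \<le> (G \<delta> s)\<^sup>2"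
    "\<And>\<delta> f. 0 < \<delta> \<Longrightarrow> smooth f \<Longrightarrow> smooth (\<lambda>x::real^'n. \<phi> \<delta> (f x))"
    "\<And>\<delta> f. 0 < \<delta> \<Longrightarrow> smooth f \<Longrightarrow> smooth (\<lambda>x::real^'n. G \<delta> (f x))"
    "\<And>s. ((\<lambda>\<delta>. (G \<delta> s)\<^sup>2) \<longlongrightarrow> \<bar>s\<bar> powr p) (at_right 0)"
proof
  \<comment> \<open>Chosen so that (s^2)^a is the (p-2)-th power of the absolute value of s.\<close>
  define a where "a = (p - 2) / 2"
  \<comment> \<open>A natural number at least \<open>a\<close>: the integer power supplied by
    \<open>k\<close> carries the vanishing at 0 when p > 2. It is 0 for p at most 2.\<close>
  define k where "k = nat \<lceil>max a 0\<rceil>"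
  define c where "c = max a 0"
  \<comment> \<open>A regularisation of the (p-2)/2-th power of the absolute value of s. The two
    functions are s V^2 and s V, and all comparisons reduce to bounds on \<open>V\<close>.\<close>
  define V where "V \<delta> s = (s\<^sup>2) ^ k * (s\<^sup>2 + \<delta>) powr (a / 2 - real k) * (1 + \<delta> * s\<^sup>2) powr (- (c / 2))" for \<delta> s :: real
  \<comment> \<open>The lower bound for 1 + 2 r: the value p - 1 is what remains of it for p <
    2.\<close>
  define m where "m = min 1 (p - 1)"
  let ?\<phi> = "power_nonlinearity (4 * k) (a - 2 * real k) c"
  let ?G = "power_nonlinearity (2 * k) (a / 2 - real k) (c / 2)"
  \<comment> \<open>The logarithmic derivative s V' / V, so that (s V)' = V (1 + r) and (s V^2)' =
    V^2 (1 + 2 r).\<close>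
  define r where "r \<delta> s = 2 * real k + (a - 2 * real k) * (s\<^sup>2 / (s\<^sup>2 + \<delta>)) - c * (\<delta> * s\<^sup>2 / (1 + \<delta> * s\<^sup>2))" for \<delta> s :: real
  let ?\<phi>' = "\<lambda>\<delta> s. (V \<delta> s)\<^sup>2 * (1 + 2 * r \<delta> s)"
  let ?G' = "\<lambda>\<delta> s. V \<delta> s * (1 + r \<delta> s)"
  have m: "0 < m" using p by (simp add: m_def)
  have k: "a \<le> 2 * k" "c \<le> 2 * k" unfolding k_def c_def by linarith+
  have k0: "k = 0" if "a \<le> 0" using that by (simp add: k_def)
  have pos: "0 < s\<^sup>2 + \<delta>" "0 < 1 + \<delta> * s\<^sup>2" if "0 < \<delta>" for \<delta> s :: real
    using that by (auto intro: add_nonneg_pos add_pos_nonneg)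
  have sq: "((s\<^sup>2 + \<delta>) powr (a / 2 - real k))\<^sup>2 = (s\<^sup>2 + \<delta>) powr (a - 2 * real k)"
    "((1 + \<delta> * s\<^sup>2) powr (- (c / 2)))\<^sup>2 = (1 + \<delta> * s\<^sup>2) powr (- c)" if "0 < \<delta>" for \<delta> s :: real
    by (simp_all add: power2_eq_square flip: powr_add)
  have V2: "(V \<delta> s)\<^sup>2 = s ^ (4 * k) * (s\<^sup>2 + \<delta>) powr (a - 2 * real k) * (1 + \<delta> * s\<^sup>2) powr (- c)" if "0 < \<delta>" for \<delta> s
    by (simp add: V_def power_mult_distrib sq[OF that] flip: power_mult)
  have \<phi>_eq: "?\<phi> \<delta> s = s * (V \<delta> s)\<^sup>2" if "0 < \<delta>" for \<delta> s
    by (simp add: power_nonlinearity_def V2[OF that])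
  have G_eq: "?G \<delta> s = s * V \<delta> s" for \<delta> s
    by (simp add: power_nonlinearity_def V_def flip: power_mult)
  \<comment> \<open>For p at least 2 the choice \<open>c = a\<close> balances the losses:
    \<open>2 k - (2 k - a) - a = 0\<close> bounds \<open>r\<close> from below. For p < 2 both
    \<open>k\<close> and \<open>c\<close> are 0, so \<open>r\<close> lies in [a, 0], and 1 + 2 a = p
    - 1.\<close>
  have r_lower: "m \<le> 1 + 2 * r \<delta> s" and r_upper: "\<bar>r \<delta> s\<bar> \<le> 2 * k + 1" if "0 < \<delta>" for \<delta> s
  proof -
    define t t' where "t = s\<^sup>2 / (s\<^sup>2 + \<delta>)" and "t' = \<delta> * s\<^sup>2 / (1 + \<delta> * s\<^sup>2)"
    have t: "0 \<le> t" "t \<le> 1" "0 \<le> t'" "t' \<le> 1"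
      using that pos[OF that, of s] by (auto simp: t_def t'_def)
    have r: "r \<delta> s = 2 * real k - (2 * k - a) * t - c * t'"
      unfolding r_def t_def[symmetric] t'_def[symmetric] by (simp add: algebra_simps)
    have b: "0 \<le> (2 * k - a) * t" "(2 * k - a) * t \<le> 2 * k - a" "0 \<le> c * t'" "c * t' \<le> c"
      using t k(1) by (auto simp: c_def intro: mult_left_le)
    have "(m \<le> 1 + 2 * r \<delta> s) \<and> \<bar>r \<delta> s\<bar> \<le> 2 * k + 1"
    proof (cases "0 \<le> a")
      case True
      then have "c = a" by (simp add: c_def)
      then have "0 \<le> r \<delta> s" "r \<delta> s \<le> 2 * k" using b unfolding r by linarith+
      then show ?thesis by (simp add: m_def)
    next
      case False
      then have "c = 0" "k = 0" using k0 by (auto simp: c_def)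
      then have "a \<le> r \<delta> s" "r \<delta> s \<le> 0" using b unfolding r by simp_all
      moreover have "m \<le> 1 + 2 * a" "- 1 < a" using p min.cobounded2[of 1 "p - 1"] by (auto simp: m_def a_def field_simps)
      ultimately show ?thesis using \<open>k = 0\<close> by auto
    qed
    then show "m \<le> 1 + 2 * r \<delta> s" "\<bar>r \<delta> s\<bar> \<le> 2 * k + 1" by auto
  qed
  have Vpow: "s ^ (4 * k) * (s\<^sup>2 + \<delta>) powr (a - 2 * real k) \<le> (s\<^sup>2) powr a" if "0 < \<delta>" "s \<noteq> 0" for \<delta> s :: real
  proof -
    have "(s\<^sup>2 + \<delta>) powr (a - 2 * real k) \<le> (s\<^sup>2) powr (a - 2 * real k)"
      using that k by (intro powr_mono2') auto
    then have "s ^ (4 * k) * (s\<^sup>2 + \<delta>) powr (a - 2 * real k) \<le> s ^ (4 * k) * (s\<^sup>2) powr (a - 2 * real k)"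
      by (intro mult_left_mono) (auto simp: power_mult)
    also have "\<dots> = (s\<^sup>2) powr (2 * k) * (s\<^sup>2) powr (a - 2 * real k)"
      using that powr_realpow[of "s\<^sup>2" "2 * k"] by (simp flip: power_mult)
    also have "\<dots> = (s\<^sup>2) powr a" by (simp flip: powr_add)
    finally show ?thesis .
  qed
  have Vle: "(V \<delta> s)\<^sup>2 \<le> (s\<^sup>2) powr a" if "0 < \<delta>" "s \<noteq> 0" for \<delta> s
  proof -
    have "(1 + \<delta> * s\<^sup>2) powr (- c) \<le> 1"
      using powr_mono[of "- c" 0 "1 + \<delta> * s\<^sup>2"] pos[OF that(1), of s] that by (auto simp: c_def split: if_splits)
    then have "(V \<delta> s)\<^sup>2 \<le> (s ^ (4 * k) * (s\<^sup>2 + \<delta>) powr (a - 2 * real k)) * 1"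
      unfolding V2[OF that(1)] by (intro mult_left_mono) (auto simp: power_mult)
    then show ?thesis using Vpow[OF that] by simp
  qed
  \<comment> \<open>The first factor bounds V^2, the second bounds 1 + 2 r, as \<open>r\<close> is
    at most 2 k + 1 in absolute value.\<close>
  define B where "B \<delta> = max 1 (\<delta> powr (- \<bar>a\<bar>)) * (4 * real k + 3)" for \<delta> :: real
  have Vbd: "(V \<delta> s)\<^sup>2 \<le> max 1 (\<delta> powr (- \<bar>a\<bar>))" if "0 < \<delta>" for \<delta> s
  proof (cases "a \<le> 0")
    case True
    then have "(V \<delta> s)\<^sup>2 = (s\<^sup>2 + \<delta>) powr a" unfolding V2[OF that] using k0 by (simp add: c_def pos[OF that] less_imp_neq[symmetric])
    also have "\<dots> \<le> \<delta> powr a" using True that by (intro powr_mono2') auto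
    finally show ?thesis using True by simp
  next
    case False
    then have kpos: "k \<noteq> 0" using k by auto
    show ?thesis
    proof (cases "s = 0")
      case True
      then have "(V \<delta> s)\<^sup>2 = 0" using kpos by (simp add: V_def)
      then show ?thesis by simp
    next
      case s: False
      have "(V \<delta> s)\<^sup>2 \<le> (s\<^sup>2) powr a * (1 + \<delta> * s\<^sup>2) powr (- a)"
        unfolding V2[OF that] using Vpow[OF that s] False by (simp add: c_def mult_right_mono)
      also have "\<dots> \<le> (s\<^sup>2) powr a * (\<delta> * s\<^sup>2) powr (- a)"
        using False that s by (intro mult_left_mono powr_mono2') auto
      also have "\<dots> = \<delta> powr (- a)"
        using that s by (simp add: powr_mult powr_minus)
      finally show ?thesis using False by simp
    qed
  qed
  \<comment> \<open>The constant is an upper bound for (1 + r)^2 divided by the lower bound for 1 +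
    2 r.\<close>
  show "0 < (2 * real k + 2)\<^sup>2 / m" using m by (intro divide_pos_pos zero_less_power) auto
  fix \<delta> :: real
  show "(?\<phi> \<delta> has_real_derivative ?\<phi>' \<delta> s) (at s)" if "0 < \<delta>" for s
    using power_nonlinearity_deriv[OF that, of "4 * k" "a - 2 * real k" c s]
    by (rule DERIV_cong) (simp add: V2[OF that] r_def algebra_simps)
  show "(?G \<delta> has_real_derivative ?G' \<delta> s) (at s)" if "0 < \<delta>" for s
    using power_nonlinearity_deriv[OF that, of "2 * k" "a / 2 - real k" "c / 2" s]
    by (rule DERIV_cong) (simp add: V_def r_def algebra_simps flip: power_mult)
  show "?\<phi> \<delta> 0 = 0" "?G \<delta> 0 = 0" by (simp_all add: power_nonlinearity_def)
  show "(?G' \<delta> s)\<^sup>2 \<le> (2 * real k + 2)\<^sup>2 / m * ?\<phi>' \<delta> s" if "0 < \<delta>" for s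
  proof -
    have "(1 + r \<delta> s)\<^sup>2 \<le> (2 * real k + 2)\<^sup>2"
      using r_upper[OF that, of s] by (intro power2_le_iff_abs_le[THEN iffD2]) auto
    also have "\<dots> \<le> (2 * real k + 2)\<^sup>2 * ((1 + 2 * r \<delta> s) / m)"
    proof -
      have "1 \<le> (1 + 2 * r \<delta> s) / m" using m r_lower[OF that, of s] by (simp add: field_simps)
      then have "(2 * real k + 2)\<^sup>2 * 1 \<le> (2 * real k + 2)\<^sup>2 * ((1 + 2 * r \<delta> s) / m)"
        by (rule mult_left_mono) simp
      then show ?thesis by simp
    qed
    finally have "(V \<delta> s)\<^sup>2 * (1 + r \<delta> s)\<^sup>2 \<le> (V \<delta> s)\<^sup>2 * ((2 * real k + 2)\<^sup>2 * ((1 + 2 * r \<delta> s) / m))"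
      by (rule mult_left_mono) simp
    then show ?thesis by (simp add: power_mult_distrib mult_ac)
  qed
  show "\<bar>?\<phi>' \<delta> s\<bar> \<le> B \<delta>" if "0 < \<delta>" for s
    unfolding abs_mult B_def using r_upper[OF that, of s] Vbd[OF that, of s]
    by (intro mult_mono) auto
  show "\<bar>?\<phi> \<delta> s\<bar> powr q \<le> (?G \<delta> s)\<^sup>2" if "0 < \<delta>" for s
  proof (cases "s = 0 \<or> V \<delta> s = 0")
    case True
    then show ?thesis by (auto simp: \<phi>_eq[OF that] G_eq)
  next
    case False
    then have s: "s \<noteq> 0" and V: "0 < (V \<delta> s)\<^sup>2" by auto
    have "q - 1 = 1 / (p - 1)" using p by (simp add: q field_simps)
    then have q1: "0 < q - 1" "(q - 1) * (p - 1) = 1" using p by simp_all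
    \<comment> \<open>The exponents of s add up to 2 here. This turns the q-th power of s V^2 into
      the square of s V, once V^(2(q-1)) is estimated by a power of s.\<close>
    then have q2: "q + 2 * a * (q - 1) = 2" by (simp add: a_def field_simps)
    have "(V \<delta> s)\<^sup>2 powr (q - 1) \<le> ((s\<^sup>2) powr a) powr (q - 1)"
      using Vle[OF that s] q1 by (intro powr_mono2) auto
    also have "\<dots> = \<bar>s\<bar> powr (2 * a * (q - 1))"
      using s powr_powr[of "\<bar>s\<bar>" 2 "a * (q - 1)"] by (simp add: powr_powr mult.assoc)
    finally have *: "(V \<delta> s)\<^sup>2 powr (q - 1) \<le> \<bar>s\<bar> powr (2 * a * (q - 1))" .
    have "\<bar>?\<phi> \<delta> s\<bar> powr q = \<bar>s\<bar> powr q * ((V \<delta> s)\<^sup>2 powr (q - 1) * (V \<delta> s)\<^sup>2)"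
      using V powr_add[of "(V \<delta> s)\<^sup>2" "q - 1" 1] by (simp add: \<phi>_eq[OF that] abs_mult powr_mult)
    also have "\<dots> \<le> \<bar>s\<bar> powr q * (\<bar>s\<bar> powr (2 * a * (q - 1)) * (V \<delta> s)\<^sup>2)"
      using * V by (intro mult_left_mono mult_right_mono) auto
    also have "\<dots> = \<bar>s\<bar> powr 2 * (V \<delta> s)\<^sup>2" unfolding mult.assoc[symmetric] by (simp add: q2 flip: powr_add)
    also have "\<dots> = (?G \<delta> s)\<^sup>2" by (simp add: G_eq power_mult_distrib)
    finally show ?thesis .
  qed
  show "smooth (\<lambda>x::real^'n. ?\<phi> \<delta> (f x))" "smooth (\<lambda>x::real^'n. ?G \<delta> (f x))" if "0 < \<delta>" "smooth f" for f
    by (rule smooth_power_nonlinearity[OF that(2,1)])+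
  show "((\<lambda>\<delta>. (?G \<delta> s)\<^sup>2) \<longlongrightarrow> \<bar>s\<bar> powr p) (at_right 0)" for s
  proof (cases "s = 0")
    case False
    have l: "((\<lambda>\<delta>. (?G \<delta> s)\<^sup>2) \<longlongrightarrow>
      (s ^ (2 * k + 1) * (s\<^sup>2 + 0) powr (a / 2 - real k) * (1 + 0 * s\<^sup>2) powr (- (c / 2)))\<^sup>2) (at_right 0)"
      unfolding power_nonlinearity_def using False by (intro tendsto_intros) auto
    have "(s ^ (2 * k + 1))\<^sup>2 = (s\<^sup>2) powr (2 * k + 1)"
    proof -
      have "(s ^ (2 * k + 1))\<^sup>2 = (s\<^sup>2) ^ (2 * k + 1)" by (simp only: power_mult[symmetric] mult.commute)
      then show ?thesis using False powr_realpow[of "s\<^sup>2" "2 * k + 1"] by simp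
    qed
    moreover have "((s\<^sup>2) powr (a / 2 - real k))\<^sup>2 = (s\<^sup>2) powr (a - 2 * real k)"
      by (simp add: power2_eq_square[of "_ powr _"] flip: powr_add)
    ultimately have "(s ^ (2 * k + 1) * (s\<^sup>2 + 0) powr (a / 2 - real k) * (1 + 0 * s\<^sup>2) powr (- (c / 2)))\<^sup>2 =
        (s\<^sup>2) powr (a + 1)"
      by (simp add: power_mult_distrib add.commute[of a] del: power_Suc flip: powr_add)
    also have "\<dots> = \<bar>s\<bar> powr p"
    proof -
      have "2 * (a + 1) = p" by (simp add: a_def field_simps)
      then show ?thesis using False powr_powr[of "\<bar>s\<bar>" 2 "a + 1"] by simp
    qed
    finally show ?thesis using l by simp
  qed (simp add: power_nonlinearity_def)
qed

section \<open>Square integrable functions\<close>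

lemma Lp_norm_le_iff:
  assumes "0 < p" "0 \<le> c"
  shows "Lp_norm p \<Omega> f \<le> ennreal c \<longleftrightarrow>
    (\<integral>\<^sup>+x. ennreal (norm (f x) powr p) \<partial>lebesgue_on \<Omega>) \<le> ennreal (c powr p)"
proof -
  define I where "I = (\<integral>\<^sup>+x. ennreal (norm (f x) powr p) \<partial>lebesgue_on \<Omega>)"
  show ?thesis
  proof (cases "I = \<infinity>")
    case True
    then show ?thesis using True by (simp add: Lp_norm_def I_def[symmetric] top_unique)
  next
    case False
    then obtain r where r: "I = ennreal r" "0 \<le> r" by (cases I) auto
    have "r powr (1 / p) \<le> c \<longleftrightarrow> r \<le> c powr p"
    proof
      assume "r powr (1 / p) \<le> c"
      then have "(r powr (1 / p)) powr p \<le> c powr p" using assms by (intro powr_mono2) auto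
      then show "r \<le> c powr p" using assms r by (simp add: powr_powr)
    next
      assume "r \<le> c powr p"
      then have "r powr (1 / p) \<le> (c powr p) powr (1 / p)" using assms r by (intro powr_mono2) auto
      then show "r powr (1 / p) \<le> c" using assms by (simp add: powr_powr)
    qed
    then show ?thesis
      using r assms by (simp add: Lp_norm_def I_def[symmetric] ennreal_le_iff)
  qed
qed

lemma Lp_norm_ge_iff:
  assumes "0 < p" "0 < c"
  shows "ennreal c \<le> Lp_norm p \<Omega> f \<longleftrightarrow>
    ennreal (c powr p) \<le> (\<integral>\<^sup>+x. ennreal (norm (f x) powr p) \<partial>lebesgue_on \<Omega>)"
proof -
  define I where "I = (\<integral>\<^sup>+x. ennreal (norm (f x) powr p) \<partial>lebesgue_on \<Omega>)"
  show ?thesis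
  proof (cases "I = \<infinity>")
    case True
    then show ?thesis by (simp add: Lp_norm_def I_def[symmetric])
  next
    case False
    then obtain r where r: "I = ennreal r" "0 \<le> r" by (cases I) auto
    have "c \<le> r powr (1 / p) \<longleftrightarrow> c powr p \<le> r"
    proof
      assume "c \<le> r powr (1 / p)"
      then have "c powr p \<le> (r powr (1 / p)) powr p" using assms by (intro powr_mono2) auto
      then show "c powr p \<le> r" using assms r by (simp add: powr_powr)
    next
      assume "c powr p \<le> r"
      then have "(c powr p) powr (1 / p) \<le> r powr (1 / p)" using assms by (intro powr_mono2) auto
      then show "c \<le> r powr (1 / p)" using assms by (simp add: powr_powr)
    qed
    then show ?thesis
      using r assms by (simp add: Lp_norm_def I_def[symmetric] ennreal_le_iff)
  qed
qed

lemma Lp_norm_eq_1_iff: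
  assumes "0 < p"
  shows "Lp_norm p \<Omega> f = 1 \<longleftrightarrow> (\<integral>\<^sup>+x. ennreal (norm (f x) powr p) \<partial>lebesgue_on \<Omega>) = 1"
  using Lp_norm_le_iff[OF assms, of 1 \<Omega> f] Lp_norm_ge_iff[OF assms, of 1 \<Omega> f]
  by (auto simp: order_eq_iff)

lemma Lp_norm_less_top_iff:
  assumes "0 < p"
  shows "Lp_norm p \<Omega> f < \<infinity> \<longleftrightarrow> (\<integral>\<^sup>+x. ennreal (norm (f x) powr p) \<partial>lebesgue_on \<Omega>) < \<infinity>"
  by (simp add: Lp_norm_def Let_def top.not_eq_extremum)

lemma Lp_norm_tendsto_0_iff:
  assumes p: "0 < p"
  shows "(\<lambda>m. Lp_norm p \<Omega> (f m)) \<longlonglongrightarrow> 0 \<longleftrightarrow>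
    (\<lambda>m. \<integral>\<^sup>+x. ennreal (norm (f m x) powr p) \<partial>lebesgue_on \<Omega>) \<longlonglongrightarrow> 0"
proof -
  \<comment> \<open>Convergence to 0 is rephrased by real thresholds, to which
    \<open>Lp_norm_le_iff\<close> applies; taking roots only changes the threshold.\<close>
  have tendsto_iff: "X \<longlonglongrightarrow> 0 \<longleftrightarrow> (\<forall>e>0. eventually (\<lambda>m. X m \<le> ennreal e) sequentially)" for X :: "nat \<Rightarrow> ennreal"
  proof
    assume X: "X \<longlonglongrightarrow> 0"
    show "\<forall>e>0. eventually (\<lambda>m. X m \<le> ennreal e) sequentially"
    proof (intro allI impI)
      fix e :: real assume "0 < e"
      then have "eventually (\<lambda>m. X m < ennreal e) sequentially" by (intro order_tendstoD(2)[OF X]) simp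
      then show "eventually (\<lambda>m. X m \<le> ennreal e) sequentially" by (rule eventually_mono) simp
    qed
  next
    assume X: "\<forall>e>0. eventually (\<lambda>m. X m \<le> ennreal e) sequentially"
    show "X \<longlonglongrightarrow> 0"
    proof (rule order_tendstoI)
      fix y :: ennreal assume "0 < y"
      then obtain e where e: "0 < e" "ennreal e < y"
      proof (cases y)
        case (real r)
        then show ?thesis using that[of "r / 2"] \<open>0 < y\<close> by (auto simp: ennreal_less_iff)
      next
        case top
        then show ?thesis using that[of 1] by simp
      qed
      then have "eventually (\<lambda>m. X m \<le> ennreal e) sequentially" using X by blast
      then show "eventually (\<lambda>m. X m < y) sequentially" by (rule eventually_mono) (use e in auto)
    qed simp
  qed
  show ?thesis
    unfolding tendsto_iff
  proof safe
    fix e :: real assume e: "0 < e"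
      and *: "\<forall>e>0. eventually (\<lambda>m. Lp_norm p \<Omega> (f m) \<le> ennreal e) sequentially"
    have "eventually (\<lambda>m. Lp_norm p \<Omega> (f m) \<le> ennreal (e powr (1 / p))) sequentially"
      using * e by auto
    then show "eventually (\<lambda>m. (\<integral>\<^sup>+x. ennreal (norm (f m x) powr p) \<partial>lebesgue_on \<Omega>) \<le> ennreal e) sequentially"
      using p e by (simp add: Lp_norm_le_iff powr_powr)
  next
    fix e :: real assume e: "0 < e"
      and *: "\<forall>e>0. eventually (\<lambda>m. (\<integral>\<^sup>+x. ennreal (norm (f m x) powr p) \<partial>lebesgue_on \<Omega>) \<le> ennreal e) sequentially"
    have "eventually (\<lambda>m. (\<integral>\<^sup>+x. ennreal (norm (f m x) powr p) \<partial>lebesgue_on \<Omega>) \<le> ennreal (e powr p)) sequentially"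
      using * e by auto
    then show "eventually (\<lambda>m. Lp_norm p \<Omega> (f m) \<le> ennreal e) sequentially"
      using p e by (simp add: Lp_norm_le_iff)
  qed
qed

section \<open>Real-valued calculus of square integrable functions\<close>

definition square_integrable :: "'a measure \<Rightarrow> ('a \<Rightarrow> 'b::euclidean_space) \<Rightarrow> bool" where
  "square_integrable M f \<longleftrightarrow> f \<in> borel_measurable M \<and> integrable M (\<lambda>x. (norm (f x))\<^sup>2)"

definition L2norm :: "'a measure \<Rightarrow> ('a \<Rightarrow> 'b::euclidean_space) \<Rightarrow> real" where
  "L2norm M f = sqrt (LINT x|M. (norm (f x))\<^sup>2)"

lemma square_integrable_measurable: "square_integrable M f \<Longrightarrow> f \<in> borel_measurable M"
  by (simp add: square_integrable_def)

lemma square_integrable_inner: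
  assumes "square_integrable M f" "square_integrable M g"
  shows "integrable M (\<lambda>x. f x \<bullet> g x)"
proof (rule Bochner_Integration.integrable_bound)
  show "integrable M (\<lambda>x. (norm (f x))\<^sup>2 + (norm (g x))\<^sup>2)"
    using assms by (auto simp: square_integrable_def)
  have [measurable]: "f \<in> borel_measurable M" "g \<in> borel_measurable M"
    using assms by (auto simp: square_integrable_def)
  show "(\<lambda>x. f x \<bullet> g x) \<in> borel_measurable M" by measurable
  have "\<bar>u \<bullet> v\<bar> \<le> (norm u)\<^sup>2 + (norm v)\<^sup>2" for u v :: 'b
  proof -
    have "0 \<le> norm u * norm v" by simp
    then show ?thesis
      using Cauchy_Schwarz_ineq2[of u v] sum_squares_bound[of "norm u" "norm v"] by linarith
  qed
  then show "AE x in M. norm (f x \<bullet> g x) \<le> norm ((norm (f x))\<^sup>2 + (norm (g x))\<^sup>2)" by simp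
qed

lemma norm_lincomb_power2:
  "(norm (a *\<^sub>R u + b *\<^sub>R v))\<^sup>2 = a\<^sup>2 * (norm u)\<^sup>2 + 2 * a * b * (u \<bullet> v) + b\<^sup>2 * (norm v)\<^sup>2"
  unfolding power2_norm_eq_inner inner_add_left inner_add_right inner_scaleR_left inner_scaleR_right
    inner_commute[of v u]
  by (simp add: algebra_simps power2_eq_square[of a] power2_eq_square[of b])

lemma square_integrable_lincomb:
  assumes "square_integrable M f" "square_integrable M g"
  shows "square_integrable M (\<lambda>x. a *\<^sub>R f x + b *\<^sub>R g x)"
proof -
  have [measurable]: "f \<in> borel_measurable M" "g \<in> borel_measurable M"
    using assms by (auto simp: square_integrable_def)
  have "(\<lambda>x. (norm (a *\<^sub>R f x + b *\<^sub>R g x))\<^sup>2) =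
      (\<lambda>x. a\<^sup>2 * (norm (f x))\<^sup>2 + 2 * a * b * (f x \<bullet> g x) + b\<^sup>2 * (norm (g x))\<^sup>2)"
    by (simp only: norm_lincomb_power2)
  moreover have "integrable M \<dots>"
    using assms square_integrable_inner[OF assms] by (auto simp: square_integrable_def)
  ultimately show ?thesis by (simp add: square_integrable_def)
qed

lemma square_integrable_diff:
  "square_integrable M f \<Longrightarrow> square_integrable M g \<Longrightarrow> square_integrable M (\<lambda>x. f x - g x)"
  using square_integrable_lincomb[of M f g 1 "-1"] by simp

lemma L2norm_nonneg [simp]: "0 \<le> L2norm M f"
  by (simp add: L2norm_def integral_nonneg_AE)

lemma L2norm_power2: "(L2norm M f)\<^sup>2 = (LINT x|M. (norm (f x))\<^sup>2)"
  by (simp add: L2norm_def integral_nonneg_AE)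

lemma nn_integral_eq_L2norm:
  "square_integrable M f \<Longrightarrow> (\<integral>\<^sup>+x. ennreal ((norm (f x))\<^sup>2) \<partial>M) = ennreal ((L2norm M f)\<^sup>2)"
  unfolding L2norm_power2 square_integrable_def by (intro nn_integral_eq_integral) auto

lemma L2norm_lincomb:
  assumes "square_integrable M f" "square_integrable M g"
  shows "(L2norm M (\<lambda>x. a *\<^sub>R f x + b *\<^sub>R g x))\<^sup>2 =
    a\<^sup>2 * (L2norm M f)\<^sup>2 + 2 * a * b * (LINT x|M. f x \<bullet> g x) + b\<^sup>2 * (L2norm M g)\<^sup>2"
proof -
  have "(\<lambda>x. (norm (a *\<^sub>R f x + b *\<^sub>R g x))\<^sup>2) =
      (\<lambda>x. a\<^sup>2 * (norm (f x))\<^sup>2 + 2 * a * b * (f x \<bullet> g x) + b\<^sup>2 * (norm (g x))\<^sup>2)"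
    by (simp only: norm_lincomb_power2)
  then show ?thesis
    using assms square_integrable_inner[OF assms] by (simp add: L2norm_power2 square_integrable_def)
qed

text \<open>Serves two purposes: it gives the Cauchy-Schwarz inequality, and with A = 0 it forces B
  = 0, which is how minimality of the energy becomes the weak equation.\<close>

lemma quadratic_nonneg_discriminant:
  fixes A B C :: real
  assumes "\<And>t. 0 \<le> A + 2 * t * B + t\<^sup>2 * C" "0 \<le> C"
  shows "B\<^sup>2 \<le> A * C"
proof (cases "C = 0")
  case True
  have "B = 0"
  proof (rule ccontr)
    assume "B \<noteq> 0"
    then have "A + 2 * (- (A + 1) / (2 * B)) * B = - 1" by (simp add: field_simps)
    then show False using assms(1)[of "- (A + 1) / (2 * B)"] True by simp
  qed
  then show ?thesis using True by simp
next
  case False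
  then have "A + 2 * (- B / C) * B + (- B / C)\<^sup>2 * C = (A * C - B\<^sup>2) / C"
    by (simp add: field_simps power2_eq_square)
  then have "0 \<le> (A * C - B\<^sup>2) / C" using assms(1)[of "- B / C"] by simp
  then show ?thesis using False assms(2) by (simp add: zero_le_divide_iff)
qed

lemma L2_Cauchy_Schwarz:
  assumes "square_integrable M f" "square_integrable M g"
  shows "\<bar>LINT x|M. f x \<bullet> g x\<bar> \<le> L2norm M f * L2norm M g"
proof -
  have "(LINT x|M. f x \<bullet> g x)\<^sup>2 \<le> (L2norm M f)\<^sup>2 * (L2norm M g)\<^sup>2"
  proof (rule quadratic_nonneg_discriminant)
    show "0 \<le> (L2norm M f)\<^sup>2 + 2 * t * (LINT x|M. f x \<bullet> g x) + t\<^sup>2 * (L2norm M g)\<^sup>2" for t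
      using L2norm_lincomb[OF assms, of 1 t] zero_le_power2[of "L2norm M (\<lambda>x. 1 *\<^sub>R f x + t *\<^sub>R g x)"] by simp
  qed simp
  then have "\<bar>LINT x|M. f x \<bullet> g x\<bar>\<^sup>2 \<le> (L2norm M f * L2norm M g)\<^sup>2" by (simp add: power_mult_distrib)
  then show ?thesis by (rule power2_le_imp_le) simp
qed

lemma L2norm_triangle:
  assumes "square_integrable M f" "square_integrable M g"
  shows "L2norm M (\<lambda>x. f x + g x) \<le> L2norm M f + L2norm M g"
proof (rule power2_le_imp_le)
  have "(L2norm M (\<lambda>x. f x + g x))\<^sup>2 = (L2norm M f)\<^sup>2 + 2 * (LINT x|M. f x \<bullet> g x) + (L2norm M g)\<^sup>2"
    using L2norm_lincomb[OF assms, of 1 1] by simp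
  also have "\<dots> \<le> (L2norm M f + L2norm M g)\<^sup>2"
    using L2_Cauchy_Schwarz[OF assms] by (simp add: power2_sum)
  finally show "(L2norm M (\<lambda>x. f x + g x))\<^sup>2 \<le> (L2norm M f + L2norm M g)\<^sup>2" .
qed simp

lemma square_integrable_Lp_space:
  "f \<in> Lp_space 2 \<Omega> \<longleftrightarrow> square_integrable (lebesgue_on \<Omega>) f"
  using Lp_norm_less_top_iff[of 2 \<Omega> f]
  by (auto simp: Lp_space_def square_integrable_def integrable_iff_bounded)

lemma square_integrable_tendsto_iff:
  assumes "\<And>m. square_integrable (lebesgue_on \<Omega>) (f m)"
  shows "(\<lambda>m. Lp_norm 2 \<Omega> (f m)) \<longlonglongrightarrow> 0 \<longleftrightarrow> (\<lambda>m. L2norm (lebesgue_on \<Omega>) (f m)) \<longlonglongrightarrow> 0"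
proof -
  have "(\<lambda>m. Lp_norm 2 \<Omega> (f m)) \<longlonglongrightarrow> 0 \<longleftrightarrow> (\<lambda>m. ennreal ((L2norm (lebesgue_on \<Omega>) (f m))\<^sup>2)) \<longlonglongrightarrow> ennreal 0"
    by (simp add: Lp_norm_tendsto_0_iff nn_integral_eq_L2norm[OF assms])
  also have "\<dots> \<longleftrightarrow> (\<lambda>m. (L2norm (lebesgue_on \<Omega>) (f m))\<^sup>2) \<longlonglongrightarrow> 0"
    by (rule tendsto_ennreal_iff) auto
  also have "\<dots> \<longleftrightarrow> (\<lambda>m. L2norm (lebesgue_on \<Omega>) (f m)) \<longlonglongrightarrow> 0"
  proof
    assume "(\<lambda>m. (L2norm (lebesgue_on \<Omega>) (f m))\<^sup>2) \<longlonglongrightarrow> 0"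
    from tendsto_real_sqrt[OF this] show "(\<lambda>m. L2norm (lebesgue_on \<Omega>) (f m)) \<longlonglongrightarrow> 0" by simp
  next
    assume "(\<lambda>m. L2norm (lebesgue_on \<Omega>) (f m)) \<longlonglongrightarrow> 0"
    from tendsto_power[OF this, of 2] show "(\<lambda>m. (L2norm (lebesgue_on \<Omega>) (f m))\<^sup>2) \<longlonglongrightarrow> 0" by simp
  qed
  finally show ?thesis .
qed

section \<open>Test functions as square integrable functions\<close>

lemma nn_integral_lebesgue_on:
  assumes "\<Omega> \<in> sets lebesgue" "f \<in> borel_measurable borel" "\<And>x. x \<notin> \<Omega> \<Longrightarrow> f x = 0"
  shows "(\<integral>\<^sup>+x. f x \<partial>lebesgue_on \<Omega>) = (\<integral>\<^sup>+x. f x \<partial>lborel)"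
proof -
  have "(\<integral>\<^sup>+x. f x \<partial>lebesgue_on \<Omega>) = (\<integral>\<^sup>+x. f x * indicator \<Omega> x \<partial>lebesgue)"
    using assms by (intro nn_integral_restrict_space) simp
  also have "\<dots> = (\<integral>\<^sup>+x. f x \<partial>lebesgue)"
    using assms by (intro nn_integral_cong) (auto split: split_indicator)
  also have "\<dots> = (\<integral>\<^sup>+x. f x \<partial>lborel)" by (rule nn_integral_completion)
  finally show ?thesis .
qed

lemma borel_measurable_lebesgue_on_borel:
  "f \<in> borel_measurable borel \<Longrightarrow> f \<in> borel_measurable (lebesgue_on \<Omega>)"
  by (intro measurable_restrict_space1 measurable_completion) simp

lemma square_integrable_compact_support:
  fixes f :: "real^'n \<Rightarrow> 'b::euclidean_space"
  assumes "continuous_on UNIV f" "compact S" "\<And>x. x \<notin> S \<Longrightarrow> f x = 0" "\<Omega> \<in> sets lebesgue" "S \<subseteq> \<Omega>"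
  shows "square_integrable (lebesgue_on \<Omega>) f"
proof -
  have [measurable]: "f \<in> borel_measurable borel" using assms(1) by (rule borel_measurable_continuous_onI)
  have "integrable lborel (\<lambda>x. indicator S x *\<^sub>R (norm (f x))\<^sup>2)"
    by (rule borel_integrable_compact[OF assms(2)])
      (intro continuous_intros continuous_on_subset[OF assms(1)], simp)
  also have "(\<lambda>x. indicator S x *\<^sub>R (norm (f x))\<^sup>2) = (\<lambda>x. (norm (f x))\<^sup>2)"
    using assms(3) by (auto simp: fun_eq_iff split: split_indicator)
  finally have "(\<integral>\<^sup>+x. ennreal ((norm (f x))\<^sup>2) \<partial>lborel) < \<infinity>"
    by (auto simp: integrable_iff_bounded)
  then have "(\<integral>\<^sup>+x. ennreal ((norm (f x))\<^sup>2) \<partial>lebesgue_on \<Omega>) < \<infinity>"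
    using assms(3-5) by (subst nn_integral_lebesgue_on) (auto intro!: assms(3))
  then show ?thesis
    by (auto simp: square_integrable_def integrable_iff_bounded borel_measurable_lebesgue_on_borel)
qed

lemma test_functions_square_integrable:
  assumes "\<phi> \<in> test_functions \<Omega>" "\<Omega> \<in> sets lebesgue"
  shows "square_integrable (lebesgue_on \<Omega>) \<phi>" "square_integrable (lebesgue_on \<Omega>) (gradient \<phi>)"
proof -
  obtain S where S: "compact S" "S \<subseteq> \<Omega>" "\<And>x. x \<notin> S \<Longrightarrow> \<phi> x = 0" "\<And>x. x \<notin> S \<Longrightarrow> gradient \<phi> x = 0"
    using test_functions_support[OF assms(1)] by metis
  note sm = test_functions_smooth[OF assms(1)]
  show "square_integrable (lebesgue_on \<Omega>) \<phi>"
    by (rule square_integrable_compact_support[OF smooth_continuous_on[OF sm] S(1,3) assms(2) S(2)])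
  show "square_integrable (lebesgue_on \<Omega>) (gradient \<phi>)"
    by (rule square_integrable_compact_support[OF smooth_gradient_continuous_on[OF sm] S(1,4) assms(2) S(2)])
qed

text \<open>The interface between geometry and analysis: the a priori estimate and the existence
  theorem know the open set only through this inequality.\<close>

definition poincare_on :: "(real^'n) set \<Rightarrow> real \<Rightarrow> bool" where
  "poincare_on \<Omega> K \<longleftrightarrow> 0 < K \<and> (\<forall>\<psi>\<in>test_functions \<Omega>.
     (L2norm (lebesgue_on \<Omega>) \<psi>)\<^sup>2 \<le> K * (L2norm (lebesgue_on \<Omega>) (gradient \<psi>))\<^sup>2)"

lemma poincare_onI:
  assumes "0 < K" "\<Omega> \<in> sets lebesgue"
    and "\<And>\<psi>. \<psi> \<in> test_functions \<Omega> \<Longrightarrow> (\<integral>\<^sup>+x. ennreal ((\<psi> x)\<^sup>2) \<partial>lborel) \<le>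
        ennreal K * (\<integral>\<^sup>+x. ennreal ((norm (gradient \<psi> x))\<^sup>2) \<partial>lborel)"
  shows "poincare_on \<Omega> K"
  unfolding poincare_on_def
proof (intro conjI ballI)
  fix \<psi> assume \<psi>: "\<psi> \<in> test_functions \<Omega>"
  have [measurable]: "\<psi> \<in> borel_measurable borel" "gradient \<psi> \<in> borel_measurable borel"
    using borel_measurable_smooth[OF test_functions_smooth[OF \<psi>]] by auto
  note sq = test_functions_square_integrable[OF \<psi> assms(2)]
  have "(\<integral>\<^sup>+x. ennreal ((norm (\<psi> x))\<^sup>2) \<partial>lebesgue_on \<Omega>) \<le>
      ennreal K * (\<integral>\<^sup>+x. ennreal ((norm (gradient \<psi> x))\<^sup>2) \<partial>lebesgue_on \<Omega>)"
  proof -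
    have "(\<integral>\<^sup>+x. ennreal ((norm (\<psi> x))\<^sup>2) \<partial>lebesgue_on \<Omega>) = (\<integral>\<^sup>+x. ennreal ((\<psi> x)\<^sup>2) \<partial>lborel)"
      using test_functions_zero_outside[OF \<psi>] by (subst nn_integral_lebesgue_on[OF assms(2)]) auto
    moreover have "(\<integral>\<^sup>+x. ennreal ((norm (gradient \<psi> x))\<^sup>2) \<partial>lebesgue_on \<Omega>) =
        (\<integral>\<^sup>+x. ennreal ((norm (gradient \<psi> x))\<^sup>2) \<partial>lborel)"
      using test_functions_zero_outside[OF \<psi>] by (subst nn_integral_lebesgue_on[OF assms(2)]) auto
    ultimately show ?thesis using assms(3)[OF \<psi>] by simp
  qed
  then have "ennreal ((L2norm (lebesgue_on \<Omega>) \<psi>)\<^sup>2) \<le> ennreal (K * (L2norm (lebesgue_on \<Omega>) (gradient \<psi>))\<^sup>2)"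
    using assms(1) unfolding nn_integral_eq_L2norm[OF sq(1)] nn_integral_eq_L2norm[OF sq(2)] by (simp add: ennreal_mult)
  then show "(L2norm (lebesgue_on \<Omega>) \<psi>)\<^sup>2 \<le> K * (L2norm (lebesgue_on \<Omega>) (gradient \<psi>))\<^sup>2"
    using assms(1) by (simp add: ennreal_le_iff)
qed (rule assms(1))

section \<open>The upper bound\<close>

lemma L2norm_mono:
  assumes "square_integrable M f" "square_integrable M g" "\<And>x. norm (f x) \<le> c * norm (g x)" "0 \<le> c"
  shows "L2norm M f \<le> c * L2norm M g"
proof (rule power2_le_imp_le)
  have "(L2norm M f)\<^sup>2 \<le> (LINT x|M. c\<^sup>2 * (norm (g x))\<^sup>2)"
    unfolding L2norm_power2
  proof (rule integral_mono)
    show "(norm (f x))\<^sup>2 \<le> c\<^sup>2 * (norm (g x))\<^sup>2" for x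
      unfolding power_mult_distrib[symmetric] by (rule power_mono[OF assms(3)]) simp
  qed (use assms in \<open>auto simp: square_integrable_def\<close>)
  then show "(L2norm M f)\<^sup>2 \<le> (c * L2norm M g)\<^sup>2"
    by (simp add: power_mult_distrib L2norm_power2)
qed (use assms in simp)

text \<open>The Poincare inequality for \<open>G (\<psi> m)\<close> and the comparison of
  \<open>G'\<close> with \<phi>' bound Y, the integral of \<open>(G (\<psi> m))\<^sup>2\<close>, by
  K C times the integral of the gradient of \<open>\<phi> (\<psi> m)\<close> against the gradient of
  \<open>\<psi> m\<close>. Replacing the latter gradient by \<open>g\<close> brings in the equation,
  tested with the admissible function \<open>\<phi> (\<psi> m)\<close>, at the price of an error
  controlled by the bound on \<phi>'. Young's inequality and the comparison of \<phi> with
  \<open>G\<close> then let Y / q be absorbed on the left.\<close>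

lemma nonlinear_energy_bound:
  fixes \<Omega> :: "(real^'n) set" and g :: "real^'n \<Rightarrow> real^'n"
  defines "M \<equiv> lebesgue_on \<Omega>"
  assumes \<Omega>: "\<Omega> \<in> sets lebesgue" and K: "poincare_on \<Omega> K"
    and p: "1 < p" "q = p / (p - 1)"
    and \<psi>: "\<And>m. \<psi> m \<in> test_functions \<Omega>"
    and g: "square_integrable M g" "(\<lambda>m. L2norm M (\<lambda>x. gradient (\<psi> m) x - g x)) \<longlonglongrightarrow> 0"
    and weak: "\<And>\<xi>. \<xi> \<in> test_functions \<Omega> \<Longrightarrow> (LINT x|M. g x \<bullet> gradient \<xi> x) = (LINT x|M. F x * \<xi> x)"
    and F: "F \<in> borel_measurable M" "(\<integral>\<^sup>+x. ennreal (norm (F x) powr p) \<partial>M) = 1"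
    and C: "0 < C"
    and der: "\<And>s. (\<phi> has_real_derivative \<phi>' s) (at s)" "\<And>s. (G has_real_derivative G' s) (at s)"
    and zero: "\<phi> 0 = 0" "G 0 = 0"
    and cmp: "\<And>s. (G' s)\<^sup>2 \<le> C * \<phi>' s" "\<And>s. \<bar>\<phi>' s\<bar> \<le> B" "\<And>s. \<bar>\<phi> s\<bar> powr q \<le> (G s)\<^sup>2"
    and sm: "\<And>f. smooth f \<Longrightarrow> smooth (\<lambda>x::real^'n. \<phi> (f x))" "\<And>f. smooth f \<Longrightarrow> smooth (\<lambda>x::real^'n. G (f x))"
  shows "\<exists>r. r \<longlonglongrightarrow> 0 \<and>
    (\<forall>m. (\<integral>\<^sup>+x. ennreal ((G (\<psi> m x))\<^sup>2) \<partial>M) \<le> ennreal ((K * C) powr p + r m))"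
proof (intro exI conjI allI)
  define e where "e m = L2norm M (\<lambda>x. gradient (\<psi> m) x - g x)" for m
  \<comment> \<open>The error of replacing the gradient of \<open>\<psi> m\<close> by
    \<open>g\<close>. The factor \<open>p\<close> appears because Y / p is what remains after the
    absorption.\<close>
  define r where "r m = p * (K * C * (B * (L2norm M g + e m) * e m))" for m
  have K0: "0 < K" using K by (simp add: poincare_on_def)
  have B0: "0 \<le> B" using cmp(2)[of 0] by linarith
  have e0: "0 \<le> e m" for m by (simp add: e_def)
  have e: "e \<longlonglongrightarrow> 0" using g(2) by (simp add: e_def[abs_def])
  have "r \<longlonglongrightarrow> p * (K * C * (B * (L2norm M g + 0) * 0))"
    unfolding r_def by (intro tendsto_intros e)
  then show "r \<longlonglongrightarrow> 0" by simp
  have pq: "1 < q" "1 / p + 1 / q = 1"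
    unfolding p(2) using p(1) by (simp_all add: field_simps)
  fix m
  have tG: "(\<lambda>x. G (\<psi> m x)) \<in> test_functions \<Omega>" and t\<Phi>: "(\<lambda>x. \<phi> (\<psi> m x)) \<in> test_functions \<Omega>"
    by (rule test_functions_compose[OF \<psi> sm(2)[OF test_functions_smooth[OF \<psi>]] zero(2)],
        rule test_functions_compose[OF \<psi> sm(1)[OF test_functions_smooth[OF \<psi>]] zero(1)])
  note d = smooth_differentiable[OF test_functions_smooth[OF \<psi>[of m]]]
  have gG: "gradient (\<lambda>x. G (\<psi> m x)) = (\<lambda>x. G' (\<psi> m x) *\<^sub>R gradient (\<psi> m) x)"
    by (intro ext partial_deriv_compose(3) d der)
  have g\<Phi>: "gradient (\<lambda>x. \<phi> (\<psi> m x)) = (\<lambda>x. \<phi>' (\<psi> m x) *\<^sub>R gradient (\<psi> m) x)"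
    by (intro ext partial_deriv_compose(3) d der)
  note sG = test_functions_square_integrable[OF tG \<Omega>, folded M_def]
  note s\<Phi> = test_functions_square_integrable[OF t\<Phi> \<Omega>, folded M_def]
  note s\<psi> = test_functions_square_integrable[OF \<psi>[of m] \<Omega>, folded M_def]
  define Y where "Y = (L2norm M (\<lambda>x. G (\<psi> m x)))\<^sup>2"
  let ?D = "gradient (\<lambda>x. \<phi> (\<psi> m x))"
  have "Y \<le> K * (L2norm M (gradient (\<lambda>x. G (\<psi> m x))))\<^sup>2"
    using K tG by (simp add: poincare_on_def Y_def M_def)
  also have "\<dots> \<le> K * (C * (LINT x|M. ?D x \<bullet> gradient (\<psi> m) x))"
  proof -
    have "(L2norm M (gradient (\<lambda>x. G (\<psi> m x))))\<^sup>2 \<le> (LINT x|M. C * (?D x \<bullet> gradient (\<psi> m) x))"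
      unfolding L2norm_power2
    proof (rule integral_mono)
      show "integrable M (\<lambda>x. (norm (gradient (\<lambda>x. G (\<psi> m x)) x))\<^sup>2)"
        using sG(2) by (simp add: square_integrable_def)
      show "integrable M (\<lambda>x. C * (?D x \<bullet> gradient (\<psi> m) x))"
        using square_integrable_inner[OF s\<Phi>(2) s\<psi>(2)] by simp
      fix x
      show "(norm (gradient (\<lambda>x. G (\<psi> m x)) x))\<^sup>2 \<le> C * (?D x \<bullet> gradient (\<psi> m) x)"
        using mult_right_mono[OF cmp(1)[of "\<psi> m x"], of "(norm (gradient (\<psi> m) x))\<^sup>2"]
        by (simp add: gG g\<Phi> power_mult_distrib dot_square_norm mult_ac)
    qed
    then show ?thesis using K0 by (simp add: mult_left_mono)
  qed
  also have "(LINT x|M. ?D x \<bullet> gradient (\<psi> m) x) =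
      (LINT x|M. ?D x \<bullet> g x) + (LINT x|M. ?D x \<bullet> (gradient (\<psi> m) x - g x))"
    by (subst Bochner_Integration.integral_add[symmetric])
      (auto intro!: square_integrable_inner square_integrable_diff s\<Phi>(2) s\<psi>(2) g(1) simp: inner_diff_right)
  also have "(LINT x|M. ?D x \<bullet> g x) = (LINT x|M. F x * \<phi> (\<psi> m x))"
    using weak[OF t\<Phi>] by (simp add: inner_commute)
  also have "(LINT x|M. ?D x \<bullet> (gradient (\<psi> m) x - g x)) \<le> B * (L2norm M g + e m) * e m"
  proof -
    have "L2norm M (gradient (\<psi> m)) \<le> L2norm M g + e m"
      using L2norm_triangle[OF g(1) square_integrable_diff[OF s\<psi>(2) g(1)]] by (simp add: e_def)
    then have "B * L2norm M (gradient (\<psi> m)) \<le> B * (L2norm M g + e m)"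
      using B0 by (rule mult_left_mono)
    moreover have "L2norm M ?D \<le> B * L2norm M (gradient (\<psi> m))"
      by (rule L2norm_mono[OF s\<Phi>(2) s\<psi>(2) _ B0]) (simp add: g\<Phi> cmp(2) mult_right_mono)
    ultimately have "L2norm M ?D * e m \<le> B * (L2norm M g + e m) * e m"
      by (intro mult_right_mono e0) simp
    moreover have "\<bar>LINT x|M. ?D x \<bullet> (gradient (\<psi> m) x - g x)\<bar> \<le> L2norm M ?D * e m"
      unfolding e_def by (intro L2_Cauchy_Schwarz square_integrable_diff s\<Phi>(2) s\<psi>(2) g(1))
    ultimately show ?thesis by linarith
  qed
  finally have Y1: "Y \<le> K * (C * ((LINT x|M. F x * \<phi> (\<psi> m x)) + B * (L2norm M g + e m) * e m))"
    using K0 C by (meson add_left_mono less_imp_le mult_left_mono order_trans)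
  have iF: "integrable M (\<lambda>x. norm (F x) powr p)"
    using F by (intro integrableI_bounded) auto
  have intF: "(LINT x|M. norm (F x) powr p) = 1"
    using F by (subst integral_eq_nn_integral) auto
  have [measurable]: "(\<lambda>x. \<phi> (\<psi> m x)) \<in> borel_measurable M" using s\<Phi>(1) by (rule square_integrable_measurable)
  have iG: "integrable M (\<lambda>x. (G (\<psi> m x))\<^sup>2)"
    using sG(1) by (simp add: square_integrable_def)
  have i\<Phi>: "integrable M (\<lambda>x. \<bar>\<phi> (\<psi> m x)\<bar> powr q)"
    by (rule Bochner_Integration.integrable_bound[OF iG]) (auto simp: cmp(3))
  \<comment> \<open>The constant K C is kept with \<open>F\<close> in Young's inequality, so that
    the term to absorb has coefficient exactly 1/q and the result is the p-th power of K C.\<close>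
  have "(LINT x|M. K * C * (F x * \<phi> (\<psi> m x))) \<le>
      (LINT x|M. (K * C) powr p / p * (norm (F x) powr p) + (\<bar>\<phi> (\<psi> m x)\<bar> powr q) / q)"
  proof (rule integral_mono')
    fix x
    have "K * C * (F x * \<phi> (\<psi> m x)) \<le> (K * C * \<bar>F x\<bar>) * \<bar>\<phi> (\<psi> m x)\<bar>"
    proof -
      have "K * C * (F x * \<phi> (\<psi> m x)) \<le> K * C * \<bar>F x * \<phi> (\<psi> m x)\<bar>"
        using K0 C by (intro mult_left_mono abs_ge_self) simp
      then show ?thesis by (simp only: abs_mult mult.assoc)
    qed
    also have "\<dots> \<le> (K * C * \<bar>F x\<bar>) powr p / p + \<bar>\<phi> (\<psi> m x)\<bar> powr q / q"
      using p pq K0 C by (intro Youngs_inequality) auto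
    finally show "K * C * (F x * \<phi> (\<psi> m x)) \<le>
        (K * C) powr p / p * (norm (F x) powr p) + (\<bar>\<phi> (\<psi> m x)\<bar> powr q) / q"
      using K0 C by (simp add: powr_mult)
    show "0 \<le> (K * C) powr p / p * (norm (F x) powr p) + (\<bar>\<phi> (\<psi> m x)\<bar> powr q) / q"
      using p pq by simp
  qed (use iF i\<Phi> in auto)
  also have "\<dots> = (K * C) powr p / p + (LINT x|M. \<bar>\<phi> (\<psi> m x)\<bar> powr q) / q"
    using iF i\<Phi> intF by simp
  also have "(LINT x|M. \<bar>\<phi> (\<psi> m x)\<bar> powr q) \<le> Y"
    unfolding Y_def L2norm_power2 using iG i\<Phi> by (intro integral_mono) (auto simp: cmp(3))
  finally have "K * C * (LINT x|M. F x * \<phi> (\<psi> m x)) \<le> (K * C) powr p / p + Y / q"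
    using pq by (simp add: divide_right_mono)
  then have "Y \<le> (K * C) powr p / p + Y / q + r m / p"
  proof -
    have "r m / p = K * C * (B * (L2norm M g + e m) * e m)" using p by (simp add: r_def)
    moreover have "K * (C * ((LINT x|M. F x * \<phi> (\<psi> m x)) + B * (L2norm M g + e m) * e m)) =
        K * C * (LINT x|M. F x * \<phi> (\<psi> m x)) + K * C * (B * (L2norm M g + e m) * e m)"
      by (simp only: distrib_left mult.assoc)
    ultimately show ?thesis using Y1 \<open>K * C * (LINT x|M. F x * \<phi> (\<psi> m x)) \<le> (K * C) powr p / p + Y / q\<close>
      by linarith
  qed
  moreover have "Y / q = Y - Y / p"
  proof -
    have "1 / q = 1 - 1 / p" using pq(2) by linarith
    then have "Y * (1 / q) = Y * (1 - 1 / p)" by (simp only:)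
    then show ?thesis by (simp add: right_diff_distrib)
  qed
  ultimately have "Y / p \<le> ((K * C) powr p + r m) / p" by (simp add: add_divide_distrib)
  then have "Y \<le> (K * C) powr p + r m" using p by (simp add: divide_le_cancel)
  moreover have "(\<integral>\<^sup>+x. ennreal ((G (\<psi> m x))\<^sup>2) \<partial>M) = ennreal Y"
    using nn_integral_eq_L2norm[OF sG(1)] by (simp add: Y_def)
  ultimately show "(\<integral>\<^sup>+x. ennreal ((G (\<psi> m x))\<^sup>2) \<partial>M) \<le> ennreal ((K * C) powr p + r m)"
    by (simp add: ennreal_leI)
qed

section \<open>Passing to the limit on compact subsets\<close>

lemma borel_measurable_lebesgue_on_subset:
  assumes "f \<in> borel_measurable (lebesgue_on \<Omega>)" "S \<subseteq> \<Omega>"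
  shows "f \<in> borel_measurable (lebesgue_on S)"
  using assms by (rule measurable_restrict_mono)

lemma nn_integral_lebesgue_on_mono:
  assumes "S \<in> sets lebesgue" "\<Omega> \<in> sets lebesgue" "S \<subseteq> \<Omega>"
  shows "(\<integral>\<^sup>+x. f x \<partial>lebesgue_on S) \<le> (\<integral>\<^sup>+x. f x \<partial>lebesgue_on \<Omega>)"
  using assms
  by (subst (1 2) nn_integral_restrict_space) (auto intro!: nn_integral_mono split: split_indicator)

lemma lebesgue_sets_compact:
  fixes S :: "'a::euclidean_space set"
  assumes "compact S"
  shows "S \<in> sets lebesgue"
proof -
  have "S \<in> sets lborel" using borel_closed[OF compact_imp_closed[OF assms]] by simp
  then show ?thesis by (rule sets_completionI_sets)
qed

lemma lebesgue_sets_open: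
  fixes S :: "'a::euclidean_space set"
  assumes "open S"
  shows "S \<in> sets lebesgue"
proof -
  have "S \<in> sets lborel" using borel_open[OF assms] by simp
  then show ?thesis by (rule sets_completionI_sets)
qed

text \<open>Convergence in L^1 on \<open>S\<close> gives almost everywhere convergence of a
  subsequence, and Fatou's lemma carries the bound over. The argument is confined to compact sets
  because approximants of an element of the energy space converge only in L^1_loc.\<close>

lemma Fatou_local:
  fixes u :: "real^'n \<Rightarrow> real"
  assumes \<Omega>: "\<Omega> \<in> sets lebesgue" and u: "u \<in> borel_measurable (lebesgue_on \<Omega>)"
    and \<psi>: "\<And>m::nat. \<psi> m \<in> borel_measurable borel"
    and S: "compact S" "S \<subseteq> \<Omega>" "(\<lambda>m. Lp_norm 1 S (\<lambda>x. \<psi> m x - u x)) \<longlonglongrightarrow> 0"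
    and H: "continuous_on UNIV H"
    and r: "r \<longlonglongrightarrow> 0"
    and bd: "\<And>m. (\<integral>\<^sup>+x. ennreal (H (\<psi> m x)) \<partial>lebesgue_on \<Omega>) \<le> ennreal (c + r m)"
  shows "(\<integral>\<^sup>+x. ennreal (H (u x)) \<partial>lebesgue_on S) \<le> ennreal c"
proof -
  let ?M = "lebesgue_on S"
  have Ss: "S \<in> sets lebesgue" by (rule lebesgue_sets_compact[OF S(1)])
  have [measurable]: "u \<in> borel_measurable ?M" using u S(2) by (rule borel_measurable_lebesgue_on_subset)
  have [measurable]: "\<psi> m \<in> borel_measurable ?M" for m by (rule borel_measurable_lebesgue_on_borel[OF \<psi>])
  have [measurable]: "H \<in> borel_measurable borel" using H by (rule borel_measurable_continuous_onI)
  have conv: "(\<lambda>m. \<integral>\<^sup>+x. ennreal (norm (\<psi> m x - u x)) \<partial>?M) \<longlonglongrightarrow> 0"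
    using S(3) by (subst (asm) Lp_norm_tendsto_0_iff) auto
  then have "eventually (\<lambda>m. (\<integral>\<^sup>+x. ennreal (norm (\<psi> m x - u x)) \<partial>?M) < \<infinity>) sequentially"
    by (rule order_tendstoD) simp
  \<comment> \<open>The L^1 distances may be infinite for the first indices, so these are dropped
    before integrability is claimed.\<close>
  then obtain N where N: "\<And>m. N \<le> m \<Longrightarrow> (\<integral>\<^sup>+x. ennreal (norm (\<psi> m x - u x)) \<partial>?M) < \<infinity>"
    by (auto simp: eventually_sequentially)
  define v where "v m x = \<psi> (m + N) x - u x" for m x
  have int: "integrable ?M (v m)" for m
    unfolding v_def by (rule integrableI_bounded) (use N in auto)
  have "(\<lambda>m. \<integral>\<^sup>+x. ennreal (norm (v m x)) \<partial>?M) \<longlonglongrightarrow> 0"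
    unfolding v_def using LIMSEQ_ignore_initial_segment[OF conv] .
  then have "(\<lambda>m. ennreal (LINT x|?M. norm (v m x))) \<longlonglongrightarrow> ennreal 0"
    using int by (simp add: nn_integral_eq_integral)
  then have "(\<lambda>m. LINT x|?M. norm (v m x)) \<longlonglongrightarrow> 0"
    by (subst (asm) tendsto_ennreal_iff) auto
  from tendsto_L1_AE_subseq[OF int this]
  obtain s where s: "strict_mono s" "AE x in ?M. (\<lambda>n. v (s n) x) \<longlonglongrightarrow> 0" by blast
  define t where "t n = s n + N" for n
  have lim: "AE x in ?M. (\<lambda>n. ennreal (H (\<psi> (t n) x))) \<longlonglongrightarrow> ennreal (H (u x))"
    using s(2)
  proof eventually_elim
    case (elim x)
    then have "(\<lambda>n. \<psi> (t n) x) \<longlonglongrightarrow> u x"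
      using LIM_zero_iff[of "\<lambda>n. \<psi> (t n) x" "u x" sequentially] by (simp add: v_def t_def)
    then have "(\<lambda>n. H (\<psi> (t n) x)) \<longlonglongrightarrow> H (u x)"
      using H continuous_on_tendsto_compose[of UNIV H] by auto
    then show ?case by (rule tendsto_ennrealI)
  qed
  have "(\<integral>\<^sup>+x. ennreal (H (u x)) \<partial>?M) \<le> (\<integral>\<^sup>+x. liminf (\<lambda>n. ennreal (H (\<psi> (t n) x))) \<partial>?M)"
  proof (rule nn_integral_mono_AE)
    show "AE x in ?M. ennreal (H (u x)) \<le> liminf (\<lambda>n. ennreal (H (\<psi> (t n) x)))"
      using lim
    proof eventually_elim
      case (elim x)
      then show ?case using lim_imp_Liminf[OF _ elim] by simp
    qed
  qed
  also have "\<dots> \<le> liminf (\<lambda>n. \<integral>\<^sup>+x. ennreal (H (\<psi> (t n) x)) \<partial>?M)"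
    by (rule nn_integral_liminf) measurable
  also have "\<dots> \<le> liminf (\<lambda>n. ennreal (c + r (t n)))"
  proof (intro Liminf_mono always_eventually allI)
    fix n
    show "(\<integral>\<^sup>+x. ennreal (H (\<psi> (t n) x)) \<partial>?M) \<le> ennreal (c + r (t n))"
      using nn_integral_lebesgue_on_mono[OF Ss \<Omega> S(2)] bd by (rule order_trans)
  qed
  also have "\<dots> = ennreal c"
  proof (rule lim_imp_Liminf)
    have "strict_mono t" using s(1) by (simp add: t_def strict_mono_def)
    then have "(\<lambda>n. c + r (t n)) \<longlonglongrightarrow> c + 0"
      using LIMSEQ_subseq_LIMSEQ[OF r] by (intro tendsto_intros) (simp add: o_def)
    then show "(\<lambda>n. ennreal (c + r (t n))) \<longlonglongrightarrow> ennreal c" by (auto intro: tendsto_ennrealI)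
  qed simp
  finally show ?thesis .
qed

text \<open>Monotone convergence along a compact exhaustion turns uniform local bounds into a global
  one.\<close>

lemma nn_integral_le_exhaustion:
  fixes f :: "'a::euclidean_space \<Rightarrow> ennreal"
  assumes "open \<Omega>" "f \<in> borel_measurable (lebesgue_on \<Omega>)"
    and bd: "\<And>S. compact S \<Longrightarrow> S \<subseteq> \<Omega> \<Longrightarrow> (\<integral>\<^sup>+x. f x \<partial>lebesgue_on S) \<le> c"
  shows "(\<integral>\<^sup>+x. f x \<partial>lebesgue_on \<Omega>) \<le> c"
proof -
  obtain C where C: "\<And>n. compact (C n)" "\<And>n. C n \<subseteq> \<Omega>" "\<And>n. C n \<subseteq> interior (C (Suc n))" "\<Union> (range C) = \<Omega>"
    using open_Union_compact_subsets[OF assms(1)] by metis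
  have Cs: "C n \<in> sets lebesgue" for n
    by (rule lebesgue_sets_compact[OF C(1)])
  have mono: "incseq C"
    by (rule incseq_SucI) (rule subset_trans[OF C(3) interior_subset])
  have \<Omega>: "\<Omega> \<in> sets lebesgue" by (rule lebesgue_sets_open[OF assms(1)])
  have [measurable]: "(\<lambda>x. f x * indicator \<Omega> x) \<in> borel_measurable lebesgue"
    using assms(2) borel_measurable_restrict_space_iff_ennreal[of \<Omega> lebesgue f] \<Omega> by simp
  have fC: "(\<lambda>x. f x * indicator (C n) x) = (\<lambda>x. (f x * indicator \<Omega> x) * indicator (C n) x)" for n
    by (rule ext) (use C(2)[of n] in \<open>auto split: split_indicator\<close>)
  have sup: "(SUP n. f x * indicator (C n) x) = f x * indicator \<Omega> x" for x
  proof (cases "x \<in> \<Omega>")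
    case True
    then obtain n where "x \<in> C n" using C(4) by auto
    then have n: "f x * indicator (C n) x = f x * indicator \<Omega> x" using True by simp
    show ?thesis
    proof (rule SUP_eqI)
      show "f x * indicator (C m) x \<le> f x * indicator \<Omega> x" for m
        using True by (simp split: split_indicator)
      show "f x * indicator \<Omega> x \<le> y" if "\<And>m. m \<in> UNIV \<Longrightarrow> f x * indicator (C m) x \<le> y" for y
        using that[of n] n by simp
    qed
  next
    case False
    then have "x \<notin> C n" for n using C(2) by auto
    then show ?thesis using False by simp
  qed
  have "(\<integral>\<^sup>+x. f x \<partial>lebesgue_on \<Omega>) = (\<integral>\<^sup>+x. (SUP n. f x * indicator (C n) x) \<partial>lebesgue)"
    unfolding sup using \<Omega> by (simp add: nn_integral_restrict_space)
  also have "\<dots> = (SUP n. \<integral>\<^sup>+x. f x * indicator (C n) x \<partial>lebesgue)"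
  proof (rule nn_integral_monotone_convergence_SUP)
    show "incseq (\<lambda>n x. f x * indicator (C n) x)"
    proof (intro incseq_SucI le_funI)
      fix n x
      show "f x * indicator (C n) x \<le> f x * indicator (C (Suc n)) x"
        using incseq_SucD[OF mono, of n] by (auto split: split_indicator)
    qed
    show "(\<lambda>x. f x * indicator (C n) x) \<in> borel_measurable lebesgue" for n
      unfolding fC using Cs by measurable
  qed
  also have "\<dots> \<le> c"
    using bd[OF C(1,2)] Cs by (intro SUP_least) (simp add: nn_integral_restrict_space)
  finally show ?thesis .
qed

text \<open>An a priori bound linear in the Poincare constant. Nothing is assumed about
  integrability of \<open>u\<close>: membership in L^p comes out of the two applications of Fatou's
  lemma.\<close>

theorem weak_solution_Lp_bound:
  fixes p :: real
  assumes p: "1 < p"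
  obtains C where "0 < C"
    "\<And>(\<Omega> :: (real^'n) set) K F u. open \<Omega> \<Longrightarrow> poincare_on \<Omega> K \<Longrightarrow> F \<in> Lp_space p \<Omega> \<Longrightarrow>
      Lp_norm p \<Omega> F = 1 \<Longrightarrow> weak_solution \<Omega> F u \<Longrightarrow> Lp_norm p \<Omega> u \<le> ennreal (C * K)"
proof -
  define q where "q = p / (p - 1)"
  show ?thesis
  proof (rule regularised_powers[OF p q_def, where 'n = 'n])
    fix C and \<phi> \<phi>' G G' :: "real \<Rightarrow> real \<Rightarrow> real" and B :: "real \<Rightarrow> real"
    assume C: "0 < C" and
    der: "\<And>\<delta> s. 0 < \<delta> \<Longrightarrow> (\<phi> \<delta> has_real_derivative \<phi>' \<delta> s) (at s)"
    "\<And>\<delta> s. 0 < \<delta> \<Longrightarrow> (G \<delta> has_real_derivative G' \<delta> s) (at s)" and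
    zero: "\<And>\<delta>. 0 < \<delta> \<Longrightarrow> \<phi> \<delta> 0 = 0" "\<And>\<delta>. 0 < \<delta> \<Longrightarrow> G \<delta> 0 = 0" and
    cmp: "\<And>\<delta> s. 0 < \<delta> \<Longrightarrow> (G' \<delta> s)\<^sup>2 \<le> C * \<phi>' \<delta> s"
    "\<And>\<delta> s. 0 < \<delta> \<Longrightarrow> \<bar>\<phi>' \<delta> s\<bar> \<le> B \<delta>"
    "\<And>\<delta> s. 0 < \<delta> \<Longrightarrow> \<bar>\<phi> \<delta> s\<bar> powr q \<le> (G \<delta> s)\<^sup>2" and
    sm: "\<And>\<delta> f. 0 < \<delta> \<Longrightarrow> smooth f \<Longrightarrow> smooth (\<lambda>x::real^'n. \<phi> \<delta> (f x))"
    "\<And>\<delta> f. 0 < \<delta> \<Longrightarrow> smooth f \<Longrightarrow> smooth (\<lambda>x::real^'n. G \<delta> (f x))" and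
    lim: "\<And>s. ((\<lambda>\<delta>. (G \<delta> s)\<^sup>2) \<longlongrightarrow> \<bar>s\<bar> powr p) (at_right 0)"
    show ?thesis
    proof (rule that[OF C])
    fix \<Omega> :: "(real^'n) set" and K F u
    assume op: "open \<Omega>" and K: "poincare_on \<Omega> K" and F: "F \<in> Lp_space p \<Omega>" "Lp_norm p \<Omega> F = 1"
      and sol: "weak_solution \<Omega> F u"
    let ?M = "lebesgue_on \<Omega>"
    have \<Omega>: "\<Omega> \<in> sets lebesgue" by (rule lebesgue_sets_open[OF op])
    have K0: "0 < K" using K by (simp add: poincare_on_def)
    from sol obtain g where W: "W12_0_with_gradient \<Omega> u g"
      and weak0: "\<forall>\<xi>\<in>test_functions \<Omega>. (LINT x|?M. g x \<bullet> gradient \<xi> x) = (LINT x|?M. F x * \<xi> x)"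
      unfolding weak_solution_def by blast
    note weak = bspec[OF weak0]
    from W have u: "u \<in> borel_measurable ?M" and g: "g \<in> Lp_space 2 \<Omega>"
      by (auto simp: W12_0_with_gradient_def)
    from W obtain \<psi> where \<psi>0: "\<forall>m::nat. \<psi> m \<in> test_functions \<Omega>"
      and gconv: "(\<lambda>m. Lp_norm 2 \<Omega> (\<lambda>x. gradient (\<psi> m) x - g x)) \<longlonglongrightarrow> 0"
      and uconv0: "\<forall>S. compact S \<and> S \<subseteq> \<Omega> \<longrightarrow> (\<lambda>m. Lp_norm 1 S (\<lambda>x. \<psi> m x - u x)) \<longlonglongrightarrow> 0"
      unfolding W12_0_with_gradient_def by blast
    note \<psi> = \<psi>0[rule_format] and uconv = uconv0[rule_format, OF conjI]
    have g2: "square_integrable ?M g" using g by (simp add: square_integrable_Lp_space)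
    have gconv2: "(\<lambda>m. L2norm ?M (\<lambda>x. gradient (\<psi> m) x - g x)) \<longlonglongrightarrow> 0"
      using gconv test_functions_square_integrable(2)[OF \<psi> \<Omega>] g2
      by (subst (asm) square_integrable_tendsto_iff) (auto intro: square_integrable_diff)
    have Fm: "F \<in> borel_measurable ?M" using F by (simp add: Lp_space_def)
    have Fi: "(\<integral>\<^sup>+x. ennreal (norm (F x) powr p) \<partial>?M) = 1"
      using F(2) p by (subst (asm) Lp_norm_eq_1_iff) auto
    have Gcont: "continuous_on UNIV (G \<delta>)" if "0 < \<delta>" for \<delta>
      using der(2)[OF that] by (intro continuous_at_imp_continuous_on ballI DERIV_isCont) auto
    \<comment> \<open>The approximation index is sent to infinity at fixed \<delta>, since the error
      \<open>r\<close> contains the constant \<open>B \<delta>\<close>, for which no bound uniform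
      in \<delta> is available.\<close>
    have step: "(\<integral>\<^sup>+x. ennreal ((G \<delta> (u x))\<^sup>2) \<partial>?M) \<le> ennreal ((K * C) powr p)" if \<delta>: "0 < \<delta>" for \<delta>
    proof -
      obtain r where r: "r \<longlonglongrightarrow> 0"
        "\<And>m. (\<integral>\<^sup>+x. ennreal ((G \<delta> (\<psi> m x))\<^sup>2) \<partial>?M) \<le> ennreal ((K * C) powr p + r m)"
        using nonlinear_energy_bound[OF \<Omega> K p q_def \<psi> g2 gconv2 weak Fm Fi C der[OF \<delta>] zero[OF \<delta>] cmp[OF \<delta>] sm[OF \<delta>]]
        by blast
      show ?thesis
      proof (rule nn_integral_le_exhaustion[OF op])
        have "G \<delta> \<in> borel_measurable borel" using Gcont[OF \<delta>] by (rule borel_measurable_continuous_onI)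
        then show "(\<lambda>x. ennreal ((G \<delta> (u x))\<^sup>2)) \<in> borel_measurable ?M" using u by measurable
        fix S assume S: "compact S" "S \<subseteq> \<Omega>"
        show "(\<integral>\<^sup>+x. ennreal ((G \<delta> (u x))\<^sup>2) \<partial>lebesgue_on S) \<le> ennreal ((K * C) powr p)"
          by (rule Fatou_local[OF \<Omega> u borel_measurable_smooth(1)[OF test_functions_smooth[OF \<psi>]] S uconv[OF S],
                where H = "\<lambda>s. (G \<delta> s)\<^sup>2", OF _ r])
            (intro continuous_intros Gcont[OF \<delta>])
      qed
    qed
    define \<delta> where "\<delta> n = inverse (real (Suc n))" for n
    have \<delta>: "filterlim \<delta> (at_right 0) sequentially"
      unfolding \<delta>_def[abs_def] using LIMSEQ_inverse_real_of_nat by (auto simp: filterlim_at)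
    have "(\<integral>\<^sup>+x. ennreal (norm (u x) powr p) \<partial>?M) = (\<integral>\<^sup>+x. liminf (\<lambda>n. ennreal ((G (\<delta> n) (u x))\<^sup>2)) \<partial>?M)"
    proof (rule nn_integral_cong)
      fix x
      have "(\<lambda>n. (G (\<delta> n) (u x))\<^sup>2) \<longlonglongrightarrow> \<bar>u x\<bar> powr p"
        using filterlim_compose[OF lim \<delta>] .
      from lim_imp_Liminf[OF _ tendsto_ennrealI[OF this]]
      show "ennreal (norm (u x) powr p) = liminf (\<lambda>n. ennreal ((G (\<delta> n) (u x))\<^sup>2))" by simp
    qed
    also have "\<dots> \<le> liminf (\<lambda>n. \<integral>\<^sup>+x. ennreal ((G (\<delta> n) (u x))\<^sup>2) \<partial>?M)"
    proof (rule nn_integral_liminf)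
      fix n
      have "G (\<delta> n) \<in> borel_measurable borel"
        by (rule borel_measurable_continuous_onI, rule Gcont) (simp add: \<delta>_def)
      then show "(\<lambda>x. ennreal ((G (\<delta> n) (u x))\<^sup>2)) \<in> borel_measurable ?M" using u by measurable
    qed
    also have "\<dots> \<le> liminf (\<lambda>n::nat. ennreal ((K * C) powr p))"
      by (intro Liminf_mono always_eventually allI step) (simp add: \<delta>_def)
    finally have "(\<integral>\<^sup>+x. ennreal (norm (u x) powr p) \<partial>?M) \<le> ennreal ((K * C) powr p)"
      by (simp add: Liminf_const)
    then show "Lp_norm p \<Omega> u \<le> ennreal (C * K)"
      using p C K0 by (simp add: Lp_norm_le_iff mult.commute)
    qed
  qed
qed

section \<open>Existence of weak solutions\<close>

text \<open>The Riesz-Fischer argument for functions. A subsequence is chosen with squared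
  increments of size 8^(-n); the weights 4^n still leave a summable series 2^(-n), so almost
  everywhere the increments are bounded by a multiple of 2^(-n) and their series converges
  absolutely.\<close>

lemma L2_complete:
  fixes f :: "nat \<Rightarrow> 'a \<Rightarrow> 'b::euclidean_space"
  assumes f: "\<And>m. square_integrable M (f m)"
    and Cauchy: "\<And>e. 0 < e \<Longrightarrow> \<exists>N. \<forall>m\<ge>N. \<forall>n\<ge>N. L2norm M (\<lambda>x. f m x - f n x) \<le> e"
  shows "\<exists>g. square_integrable M g \<and> (\<lambda>m. L2norm M (\<lambda>x. f m x - g x)) \<longlonglongrightarrow> 0"
proof -
  have [measurable]: "f m \<in> borel_measurable M" for m by (rule square_integrable_measurable[OF f])
  have "\<forall>n. \<exists>N. \<forall>m\<ge>N. \<forall>k\<ge>N. L2norm M (\<lambda>x. f m x - f k x) \<le> sqrt ((1/8) ^ n)"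
    by (intro allI Cauchy) simp
  then obtain N where N: "\<And>n m k. N n \<le> m \<Longrightarrow> N n \<le> k \<Longrightarrow> L2norm M (\<lambda>x. f m x - f k x) \<le> sqrt ((1/8) ^ n)"
    by metis
  \<comment> \<open>A strictly increasing index that dominates both \<open>N n\<close> and
    \<open>n\<close>.\<close>
  define r where "r n = (\<Sum>i\<le>n. N i) + n" for n
  have r_Suc: "r (Suc n) = r n + N (Suc n) + 1" for n by (simp add: r_def)
  have rN: "N n \<le> r n" for n
    unfolding r_def using member_le_sum[of n "{..n}" N] by simp
  have rn: "n \<le> r n" for n by (simp add: r_def)
  define \<Delta> where "\<Delta> n x = f (r (Suc n)) x - f (r n) x" for n x
  have sq\<Delta>: "square_integrable M (\<Delta> n)" for n
    unfolding \<Delta>_def by (intro square_integrable_diff f)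
  have [measurable]: "\<Delta> n \<in> borel_measurable M" for n by (rule square_integrable_measurable[OF sq\<Delta>])
  have \<Delta>: "(\<integral>\<^sup>+x. ennreal ((norm (\<Delta> n x))\<^sup>2) \<partial>M) \<le> ennreal ((1/8) ^ n)" for n
  proof -
    have "L2norm M (\<Delta> n) \<le> sqrt ((1/8) ^ n)"
      unfolding \<Delta>_def using rN[of n] by (intro N) (auto simp: r_Suc)
    then have "(L2norm M (\<Delta> n))\<^sup>2 \<le> (sqrt ((1/8) ^ n))\<^sup>2" by (rule power_mono) simp
    then show ?thesis by (simp add: nn_integral_eq_L2norm[OF sq\<Delta>] ennreal_leI)
  qed
  have "(\<integral>\<^sup>+x. (\<Sum>n. ennreal (4 ^ n) * ennreal ((norm (\<Delta> n x))\<^sup>2)) \<partial>M) =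
      (\<Sum>n. ennreal (4 ^ n) * (\<integral>\<^sup>+x. ennreal ((norm (\<Delta> n x))\<^sup>2) \<partial>M))"
    by (subst nn_integral_suminf) (auto simp: nn_integral_cmult)
  also have "\<dots> \<le> (\<Sum>n. ennreal ((1/2) ^ n))"
  proof (intro suminf_le summableI)
    fix n
    have "ennreal (4 ^ n) * (\<integral>\<^sup>+x. ennreal ((norm (\<Delta> n x))\<^sup>2) \<partial>M) \<le> ennreal (4 ^ n) * ennreal ((1/8) ^ n)"
      by (intro mult_left_mono \<Delta>) simp
    also have "\<dots> = ennreal ((1/2) ^ n)"
      by (simp flip: ennreal_mult power_mult_distrib)
    finally show "ennreal (4 ^ n) * (\<integral>\<^sup>+x. ennreal ((norm (\<Delta> n x))\<^sup>2) \<partial>M) \<le> ennreal ((1/2) ^ n)" .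
  qed
  also have "\<dots> = ennreal (\<Sum>n. (1/2) ^ n)" by (rule suminf_ennreal2) (auto simp: summable_geometric)
  also have "\<dots> < \<infinity>" by simp
  finally have "AE x in M. (\<Sum>n. ennreal (4 ^ n) * ennreal ((norm (\<Delta> n x))\<^sup>2)) \<noteq> \<infinity>"
    by (intro nn_integral_noteq_infinite) auto
  then have conv: "AE x in M. convergent (\<lambda>n. f (r n) x)"
  proof eventually_elim
    case (elim x)
    then obtain c where c: "0 \<le> c" "(\<Sum>n. ennreal (4 ^ n) * ennreal ((norm (\<Delta> n x))\<^sup>2)) = ennreal c"
      by (cases "(\<Sum>n. ennreal (4 ^ n) * ennreal ((norm (\<Delta> n x))\<^sup>2))") auto
    have "norm (\<Delta> n x) \<le> sqrt c * (1/2) ^ n" for n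
    proof -
      have "ennreal (4 ^ n) * ennreal ((norm (\<Delta> n x))\<^sup>2) \<le> ennreal c"
        unfolding c(2)[symmetric]
        using sum_le_suminf[OF summableI, of "{n}" "\<lambda>n. ennreal (4 ^ n) * ennreal ((norm (\<Delta> n x))\<^sup>2)"] by simp
      then have "ennreal (4 ^ n * (norm (\<Delta> n x))\<^sup>2) \<le> ennreal c" by (simp add: ennreal_mult)
      then have "4 ^ n * (norm (\<Delta> n x))\<^sup>2 \<le> c" using c by (simp add: ennreal_le_iff)
      moreover have "(2 ^ n * norm (\<Delta> n x))\<^sup>2 = 4 ^ n * (norm (\<Delta> n x))\<^sup>2"
      proof -
        have "((2::real) ^ n)\<^sup>2 = (2\<^sup>2) ^ n" by (simp only: power_mult[symmetric] mult.commute)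
        then show ?thesis by (simp add: power_mult_distrib)
      qed
      ultimately have "2 ^ n * norm (\<Delta> n x) \<le> sqrt c" by (intro real_le_rsqrt) simp
      then show ?thesis by (simp add: field_simps)
    qed
    moreover have "summable (\<lambda>n. sqrt c * (1/2::real) ^ n)"
      by (intro summable_mult summable_geometric) simp
    ultimately have "summable (\<lambda>n. \<Delta> n x)"
      by (intro summable_comparison_test[of "\<lambda>n. \<Delta> n x" "\<lambda>n. sqrt c * (1/2) ^ n"]) auto
    then have "convergent (\<lambda>n. \<Sum>i<n. \<Delta> i x)" by (simp add: summable_iff_convergent)
    then have "convergent (\<lambda>n. f (r 0) x + (\<Sum>i<n. \<Delta> i x))" by (intro convergent_add convergent_const)
    moreover have "f (r 0) x + (\<Sum>i<n. \<Delta> i x) = f (r n) x" for n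
      using sum_lessThan_telescope[of "\<lambda>i. f (r i) x" n] by (simp add: \<Delta>_def)
    ultimately show ?case by simp
  qed
  \<comment> \<open>Where the subsequence diverges this is an unspecified value; that set is
    null.\<close>
  define g where "g x = lim (\<lambda>n. f (r n) x)" for x
  have [measurable]: "g \<in> borel_measurable M" unfolding g_def by (rule borel_measurable_lim_metric) measurable
  have lim: "AE x in M. (\<lambda>n. f (r n) x) \<longlonglongrightarrow> g x"
    using conv by eventually_elim (simp add: g_def convergent_LIMSEQ_iff)
  \<comment> \<open>Fatou's lemma in the second index of the Cauchy condition: the whole sequence,
    not just the subsequence, is close to the limit.\<close>
  have bound: "\<exists>N. \<forall>m\<ge>N. (\<integral>\<^sup>+x. ennreal ((norm (f m x - g x))\<^sup>2) \<partial>M) \<le> ennreal (e\<^sup>2)" if e: "0 < e" for e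
  proof -
    obtain N0 where N0: "\<And>m n. N0 \<le> m \<Longrightarrow> N0 \<le> n \<Longrightarrow> L2norm M (\<lambda>x. f m x - f n x) \<le> e"
      using Cauchy[OF e] by blast
    have "(\<integral>\<^sup>+x. ennreal ((norm (f m x - g x))\<^sup>2) \<partial>M) \<le> ennreal (e\<^sup>2)" if m: "N0 \<le> m" for m
    proof -
      have "(\<integral>\<^sup>+x. ennreal ((norm (f m x - g x))\<^sup>2) \<partial>M) =
          (\<integral>\<^sup>+x. liminf (\<lambda>n. ennreal ((norm (f m x - f (r n) x))\<^sup>2)) \<partial>M)"
      proof (rule nn_integral_cong_AE)
        show "AE x in M. ennreal ((norm (f m x - g x))\<^sup>2) = liminf (\<lambda>n. ennreal ((norm (f m x - f (r n) x))\<^sup>2))"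
          using lim
        proof eventually_elim
          case (elim x)
          have "(\<lambda>n. ennreal ((norm (f m x - f (r n) x))\<^sup>2)) \<longlonglongrightarrow> ennreal ((norm (f m x - g x))\<^sup>2)"
            by (intro tendsto_ennrealI tendsto_intros elim)
          from lim_imp_Liminf[OF _ this] show ?case by simp
        qed
      qed
      also have "\<dots> \<le> liminf (\<lambda>n. \<integral>\<^sup>+x. ennreal ((norm (f m x - f (r n) x))\<^sup>2) \<partial>M)"
        by (rule nn_integral_liminf) measurable
      also have "\<dots> \<le> liminf (\<lambda>n::nat. ennreal (e\<^sup>2))"
      proof (rule Liminf_mono)
        show "eventually (\<lambda>n. (\<integral>\<^sup>+x. ennreal ((norm (f m x - f (r n) x))\<^sup>2) \<partial>M) \<le> ennreal (e\<^sup>2)) sequentially"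
          using eventually_ge_at_top[of N0]
        proof eventually_elim
          case (elim n)
          have "L2norm M (\<lambda>x. f m x - f (r n) x) \<le> e" using m elim rn[of n] by (intro N0) auto
          then show ?case
            using nn_integral_eq_L2norm[OF square_integrable_diff[OF f f], of m "r n"]
            by (simp add: ennreal_leI power_mono)
        qed
      qed
      finally show ?thesis by (simp add: Liminf_const)
    qed
    then show ?thesis by blast
  qed
  obtain N1 where "\<And>m. N1 \<le> m \<Longrightarrow> (\<integral>\<^sup>+x. ennreal ((norm (f m x - g x))\<^sup>2) \<partial>M) \<le> ennreal (1\<^sup>2)"
    using bound[of 1] by auto
  then have N1: "square_integrable M (\<lambda>x. f m x - g x)" if "N1 \<le> m" for m
    using le_less_trans[of _ "ennreal (1\<^sup>2)" \<infinity>] that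
    by (auto simp: square_integrable_def integrable_iff_bounded)
  have g: "square_integrable M g"
    using square_integrable_diff[OF f[of N1] N1[of N1]] by simp
  have "(\<lambda>m. L2norm M (\<lambda>x. f m x - g x)) \<longlonglongrightarrow> 0"
  proof (rule LIMSEQ_I)
    fix e :: real assume e: "0 < e"
    obtain N where N: "\<And>m. N \<le> m \<Longrightarrow> (\<integral>\<^sup>+x. ennreal ((norm (f m x - g x))\<^sup>2) \<partial>M) \<le> ennreal ((e/2)\<^sup>2)"
      using bound[of "e/2"] e by auto
    have "norm (L2norm M (\<lambda>x. f m x - g x) - 0) < e" if "N \<le> m" for m
    proof -
      have "ennreal ((L2norm M (\<lambda>x. f m x - g x))\<^sup>2) \<le> ennreal ((e/2)\<^sup>2)"
        using N[OF that] nn_integral_eq_L2norm[OF square_integrable_diff[OF f g], of m] by simp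
      then have "(L2norm M (\<lambda>x. f m x - g x))\<^sup>2 \<le> (e/2)\<^sup>2" by (simp add: ennreal_le_iff)
      then have "L2norm M (\<lambda>x. f m x - g x) \<le> e/2" by (rule power2_le_imp_le) (use e in simp)
      then show ?thesis using e by simp
    qed
    then show "\<exists>no. \<forall>n\<ge>no. norm (L2norm M (\<lambda>x. f n x - g x) - 0) < e" by blast
  qed
  then show ?thesis using g by blast
qed

lemma L2_tendsto_inner:
  assumes "\<And>m. square_integrable M (f m)" "square_integrable M g" "square_integrable M h"
    and "(\<lambda>m. L2norm M (\<lambda>x. f m x - g x)) \<longlonglongrightarrow> 0"
  shows "(\<lambda>m. LINT x|M. h x \<bullet> f m x) \<longlonglongrightarrow> (LINT x|M. h x \<bullet> g x)"
proof (rule LIM_zero_cancel, rule Lim_null_comparison)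
  show "eventually (\<lambda>m. norm ((LINT x|M. h x \<bullet> f m x) - (LINT x|M. h x \<bullet> g x)) \<le>
      L2norm M h * L2norm M (\<lambda>x. f m x - g x)) sequentially"
  proof (intro always_eventually allI)
    fix m
    have "(LINT x|M. h x \<bullet> f m x) - (LINT x|M. h x \<bullet> g x) = (LINT x|M. h x \<bullet> (f m x - g x))"
      unfolding inner_diff_right
      by (rule Bochner_Integration.integral_diff[symmetric]) (intro square_integrable_inner assms)+
    then show "norm ((LINT x|M. h x \<bullet> f m x) - (LINT x|M. h x \<bullet> g x)) \<le>
      L2norm M h * L2norm M (\<lambda>x. f m x - g x)"
      using L2_Cauchy_Schwarz[OF assms(3) square_integrable_diff[OF assms(1,2)], of m] by simp
  qed
  show "(\<lambda>m. L2norm M h * L2norm M (\<lambda>x. f m x - g x)) \<longlonglongrightarrow> 0"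
    using tendsto_mult[OF tendsto_const assms(4), of "L2norm M h"] by simp
qed

text \<open>On a set of finite measure L^2 convergence implies L^1 convergence. The pointwise bound
  of the absolute value of y by s + y^2 / s is used in place of Cauchy-Schwarz and integrates
  directly as a nonnegative integral.\<close>

lemma L2_tendsto_imp_L1_local:
  fixes v :: "nat \<Rightarrow> real^'n \<Rightarrow> real"
  assumes \<Omega>: "\<Omega> \<in> sets lebesgue" and S: "compact S" "S \<subseteq> \<Omega>"
    and v: "\<And>m. square_integrable (lebesgue_on \<Omega>) (v m)"
    and lim: "(\<lambda>m. L2norm (lebesgue_on \<Omega>) (v m)) \<longlonglongrightarrow> 0"
  shows "(\<lambda>m. Lp_norm 1 S (v m)) \<longlonglongrightarrow> 0"
proof -
  let ?M = "lebesgue_on S"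
  note Ss = lebesgue_sets_compact[OF S(1)]
  define e where "e m = L2norm (lebesgue_on \<Omega>) (v m)" for m
  \<comment> \<open>Slightly larger than the L^2 norm, so that division by it is legitimate even
    when the norm is 0.\<close>
  define s where "s m = e m + inverse (real (Suc m))" for m
  have e0: "0 \<le> e m" for m by (simp add: e_def)
  have s0: "0 < s m" "e m \<le> s m" for m using e0[of m] by (auto simp: s_def intro: add_nonneg_pos)
  have "s \<longlonglongrightarrow> 0 + 0"
    unfolding s_def[abs_def] e_def by (intro tendsto_intros lim LIMSEQ_inverse_real_of_nat)
  then have s: "s \<longlonglongrightarrow> 0" by simp
  have "emeasure lebesgue S < \<infinity>"
    using emeasure_compact_finite[OF S(1)] borel_closed[OF compact_imp_closed[OF S(1)]] by simp
  then obtain c where c: "emeasure lebesgue S = ennreal c" "0 \<le> c"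
    by (cases "emeasure lebesgue S") auto
  have "(\<integral>\<^sup>+x. ennreal (norm (v m x) powr 1) \<partial>?M) \<le> ennreal (s m * (c + 1))" for m
  proof -
    have [measurable]: "v m \<in> borel_measurable ?M"
      using square_integrable_measurable[OF v] S(2) by (rule borel_measurable_lebesgue_on_subset)
    have "(\<integral>\<^sup>+x. ennreal (norm (v m x) powr 1) \<partial>?M) \<le>
        (\<integral>\<^sup>+x. ennreal (s m) + ennreal (1 / s m) * ennreal ((norm (v m x))\<^sup>2) \<partial>?M)"
    proof (rule nn_integral_mono)
      fix x
      have "\<bar>y\<bar> \<le> s m + 1 / s m * (norm y)\<^sup>2" for y :: real
      proof -
        have "s m * \<bar>y\<bar> \<le> s m * s m + y\<^sup>2"
        proof -
          have "2 * (s m * \<bar>y\<bar>) \<le> s m * s m + y\<^sup>2"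
            using sum_squares_bound[of "s m" "\<bar>y\<bar>"] by (simp add: power2_eq_square)
          moreover have "0 \<le> s m * \<bar>y\<bar>" using s0[of m] by simp
          ultimately show ?thesis by linarith
        qed
        then show ?thesis using s0[of m] by (simp add: field_simps power2_eq_square)
      qed
      then have "ennreal (norm (v m x)) \<le> ennreal (s m + 1 / s m * (norm (v m x))\<^sup>2)"
        by (intro ennreal_leI) simp
      also have "\<dots> = ennreal (s m) + ennreal (1 / s m * (norm (v m x))\<^sup>2)"
        using s0[of m] by (intro ennreal_plus) auto
      also have "ennreal (1 / s m * (norm (v m x))\<^sup>2) = ennreal (1 / s m) * ennreal ((norm (v m x))\<^sup>2)"
        using s0[of m] by (intro ennreal_mult) auto
      finally show "ennreal (norm (v m x) powr 1) \<le> ennreal (s m) + ennreal (1 / s m) * ennreal ((norm (v m x))\<^sup>2)"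
        by simp
    qed
    also have "\<dots> = ennreal (s m) * emeasure ?M S + ennreal (1 / s m) * (\<integral>\<^sup>+x. ennreal ((norm (v m x))\<^sup>2) \<partial>?M)"
    proof (subst nn_integral_add)
      show "(\<integral>\<^sup>+x. ennreal (s m) \<partial>?M) + (\<integral>\<^sup>+x. ennreal (1 / s m) * ennreal ((norm (v m x))\<^sup>2) \<partial>?M) =
        ennreal (s m) * emeasure ?M S + ennreal (1 / s m) * (\<integral>\<^sup>+x. ennreal ((norm (v m x))\<^sup>2) \<partial>?M)"
        by (subst nn_integral_cmult) (simp_all add: space_restrict_space)
    qed simp_all
    also have "emeasure ?M S = ennreal c" using c Ss by (simp add: emeasure_restrict_space)
    also have "(\<integral>\<^sup>+x. ennreal ((norm (v m x))\<^sup>2) \<partial>?M) \<le> ennreal ((e m)\<^sup>2)"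
      unfolding e_def nn_integral_eq_L2norm[OF v, symmetric]
      by (rule nn_integral_lebesgue_on_mono[OF Ss \<Omega> S(2)])
    finally have "(\<integral>\<^sup>+x. ennreal (norm (v m x) powr 1) \<partial>?M) \<le>
        ennreal (s m) * ennreal c + ennreal (1 / s m) * ennreal ((e m)\<^sup>2)"
      by (meson add_left_mono mult_left_mono order_trans zero_le)
    also have "\<dots> = ennreal (s m * c + 1 / s m * (e m)\<^sup>2)"
    proof -
      have "ennreal (s m * c + 1 / s m * (e m)\<^sup>2) = ennreal (s m * c) + ennreal (1 / s m * (e m)\<^sup>2)"
        using s0[of m] c(2) by (intro ennreal_plus) auto
      moreover have "ennreal (s m * c) = ennreal (s m) * ennreal c"
        using s0[of m] c(2) by (intro ennreal_mult) auto
      moreover have "ennreal (1 / s m * (e m)\<^sup>2) = ennreal (1 / s m) * ennreal ((e m)\<^sup>2)"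
        using s0[of m] by (intro ennreal_mult) auto
      ultimately show ?thesis by (simp only:)
    qed
    also have "\<dots> \<le> ennreal (s m * (c + 1))"
    proof (rule ennreal_leI)
      have "(e m)\<^sup>2 \<le> (s m)\<^sup>2" using s0[of m] e0[of m] by (intro power_mono) auto
      then have "1 / s m * (e m)\<^sup>2 \<le> s m" using s0(1)[of m] by (simp add: field_simps power2_eq_square)
      then show "s m * c + 1 / s m * (e m)\<^sup>2 \<le> s m * (c + 1)" by (simp add: algebra_simps)
    qed
    finally show ?thesis .
  qed
  note bound = this
  have "(\<lambda>m. s m * (c + 1)) \<longlonglongrightarrow> 0 * (c + 1)" by (rule tendsto_mult[OF s tendsto_const])
  then have lim0: "(\<lambda>m. ennreal (s m * (c + 1))) \<longlonglongrightarrow> ennreal 0"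
    by (intro tendsto_ennrealI) simp
  have "(\<lambda>m. \<integral>\<^sup>+x. ennreal (norm (v m x) powr 1) \<partial>?M) \<longlonglongrightarrow> 0"
  proof (rule tendsto_sandwich[OF _ _ tendsto_const])
    show "(\<lambda>m. ennreal (s m * (c + 1))) \<longlonglongrightarrow> 0" using lim0 by simp
    show "eventually (\<lambda>m. (\<integral>\<^sup>+x. ennreal (norm (v m x) powr 1) \<partial>?M) \<le> ennreal (s m * (c + 1))) sequentially"
      using bound by (intro always_eventually allI)
  qed simp
  then show ?thesis by (subst Lp_norm_tendsto_0_iff) (simp, assumption)
qed

text \<open>The solution is the limit of a sequence minimising the Dirichlet energy
  \<open>\<parallel>\<nabla>\<psi>\<parallel>\<^sup>2 - 2 \<integral> F \<psi>\<close>, which is Cauchy by the parallelogram law. The bound is the dual description of the minimum.\<close>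

theorem weak_solution_exists:
  fixes \<Omega> :: "(real^'n) set"
  assumes op: "open \<Omega>" and K: "poincare_on \<Omega> K" and F: "square_integrable (lebesgue_on \<Omega>) F"
  shows "\<exists>u. weak_solution \<Omega> F u \<and> square_integrable (lebesgue_on \<Omega>) u \<and>
    (\<forall>\<psi>\<in>test_functions \<Omega>. (LINT x|lebesgue_on \<Omega>. F x * \<psi> x)\<^sup>2 \<le>
      (LINT x|lebesgue_on \<Omega>. F x * u x) * (L2norm (lebesgue_on \<Omega>) (gradient \<psi>))\<^sup>2)"
proof -
  let ?M = "lebesgue_on \<Omega>"
  let ?T = "test_functions \<Omega>"
  note \<Omega> = lebesgue_sets_open[OF op]
  note sq = test_functions_square_integrable[OF _ \<Omega>]
  have K0: "0 < K" using K by (simp add: poincare_on_def)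
  have poincare: "L2norm ?M \<psi> \<le> sqrt K * L2norm ?M (gradient \<psi>)" if "\<psi> \<in> ?T" for \<psi>
  proof (rule power2_le_imp_le)
    show "(L2norm ?M \<psi>)\<^sup>2 \<le> (sqrt K * L2norm ?M (gradient \<psi>))\<^sup>2"
      using K that K0 by (simp add: poincare_on_def power_mult_distrib)
  qed (use K0 in simp)
  define I where "I \<psi> = (LINT x|?M. F x * \<psi> x)" for \<psi>
  have I_lin: "I (\<lambda>x. a * \<phi> x + b * \<psi> x) = a * I \<phi> + b * I \<psi>" if "\<phi> \<in> ?T" "\<psi> \<in> ?T" for a b \<phi> \<psi>
    using square_integrable_inner[OF F sq(1)[OF that(1)]] square_integrable_inner[OF F sq(1)[OF that(2)]]
    by (simp add: I_def distrib_left mult.left_commute)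
  define J where "J \<psi> = (L2norm ?M (gradient \<psi>))\<^sup>2 - 2 * I \<psi>" for \<psi>
  \<comment> \<open>Cauchy-Schwarz and Poincare bound the linear term by c X, where X is the norm of
    the gradient; completing the square in X^2 - 2 c X shows that the energy is at least
    -c^2.\<close>
  define c where "c = L2norm ?M F * sqrt K"
  have J_lower: "- (c\<^sup>2) \<le> J \<psi>" if "\<psi> \<in> ?T" for \<psi>
  proof -
    have "I \<psi> \<le> L2norm ?M F * L2norm ?M \<psi>"
      using L2_Cauchy_Schwarz[OF F sq(1)[OF that]] by (simp add: I_def)
    also have "\<dots> \<le> c * L2norm ?M (gradient \<psi>)"
      unfolding c_def mult.assoc by (intro mult_left_mono poincare that) simp
    finally have "I \<psi> \<le> c * L2norm ?M (gradient \<psi>)" .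
    moreover have "0 \<le> (c - L2norm ?M (gradient \<psi>))\<^sup>2" by simp
    ultimately show ?thesis by (simp add: J_def power2_diff)
  qed
  define m0 where "m0 = Inf (J ` ?T)"
  have zeroT: "(\<lambda>x. 0) \<in> ?T" by (rule test_functionsI[OF smooth_const, of "{}"]) auto
  have bdd: "bdd_below (J ` ?T)" using J_lower by (auto simp: bdd_below_def)
  have m0: "m0 \<le> J \<psi>" if "\<psi> \<in> ?T" for \<psi>
    unfolding m0_def using that by (intro cInf_lower bdd) auto
  have "\<exists>\<psi>\<in>?T. J \<psi> < m0 + inverse (real (Suc m))" for m
    using cInf_lessD[of "J ` ?T" "m0 + inverse (real (Suc m))"] zeroT
    unfolding m0_def[symmetric] by auto
  then obtain \<psi> where \<psi>: "\<And>m. \<psi> m \<in> ?T" and J\<psi>: "\<And>m. J (\<psi> m) < m0 + inverse (real (Suc m))"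
    by metis
  have J_expand: "J (\<lambda>x. 1 * \<phi> x + t * \<theta> x) =
      J \<phi> + 2 * t * ((LINT x|?M. gradient \<phi> x \<bullet> gradient \<theta> x) - I \<theta>) + t\<^sup>2 * (L2norm ?M (gradient \<theta>))\<^sup>2"
    if "\<phi> \<in> ?T" "\<theta> \<in> ?T" for \<phi> \<theta> t
    using L2norm_lincomb[OF sq(2)[OF that(1)] sq(2)[OF that(2)], of 1 t]
    unfolding J_def I_lin[OF that] test_functions_lincomb(2)[OF that] by (simp add: algebra_simps)
  \<comment> \<open>The midpoint of two test functions has energy at least the infimum, so two
    nearly minimal functions have close gradients.\<close>
  have parallelogram: "(L2norm ?M (\<lambda>x. gradient \<phi> x - gradient \<theta> x))\<^sup>2 \<le> 2 * (J \<phi> - m0) + 2 * (J \<theta> - m0)"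
    if "\<phi> \<in> ?T" "\<theta> \<in> ?T" for \<phi> \<theta>
  proof -
    have "4 * m0 \<le> 4 * J (\<lambda>x. 1/2 * \<phi> x + 1/2 * \<theta> x)"
      using m0[OF test_functions_lincomb(1)[OF that, of "1/2" "1/2"]] by linarith
    also have "4 * J (\<lambda>x. 1/2 * \<phi> x + 1/2 * \<theta> x) =
        2 * J \<phi> + 2 * J \<theta> - (L2norm ?M (\<lambda>x. 1 *\<^sub>R gradient \<phi> x + (-1) *\<^sub>R gradient \<theta> x))\<^sup>2"
      unfolding J_def I_lin[OF that] test_functions_lincomb(2)[OF that]
        L2norm_lincomb[OF sq(2)[OF that(1)] sq(2)[OF that(2)]]
      by (simp add: field_simps power2_eq_square)
    finally show ?thesis by simp
  qed
  \<comment> \<open>At least 1 and at least sqrt K, so that one Cauchy estimate serves the gradients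
    and, through Poincare, the functions themselves.\<close>
  define \<kappa> where "\<kappa> = 1 + sqrt K"
  have \<kappa>: "1 \<le> \<kappa>" "sqrt K \<le> \<kappa>" using K0 by (auto simp: \<kappa>_def)
  have Cauchy: "\<exists>N. \<forall>m\<ge>N. \<forall>n\<ge>N. \<kappa> * L2norm ?M (\<lambda>x. gradient (\<psi> m) x - gradient (\<psi> n) x) \<le> e"
    if e: "0 < e" for e
  proof -
    have "0 < (e / \<kappa>)\<^sup>2 / 4" using e \<kappa> by simp
    then obtain N where N: "inverse (real (Suc N)) < (e / \<kappa>)\<^sup>2 / 4"
      using reals_Archimedean by blast
    have "\<kappa> * L2norm ?M (\<lambda>x. gradient (\<psi> m) x - gradient (\<psi> n) x) \<le> e" if mn: "N \<le> m" "N \<le> n" for m n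
    proof -
      have "J (\<psi> m) - m0 < inverse (real (Suc m))" "J (\<psi> n) - m0 < inverse (real (Suc n))"
        using J\<psi>[of m] J\<psi>[of n] by auto
      moreover have "inverse (real (Suc m)) \<le> inverse (real (Suc N))" "inverse (real (Suc n)) \<le> inverse (real (Suc N))"
        using mn by (auto intro!: le_imp_inverse_le)
      moreover have "X \<le> E" if "jm < a" "jn < b" "a \<le> c" "b \<le> c" "X \<le> 2 * jm + 2 * jn" "c < E / 4"
        for X E jm jn a b c :: real
        using that by linarith
      ultimately have "(L2norm ?M (\<lambda>x. gradient (\<psi> m) x - gradient (\<psi> n) x))\<^sup>2 \<le> (e / \<kappa>)\<^sup>2"
        using parallelogram[OF \<psi>[of m] \<psi>[of n]] N by blast
      then have "L2norm ?M (\<lambda>x. gradient (\<psi> m) x - gradient (\<psi> n) x) \<le> e / \<kappa>"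
        by (rule power2_le_imp_le) (use e \<kappa> in simp)
      then show ?thesis using \<kappa> by (simp add: field_simps)
    qed
    then show ?thesis by blast
  qed
  have "\<exists>g. square_integrable ?M g \<and> (\<lambda>m. L2norm ?M (\<lambda>x. gradient (\<psi> m) x - g x)) \<longlonglongrightarrow> 0"
  proof (rule L2_complete[OF sq(2)[OF \<psi>]])
    fix e :: real assume "0 < e"
    then obtain N where N: "\<And>m n. N \<le> m \<Longrightarrow> N \<le> n \<Longrightarrow> \<kappa> * L2norm ?M (\<lambda>x. gradient (\<psi> m) x - gradient (\<psi> n) x) \<le> e"
      using Cauchy by blast
    have "L2norm ?M (\<lambda>x. gradient (\<psi> m) x - gradient (\<psi> n) x) \<le> \<kappa> * L2norm ?M (\<lambda>x. gradient (\<psi> m) x - gradient (\<psi> n) x)" for m n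
      using mult_right_mono[OF \<kappa>(1), of "L2norm ?M (\<lambda>x. gradient (\<psi> m) x - gradient (\<psi> n) x)"] by simp
    then show "\<exists>N. \<forall>m\<ge>N. \<forall>n\<ge>N. L2norm ?M (\<lambda>x. gradient (\<psi> m) x - gradient (\<psi> n) x) \<le> e"
      using N order_trans by blast
  qed
  then obtain g where g: "square_integrable ?M g" and gconv: "(\<lambda>m. L2norm ?M (\<lambda>x. gradient (\<psi> m) x - g x)) \<longlonglongrightarrow> 0"
    by blast
  have "\<exists>u. square_integrable ?M u \<and> (\<lambda>m. L2norm ?M (\<lambda>x. \<psi> m x - u x)) \<longlonglongrightarrow> 0"
  proof (rule L2_complete[OF sq(1)[OF \<psi>]])
    fix e :: real assume "0 < e"
    then obtain N where N: "\<And>m n. N \<le> m \<Longrightarrow> N \<le> n \<Longrightarrow> \<kappa> * L2norm ?M (\<lambda>x. gradient (\<psi> m) x - gradient (\<psi> n) x) \<le> e"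
      using Cauchy by blast
    have "L2norm ?M (\<lambda>x. \<psi> m x - \<psi> n x) \<le> \<kappa> * L2norm ?M (\<lambda>x. gradient (\<psi> m) x - gradient (\<psi> n) x)" for m n
    proof -
      have "L2norm ?M (\<lambda>x. \<psi> m x - \<psi> n x) \<le> sqrt K * L2norm ?M (\<lambda>x. gradient (\<psi> m) x - gradient (\<psi> n) x)"
        using poincare[OF test_functions_lincomb(1)[OF \<psi> \<psi>, of 1 m "-1" n]]
        unfolding test_functions_lincomb(2)[OF \<psi> \<psi>] by simp
      also have "\<dots> \<le> \<kappa> * L2norm ?M (\<lambda>x. gradient (\<psi> m) x - gradient (\<psi> n) x)"
        by (rule mult_right_mono[OF \<kappa>(2)]) simp
      finally show ?thesis .
    qed
    then show "\<exists>N. \<forall>m\<ge>N. \<forall>n\<ge>N. L2norm ?M (\<lambda>x. \<psi> m x - \<psi> n x) \<le> e"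
      using N order_trans by blast
  qed
  then obtain u where u: "square_integrable ?M u" and uconv: "(\<lambda>m. L2norm ?M (\<lambda>x. \<psi> m x - u x)) \<longlonglongrightarrow> 0"
    by blast
  have weak: "(LINT x|?M. g x \<bullet> gradient \<theta> x) = I \<theta>" if \<theta>: "\<theta> \<in> ?T" for \<theta>
  proof -
    let ?b = "(LINT x|?M. g x \<bullet> gradient \<theta> x) - I \<theta>"
    \<comment> \<open>The energy of \<open>\<psi> m\<close> plus t \<theta> is at least the infimum,
      and \<open>\<psi> m\<close> exceeds the infimum by less than 1/(m+1). In the limit a quadratic
      in t without constant term is nonnegative, so its linear coefficient vanishes.\<close>
    have "0 \<le> 0 + 2 * t * ?b + t\<^sup>2 * (L2norm ?M (gradient \<theta>))\<^sup>2" for t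
    proof (rule LIMSEQ_le_const)
      have "(\<lambda>m. LINT x|?M. gradient \<theta> x \<bullet> gradient (\<psi> m) x) \<longlonglongrightarrow> (LINT x|?M. gradient \<theta> x \<bullet> g x)"
        by (rule L2_tendsto_inner[OF sq(2)[OF \<psi>] g sq(2)[OF \<theta>] gconv])
      then have "(\<lambda>m. LINT x|?M. gradient (\<psi> m) x \<bullet> gradient \<theta> x) \<longlonglongrightarrow> (LINT x|?M. g x \<bullet> gradient \<theta> x)"
        by (simp only: inner_commute)
      then show "(\<lambda>m. inverse (real (Suc m)) + 2 * t * ((LINT x|?M. gradient (\<psi> m) x \<bullet> gradient \<theta> x) - I \<theta>) +
          t\<^sup>2 * (L2norm ?M (gradient \<theta>))\<^sup>2) \<longlonglongrightarrow> 0 + 2 * t * ?b + t\<^sup>2 * (L2norm ?M (gradient \<theta>))\<^sup>2"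
        by (intro tendsto_intros LIMSEQ_inverse_real_of_nat)
      have "0 \<le> inverse (real (Suc m)) + 2 * t * ((LINT x|?M. gradient (\<psi> m) x \<bullet> gradient \<theta> x) - I \<theta>) +
          t\<^sup>2 * (L2norm ?M (gradient \<theta>))\<^sup>2" for m
        using m0[OF test_functions_lincomb(1)[OF \<psi>[of m] \<theta>, of 1 t]] J\<psi>[of m]
        unfolding J_expand[OF \<psi>[of m] \<theta>] by linarith
      then show "\<exists>N. \<forall>m\<ge>N. 0 \<le> inverse (real (Suc m)) + 2 * t * ((LINT x|?M. gradient (\<psi> m) x \<bullet> gradient \<theta> x) - I \<theta>) +
          t\<^sup>2 * (L2norm ?M (gradient \<theta>))\<^sup>2" by blast
    qed
    from quadratic_nonneg_discriminant[OF this] have "?b\<^sup>2 \<le> 0" by simp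
    then show ?thesis by simp
  qed
  have "(\<lambda>m. LINT x|?M. g x \<bullet> gradient (\<psi> m) x) \<longlonglongrightarrow> (LINT x|?M. g x \<bullet> g x)"
    by (rule L2_tendsto_inner[OF sq(2)[OF \<psi>] g g gconv])
  moreover have "(\<lambda>m. LINT x|?M. g x \<bullet> gradient (\<psi> m) x) \<longlonglongrightarrow> (LINT x|?M. F x * u x)"
    using L2_tendsto_inner[OF sq(1)[OF \<psi>] u F uconv] by (simp add: weak[OF \<psi>] I_def)
  \<comment> \<open>The weak equation is tested with \<open>\<psi> m\<close>. Both sides converge,
    which identifies the work of \<open>F\<close> on the solution with its Dirichlet energy.\<close>
  ultimately have energy: "(LINT x|?M. F x * u x) = (L2norm ?M g)\<^sup>2"
    using LIMSEQ_unique unfolding L2norm_power2 power2_norm_eq_inner by blast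
  have "W12_0_with_gradient \<Omega> u g"
    unfolding W12_0_with_gradient_def
  proof (intro conjI exI allI impI)
    show "u \<in> borel_measurable ?M" using u by (rule square_integrable_measurable)
    show "g \<in> Lp_space 2 \<Omega>" using g by (simp add: square_integrable_Lp_space)
    show "\<psi> m \<in> ?T" for m by (rule \<psi>)
    show "(\<lambda>m. Lp_norm 2 \<Omega> (\<lambda>x. gradient (\<psi> m) x - g x)) \<longlonglongrightarrow> 0"
      using gconv by (subst square_integrable_tendsto_iff) (intro square_integrable_diff sq \<psi> g)+
    fix S assume "compact S \<and> S \<subseteq> \<Omega>"
    then show "(\<lambda>m. Lp_norm 1 S (\<lambda>x. \<psi> m x - u x)) \<longlonglongrightarrow> 0"
      by (intro L2_tendsto_imp_L1_local[OF \<Omega> _ _ _ uconv] square_integrable_diff sq(1) \<psi> u) auto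
  qed
  then have "weak_solution \<Omega> F u"
    unfolding weak_solution_def using weak by (auto simp: I_def)
  moreover have "(LINT x|?M. F x * \<phi> x)\<^sup>2 \<le> (LINT x|?M. F x * u x) * (L2norm ?M (gradient \<phi>))\<^sup>2"
    if "\<phi> \<in> ?T" for \<phi>
  proof -
    have "\<bar>I \<phi>\<bar> \<le> L2norm ?M g * L2norm ?M (gradient \<phi>)"
      unfolding weak[OF that, symmetric] by (rule L2_Cauchy_Schwarz[OF g sq(2)[OF that]])
    then have "\<bar>I \<phi>\<bar>\<^sup>2 \<le> (L2norm ?M g * L2norm ?M (gradient \<phi>))\<^sup>2" by (rule power_mono) simp
    then show ?thesis unfolding energy by (simp add: I_def power_mult_distrib)
  qed
  ultimately show ?thesis using u by blast
qed

section \<open>Cutoff functions\<close>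

text \<open>The usual quotient of flat functions. The denominator is written as a real power with
  exponent -1 because positive real powers of smooth functions already have a closure rule.\<close>

definition smooth_step :: "real \<Rightarrow> real" where
  "smooth_step y = flat_function 0 y * (flat_function 0 y + flat_function 0 (1 - y)) powr (- 1)"

lemma flat_function_0_pos: "0 < y \<Longrightarrow> 0 < flat_function 0 y"
  by (simp add: flat_function_def)

lemma flat_function_0_nonneg: "0 \<le> flat_function 0 y"
  by (simp add: flat_function_def)

lemma flat_function_0_add_pos: "0 < flat_function 0 y + flat_function 0 (1 - y)"
  using flat_function_0_pos[of y] flat_function_0_pos[of "1 - y"] flat_function_0_nonneg[of y]
    flat_function_0_nonneg[of "1 - y"] by (cases "0 < y") (auto intro: add_pos_nonneg add_nonneg_pos)

lemma smooth_step_bounds: "0 \<le> smooth_step y" "smooth_step y \<le> 1"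
  using flat_function_0_nonneg[of y] flat_function_0_nonneg[of "1 - y"] flat_function_0_add_pos[of y]
  by (auto simp: smooth_step_def powr_minus_divide)

lemma smooth_step_eq_0: "y \<le> 0 \<Longrightarrow> smooth_step y = 0"
  by (simp add: smooth_step_def flat_function_def)

lemma smooth_step_eq_1: "1 \<le> y \<Longrightarrow> smooth_step y = 1"
  using flat_function_0_pos[of y] by (simp add: smooth_step_def flat_function_def powr_minus_divide)

lemma smooth_smooth_step: "smooth f \<Longrightarrow> smooth (\<lambda>x. smooth_step (f x))"
  unfolding smooth_step_def by (intro smooth_intros flat_function_0_add_pos)

lemma gradient_locally_const:
  assumes "open U" "x \<in> U" "\<And>y. y \<in> U \<Longrightarrow> f y = c"
  shows "gradient f x = 0"
proof (rule gradient_unique)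
  have "((\<lambda>y. c) has_derivative (\<lambda>h. 0 \<bullet> h)) (at x)" by simp
  then show "(f has_derivative (\<lambda>h. 0 \<bullet> h)) (at x)"
    by (rule has_derivative_transform_within_open[OF _ assms(1,2)]) (simp add: assms(3))
qed

lemma closed_abs_component_le: "closed {x::real^'n. \<bar>x $ i\<bar> \<le> r}"
  by (intro closed_Collect_le continuous_intros)

lemma open_abs_component_less: "open {x::real^'n. \<bar>x $ i\<bar> < r}"
  by (intro open_Collect_less continuous_intros)

text \<open>A product of one-dimensional steps in the squared coordinates, so that the level sets
  follow cubes, the shape in which the hole is confined. Squares keep the argument smooth where an
  absolute value would not. A compactness argument bounds the gradient.\<close>

lemma cutoff_exists:
  fixes a b :: real
  assumes ab: "0 < a" "a < b"
  obtains \<theta> :: "real^'n \<Rightarrow> real" and C where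
    "smooth \<theta>" "0 \<le> C" "\<And>x. 0 \<le> \<theta> x" "\<And>x. \<theta> x \<le> 1"
    "\<And>x. (\<And>i. \<bar>x $ i\<bar> \<le> a) \<Longrightarrow> \<theta> x = 1" "\<And>x i. b \<le> \<bar>x $ i\<bar> \<Longrightarrow> \<theta> x = 0"
    "\<And>x. norm (gradient \<theta> x) \<le> C"
    "\<And>x i. gradient \<theta> x \<noteq> 0 \<Longrightarrow> \<bar>x $ i\<bar> \<le> b" "\<And>x. gradient \<theta> x \<noteq> 0 \<Longrightarrow> \<exists>i. a \<le> \<bar>x $ i\<bar>"
proof -
  \<comment> \<open>The argument of the step is at least 1 for coordinates up to \<open>a\<close>
    and at most 0 for coordinates from \<open>b\<close> on, in absolute value.\<close>
  define \<theta> :: "real^'n \<Rightarrow> real" where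
    "\<theta> x = (\<Prod>i\<in>UNIV. smooth_step (1 / (b\<^sup>2 - a\<^sup>2) * (b\<^sup>2 - (x $ i) ^ 2)))" for x
  have d: "0 < b\<^sup>2 - a\<^sup>2" using ab by (simp add: power_strict_mono)
  have sm: "smooth \<theta>"
    unfolding \<theta>_def by (intro smooth_intros smooth_smooth_step)
  have one: "\<theta> x = 1" if "\<And>i. \<bar>x $ i\<bar> \<le> a" for x
  proof -
    have "smooth_step (1 / (b\<^sup>2 - a\<^sup>2) * (b\<^sup>2 - (x $ i) ^ 2)) = 1" for i
    proof (rule smooth_step_eq_1)
      have "(x $ i)\<^sup>2 \<le> a\<^sup>2" using that[of i] ab by (simp add: abs_le_square_iff[symmetric])
      then show "1 \<le> 1 / (b\<^sup>2 - a\<^sup>2) * (b\<^sup>2 - (x $ i) ^ 2)" using d by (simp add: field_simps)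
    qed
    then show ?thesis by (simp add: \<theta>_def)
  qed
  have zero: "\<theta> x = 0" if "b \<le> \<bar>x $ i\<bar>" for x i
  proof -
    have "b\<^sup>2 \<le> (x $ i)\<^sup>2" using that ab by (simp add: abs_le_square_iff[symmetric])
    then have "1 / (b\<^sup>2 - a\<^sup>2) * (b\<^sup>2 - (x $ i) ^ 2) \<le> 0"
      using d by (intro mult_nonneg_nonpos) auto
    then have "smooth_step (1 / (b\<^sup>2 - a\<^sup>2) * (b\<^sup>2 - (x $ i) ^ 2)) = 0" by (rule smooth_step_eq_0)
    then show ?thesis unfolding \<theta>_def by (intro prod_zero) auto
  qed
  have sup1: "\<bar>x $ i\<bar> \<le> b" if "gradient \<theta> x \<noteq> 0" for x i
  proof (rule ccontr)
    assume "\<not> \<bar>x $ i\<bar> \<le> b"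
    then have x: "x \<in> - {y. \<bar>y $ i\<bar> \<le> b}" by simp
    have "gradient \<theta> x = 0"
      by (rule gradient_locally_const[OF open_Compl[OF closed_abs_component_le] x, of _ 0]) (rule zero[where i = i], simp)
    then show False using that by simp
  qed
  have sup2: "\<exists>i. a \<le> \<bar>x $ i\<bar>" if "gradient \<theta> x \<noteq> 0" for x
  proof (rule ccontr)
    assume "\<not> (\<exists>i. a \<le> \<bar>x $ i\<bar>)"
    then have x: "x \<in> (\<Inter>i. {y. \<bar>y $ i\<bar> < a})" by (simp add: not_le)
    have op: "open (\<Inter>i. {y::real^'n. \<bar>y $ i\<bar> < a})"
      by (intro open_INT ballI open_abs_component_less) auto
    have "gradient \<theta> x = 0"
    proof (rule gradient_locally_const[OF op x, of _ 1])
      fix y :: "real^'n" assume "y \<in> (\<Inter>i. {y. \<bar>y $ i\<bar> < a})"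
      then have "\<bar>y $ i\<bar> < a" for i by blast
      then show "\<theta> y = 1" by (intro one) (simp add: less_imp_le)
    qed
    then show False using that by simp
  qed
  have "compact (gradient \<theta> ` cbox (\<chi> i. - b) (\<chi> i. b))"
    by (intro compact_continuous_image smooth_gradient_continuous_on sm compact_cbox)
  then have "bounded (gradient \<theta> ` cbox (\<chi> i. - b) (\<chi> i. b))" by (rule compact_imp_bounded)
  then obtain C where C: "\<And>x. x \<in> cbox (\<chi> i. - b) (\<chi> i. b) \<Longrightarrow> norm (gradient \<theta> x) \<le> C"
    by (auto simp: bounded_iff)
  have "norm (gradient \<theta> x) \<le> max C 0" for x
  proof (cases "gradient \<theta> x = 0")
    case False
    then have "x \<in> cbox (\<chi> i. - b) (\<chi> i. b)"
    proof (simp add: mem_box_cart, intro allI)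
      fix i show "- b \<le> x $ i \<and> x $ i \<le> b" using sup1[OF False, of i] by linarith
    qed
    then have "norm (gradient \<theta> x) \<le> C" by (rule C)
    then show ?thesis by simp
  qed simp
  note bound = this
  show thesis
    by (rule that[OF sm _ _ _ one zero bound sup1 sup2])
      (auto simp: \<theta>_def smooth_step_bounds intro!: prod_nonneg prod_le_1)
qed

lemma emeasure_cube:
  fixes z :: "real^'n"
  assumes "0 \<le> r"
  shows "emeasure lborel {x. \<forall>i. \<bar>x $ i - z $ i\<bar> \<le> r} = ennreal ((2 * r) ^ CARD('n))"
    and "compact {x. \<forall>i. \<bar>x $ i - z $ i\<bar> \<le> r}"
proof -
  have eq: "{x. \<forall>i. \<bar>x $ i - z $ i\<bar> \<le> r} = cbox (\<chi> i. z $ i - r) (\<chi> i. z $ i + r)"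
    by (auto simp: mem_box_cart abs_le_iff algebra_simps)
  have "z \<in> cbox (\<chi> i. z $ i - r) (\<chi> i. z $ i + r)" using assms by (simp add: mem_box_cart)
  then have "measure lborel (cbox (\<chi> i. z $ i - r) (\<chi> i. z $ i + r)) = (2 * r) ^ CARD('n)"
    by (subst content_cbox_cart) auto
  then show "emeasure lborel {x. \<forall>i. \<bar>x $ i - z $ i\<bar> \<le> r} = ennreal ((2 * r) ^ CARD('n))"
    unfolding eq using emeasure_lborel_cbox_finite[of "\<chi> i. z $ i - r" "\<chi> i. z $ i + r"]
    by (simp add: emeasure_eq_ennreal_measure)
  show "compact {x. \<forall>i. \<bar>x $ i - z $ i\<bar> \<le> r}" unfolding eq by (rule compact_cbox)
qed

text \<open>Disjoint supports remove all cross terms, so the energies of the layers add up instead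
  of their norms.\<close>

lemma norm_sum_at_most_one:
  fixes f :: "'i \<Rightarrow> 'b::real_inner"
  assumes "finite A" "\<And>x y. x \<in> A \<Longrightarrow> y \<in> A \<Longrightarrow> f x \<noteq> 0 \<Longrightarrow> f y \<noteq> 0 \<Longrightarrow> x = y"
  shows "(norm (\<Sum>x\<in>A. f x))\<^sup>2 \<le> (\<Sum>x\<in>A. (norm (f x))\<^sup>2)"
proof (cases "\<exists>x\<in>A. f x \<noteq> 0")
  case True
  then obtain x where x: "x \<in> A" "f x \<noteq> 0" by blast
  then have "(\<Sum>y\<in>A. f y) = (\<Sum>y\<in>{x}. f y)"
    using assms by (intro sum.mono_neutral_right) auto
  then show ?thesis using member_le_sum[OF x(1), of "\<lambda>x. (norm (f x))\<^sup>2"] assms(1) by simp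
qed (simp add: sum_nonneg)

lemma sum_at_most_one_le_1:
  fixes f :: "'i \<Rightarrow> real"
  assumes "finite A" "\<And>x y. x \<in> A \<Longrightarrow> y \<in> A \<Longrightarrow> f x \<noteq> 0 \<Longrightarrow> f y \<noteq> 0 \<Longrightarrow> x = y"
    "\<And>x. f x \<le> 1"
  shows "(\<Sum>x\<in>A. f x) \<le> 1"
proof (cases "\<exists>x\<in>A. f x \<noteq> 0")
  case True
  then obtain x where x: "x \<in> A" "f x \<noteq> 0" by blast
  then have "(\<Sum>y\<in>A. f y) = (\<Sum>y\<in>{x}. f y)"
    using assms by (intro sum.mono_neutral_right) auto
  then show ?thesis using assms(3) by simp
qed simp

section \<open>A test function of small energy\<close>

text \<open>A cutoff on the scale \<open>N * \<epsilon>\<close> times a periodic profile that vanishes near the holes. Averaging over \<open>M\<close> dyadic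
  scales, whose gradients have disjoint supports, produces the logarithm of the planar case; in higher dimension \<open>M = 1\<close>.\<close>

locale lattice_profile =
  fixes \<theta> :: "real^'n \<Rightarrow> real" and a b C \<epsilon> \<eta> :: real and M N :: nat
  assumes smooth: "smooth \<theta>" and C: "0 \<le> C"
    and \<theta>_bounds: "0 \<le> \<theta> x" "\<theta> x \<le> 1"
    and \<theta>_one: "(\<And>i. \<bar>x $ i\<bar> \<le> a) \<Longrightarrow> \<theta> x = 1"
    and \<theta>_zero: "b \<le> \<bar>x $ i\<bar> \<Longrightarrow> \<theta> x = 0"
    and gradient_bound: "norm (gradient \<theta> x) \<le> C"
    and gradient_outer: "gradient \<theta> x \<noteq> 0 \<Longrightarrow> \<bar>x $ i\<bar> \<le> b"
    and gradient_inner: "gradient \<theta> x \<noteq> 0 \<Longrightarrow> \<exists>i. a \<le> \<bar>x $ i\<bar>"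
    and ab: "1/4 \<le> a" "b < 1/2" "b < 2 * a" "0 < b" "a < b"
    and \<epsilon>: "0 < \<epsilon>" and \<eta>: "0 < \<eta>" and M: "0 < M" and N: "0 < N"
    and scales: "2 ^ (M - 1) * \<eta> \<le> 1"
begin

definition scale :: "nat \<Rightarrow> real" where
  "scale j = 2 ^ j * \<eta>"

definition shift :: "('n \<Rightarrow> int) \<Rightarrow> real^'n" where
  "shift k = (\<chi> i. of_int (k i))"

text \<open>The large cutoff lives where coordinates are at most 2 N \<epsilon>, and a hole reaches
  at most half a cell from its centre. Hence 2 N + 1 captures every hole that the cutoff
  meets.\<close>

definition box :: "('n \<Rightarrow> int) set" where
  "box = UNIV \<rightarrow>\<^sub>E {- int (2 * N + 1) .. int (2 * N + 1)}"

definition bump :: "nat \<Rightarrow> ('n \<Rightarrow> int) \<Rightarrow> real^'n \<Rightarrow> real" where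
  "bump j k x = \<theta> ((1 / (\<epsilon> * scale j)) *\<^sub>R x + (- (1 / scale j)) *\<^sub>R shift k)"

text \<open>Each of the M scales contributes one layer of transition. Averaging multiplies a layer's
  energy by M^(-2); for disjoint layers of equal cost, as in the plane, the total is smaller by the
  factor 1/M.\<close>

definition hole_part :: "real^'n \<Rightarrow> real" where
  "hole_part x = 1 - (1 / real M) * (\<Sum>(j, k)\<in>{..<M} \<times> box. bump j k x)"

text \<open>With the factor 4, \<open>1/4 \<le> a\<close> gives the value 1 up to \<epsilon> N, and
  \<open>b < 1/2\<close> gives 0 beyond 2 \<epsilon> N. The added 0 matches the affine form of the
  composition rules.\<close>

definition cutoff :: "real^'n \<Rightarrow> real" where
  "cutoff x = \<theta> ((1 / (4 * \<epsilon> * N)) *\<^sub>R x + 0)"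

definition profile :: "real^'n \<Rightarrow> real" where
  "profile x = cutoff x * hole_part x"

section \<open>Bumps around the lattice points\<close>

lemma scale_pos: "0 < scale j"
  using \<eta> by (simp add: scale_def)

lemma scale_ge: "\<eta> \<le> scale j"
  using \<eta> by (simp add: scale_def)

lemma scale_le_1: "j < M \<Longrightarrow> scale j \<le> 1"
proof -
  assume "j < M"
  then have "(2::real) ^ j * \<eta> \<le> 2 ^ (M - 1) * \<eta>"
    using \<eta> by (intro mult_right_mono power_increasing) auto
  then show ?thesis using scales by (simp add: scale_def)
qed

lemma scale_double: "i < j \<Longrightarrow> 2 * scale i \<le> scale j"
proof -
  assume "i < j"
  then have "(2::real) ^ Suc i * \<eta> \<le> 2 ^ j * \<eta>"
    using \<eta> by (intro mult_right_mono power_increasing) auto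
  then show ?thesis by (simp add: scale_def)
qed

lemma finite_box: "finite box"
  unfolding box_def by (intro finite_PiE) auto

text \<open>There are 4 N + 3 indices per axis, at most 7 N; this is the origin of the 7 in the
  energy bound.\<close>

lemma card_box: "real (card box) \<le> (7 * real N) ^ CARD('n)"
proof -
  have "nat (int (2 * N + 1) - - int (2 * N + 1) + 1) = 4 * N + 3" by simp
  then have "card box = (4 * N + 3) ^ CARD('n)"
    unfolding box_def by (subst card_funcsetE) (simp_all only: finite card_atLeastAtMost_int)
  then have "real (card box) = (real (4 * N + 3)) ^ CARD('n)" by simp
  also have "\<dots> \<le> (7 * real N) ^ CARD('n)"
    using N by (intro power_mono) auto
  finally show ?thesis by simp
qed

lemma in_boxI: "(\<And>i. \<bar>k i\<bar> \<le> int (2 * N + 1)) \<Longrightarrow> k \<in> box"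
proof -
  assume k: "\<And>i. \<bar>k i\<bar> \<le> int (2 * N + 1)"
  have "k i \<in> {- int (2 * N + 1) .. int (2 * N + 1)}" for i using k[of i] by (simp add: abs_le_iff)
  then show ?thesis by (simp add: box_def PiE_def extensional_def)
qed

lemma bump_arg:
  "((1 / (\<epsilon> * scale j)) *\<^sub>R x + (- (1 / scale j)) *\<^sub>R shift k) $ i = (x $ i / \<epsilon> - of_int (k i)) / scale j"
  using \<epsilon> scale_pos[of j] by (simp add: shift_def field_simps)

lemma abs_bump_arg:
  "\<bar>((1 / (\<epsilon> * scale j)) *\<^sub>R x + (- (1 / scale j)) *\<^sub>R shift k) $ i\<bar> = \<bar>x $ i / \<epsilon> - of_int (k i)\<bar> / scale j"
  unfolding bump_arg using scale_pos[of j] by simp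

lemma bump_bounds: "0 \<le> bump j k x" "bump j k x \<le> 1"
  by (simp_all add: bump_def \<theta>_bounds)

lemma bump_eq_1: "(\<And>i. \<bar>x $ i / \<epsilon> - of_int (k i)\<bar> \<le> scale j * a) \<Longrightarrow> bump j k x = 1"
  unfolding bump_def using scale_pos[of j]
  by (intro \<theta>_one, subst abs_bump_arg) (simp add: pos_divide_le_eq mult.commute)

lemma bump_eq_0: "scale j * b \<le> \<bar>x $ i / \<epsilon> - of_int (k i)\<bar> \<Longrightarrow> bump j k x = 0"
  unfolding bump_def using scale_pos[of j]
  by (intro \<theta>_zero[where i = i], subst abs_bump_arg) (simp add: pos_le_divide_eq mult.commute)

text \<open>Bumps reach less than half a cell, so this makes bumps around different lattice points
  disjoint.\<close>

lemma lattice_separated: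
  assumes "\<And>i. \<bar>y $ i / \<epsilon> - of_int (k i)\<bar> < 1/2" "\<And>i. \<bar>y $ i / \<epsilon> - of_int (k' i)\<bar> < 1/2"
  shows "k = k'"
proof
  fix i
  have "\<bar>of_int (k i) - of_int (k' i) :: real\<bar> < 1" using assms[of i] by linarith
  then show "k i = k' i" by linarith
qed

lemma scale_b: "j < M \<Longrightarrow> scale j * b < 1/2"
proof -
  assume "j < M"
  then have "scale j * b \<le> 1 * b" using scale_le_1 ab by (intro mult_right_mono) auto
  then show ?thesis using ab by linarith
qed

lemma bump_nonzeroD: "j < M \<Longrightarrow> bump j k x \<noteq> 0 \<Longrightarrow> \<bar>x $ i / \<epsilon> - of_int (k i)\<bar> < 1/2"
  using bump_eq_0[of j x i k] scale_b[of j] by force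

lemma sum_bump_le_1:
  assumes "j < M"
  shows "(\<Sum>k\<in>box. bump j k x) \<le> 1"
  by (rule sum_at_most_one_le_1[OF finite_box])
    (use assms in \<open>auto intro: lattice_separated[OF bump_nonzeroD bump_nonzeroD] simp: bump_bounds\<close>)

lemma hole_part_bounds: "0 \<le> hole_part x" "hole_part x \<le> 1"
proof -
  have eq: "(\<Sum>(j, k)\<in>{..<M} \<times> box. bump j k x) = (\<Sum>j<M. \<Sum>k\<in>box. bump j k x)"
    by (simp add: sum.cartesian_product)
  have "(\<Sum>j<M. \<Sum>k\<in>box. bump j k x) \<le> (\<Sum>j<M. 1)"
    by (intro sum_mono sum_bump_le_1) simp
  moreover have "0 \<le> (\<Sum>j<M. \<Sum>k\<in>box. bump j k x)"
    by (intro sum_nonneg bump_bounds)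
  ultimately show "0 \<le> hole_part x" "hole_part x \<le> 1"
    using M by (simp_all add: hole_part_def eq)
qed

lemma smooth_bump: "smooth (bump j k)"
  unfolding bump_def[abs_def] by (rule smooth_compose_affine[OF smooth])

lemma smooth_hole_part: "smooth hole_part"
  unfolding hole_part_def[abs_def] split_beta by (intro smooth_intros smooth_bump)

lemma smooth_cutoff: "smooth cutoff"
  unfolding cutoff_def[abs_def] by (rule smooth_compose_affine[OF smooth])

lemma smooth_profile: "smooth profile"
  unfolding profile_def[abs_def] by (intro smooth_intros smooth_cutoff smooth_hole_part)

lemma gradient_bump:
  "gradient (bump j k) x = (1 / (\<epsilon> * scale j)) *\<^sub>R
    gradient \<theta> ((1 / (\<epsilon> * scale j)) *\<^sub>R x + (- (1 / scale j)) *\<^sub>R shift k)"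
  unfolding bump_def[abs_def] by (rule gradient_compose_affine[OF smooth_differentiable[OF smooth]])

lemma norm_gradient_bump: "norm (gradient (bump j k) x) \<le> C / (\<epsilon> * scale j)"
  unfolding gradient_bump using gradient_bound \<epsilon> scale_pos[of j] by (simp add: divide_right_mono)

lemma gradient_bump_outer:
  assumes "gradient (bump j k) x \<noteq> 0"
  shows "\<bar>x $ i / \<epsilon> - of_int (k i)\<bar> \<le> scale j * b"
proof -
  have "gradient \<theta> ((1 / (\<epsilon> * scale j)) *\<^sub>R x + (- (1 / scale j)) *\<^sub>R shift k) \<noteq> 0"
    using assms by (auto simp: gradient_bump)
  from gradient_outer[OF this, of i] show ?thesis
    unfolding abs_bump_arg using scale_pos[of j] by (simp add: field_simps)
qed

lemma gradient_bump_inner: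
  assumes "gradient (bump j k) x \<noteq> 0"
  shows "\<exists>i. scale j * a \<le> \<bar>x $ i / \<epsilon> - of_int (k i)\<bar>"
proof -
  have "gradient \<theta> ((1 / (\<epsilon> * scale j)) *\<^sub>R x + (- (1 / scale j)) *\<^sub>R shift k) \<noteq> 0"
    using assms by (auto simp: gradient_bump)
  from gradient_inner[OF this] show ?thesis
    unfolding abs_bump_arg using scale_pos[of j] by (auto simp: field_simps)
qed

text \<open>Layers around different lattice points are apart by \<open>lattice_separated\<close>.
  Around the same point, the larger scale is at least twice the smaller, so its layer begins at 2 a
  times the smaller scale, beyond the end b of the smaller layer because
  \<open>b < 2 * a\<close>.\<close>

lemma gradient_bump_disjoint:
  assumes "j < M" "j' < M" "gradient (bump j k) x \<noteq> 0" "gradient (bump j' k') x \<noteq> 0"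
  shows "j = j' \<and> k = k'"
proof -
  have k: "k = k'"
  proof (rule lattice_separated)
    show "\<bar>x $ i / \<epsilon> - of_int (k i)\<bar> < 1/2" for i
      using gradient_bump_outer[OF assms(3), of i] scale_b[OF assms(1)] by linarith
    show "\<bar>x $ i / \<epsilon> - of_int (k' i)\<bar> < 1/2" for i
      using gradient_bump_outer[OF assms(4), of i] scale_b[OF assms(2)] by linarith
  qed
  have False if A: "i < l" "gradient (bump i k) x \<noteq> 0" "gradient (bump l k) x \<noteq> 0" for i l
  proof -
    obtain m where m: "scale l * a \<le> \<bar>x $ m / \<epsilon> - of_int (k m)\<bar>"
      using gradient_bump_inner[OF A(3)] by blast
    have "2 * scale i * a \<le> scale l * a"
      using scale_double[OF A(1)] ab by (intro mult_right_mono) auto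
    moreover have "scale i * b < scale i * (2 * a)"
      using ab scale_pos[of i] by (intro mult_strict_left_mono)
    ultimately show False using m gradient_bump_outer[OF A(2), of m] by (simp add: mult_ac)
  qed
  then show ?thesis using k assms(3,4) by (metis linorder_neqE_nat)
qed

lemma gradient_hole_part:
  "gradient hole_part x = (- (1 / real M)) *\<^sub>R (\<Sum>(j, k)\<in>{..<M} \<times> box. gradient (bump j k) x)"
proof (rule gradient_unique)
  have "(hole_part has_derivative
      (\<lambda>h. 0 - (1 / real M) * (\<Sum>p\<in>{..<M} \<times> box. gradient (bump (fst p) (snd p)) x \<bullet> h))) (at x)"
    unfolding hole_part_def[abs_def] split_beta
    by (intro derivative_intros has_derivative_mult_right has_derivative_gradient smooth_differentiable smooth_bump)
  then show "(hole_part has_derivative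
      (\<lambda>h. ((- (1 / real M)) *\<^sub>R (\<Sum>(j, k)\<in>{..<M} \<times> box. gradient (bump j k) x)) \<bullet> h)) (at x)"
    by (simp add: split_beta inner_sum_left)
qed

text \<open>Stated with indicators of cubes so that it can be integrated termwise. The half-width
  \<open>scale j / 2\<close> contains the layer because \<open>b < 1/2\<close>.\<close>

lemma norm_gradient_hole_part:
  "(norm (gradient hole_part x))\<^sup>2 \<le>
    (1 / real M)\<^sup>2 * (\<Sum>(j, k)\<in>{..<M} \<times> box. (C / (\<epsilon> * scale j))\<^sup>2 *
      indicator {x. \<forall>i. \<bar>x $ i - (\<epsilon> *\<^sub>R shift k) $ i\<bar> \<le> \<epsilon> * (scale j / 2)} x)"
proof -
  let ?g = "\<lambda>p. gradient (bump (fst p) (snd p)) x"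
  have "(norm (gradient hole_part x))\<^sup>2 = (1 / real M)\<^sup>2 * (norm (\<Sum>p\<in>{..<M} \<times> box. ?g p))\<^sup>2"
    by (simp add: gradient_hole_part split_beta power_mult_distrib power_divide)
  also have "(norm (\<Sum>p\<in>{..<M} \<times> box. ?g p))\<^sup>2 \<le> (\<Sum>p\<in>{..<M} \<times> box. (norm (?g p))\<^sup>2)"
    by (rule norm_sum_at_most_one) (auto simp: finite_box dest: gradient_bump_disjoint)
  also have "\<dots> \<le> (\<Sum>p\<in>{..<M} \<times> box. (C / (\<epsilon> * scale (fst p)))\<^sup>2 *
      indicator {x. \<forall>i. \<bar>x $ i - (\<epsilon> *\<^sub>R shift (snd p)) $ i\<bar> \<le> \<epsilon> * (scale (fst p) / 2)} x)"
  proof (rule sum_mono)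
    fix p :: "nat \<times> ('n \<Rightarrow> int)"
    obtain j k where p: "p = (j, k)" by (cases p)
    show "(norm (?g p))\<^sup>2 \<le> (C / (\<epsilon> * scale (fst p)))\<^sup>2 *
      indicator {x. \<forall>i. \<bar>x $ i - (\<epsilon> *\<^sub>R shift (snd p)) $ i\<bar> \<le> \<epsilon> * (scale (fst p) / 2)} x"
    proof (cases "?g p = 0")
      case False
      have "\<bar>x $ i - \<epsilon> * of_int (k i)\<bar> \<le> \<epsilon> * (scale j / 2)" for i
      proof -
        have "scale j * b \<le> scale j * (1/2)" using ab scale_pos[of j] by (intro mult_left_mono) auto
        then have "\<bar>x $ i / \<epsilon> - of_int (k i)\<bar> \<le> scale j / 2"
          using gradient_bump_outer[of j k x i] False p by auto
        then have "\<epsilon> * \<bar>x $ i / \<epsilon> - of_int (k i)\<bar> \<le> \<epsilon> * (scale j / 2)"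
          using \<epsilon> by (intro mult_left_mono) auto
        also have "\<epsilon> * \<bar>x $ i / \<epsilon> - of_int (k i)\<bar> = \<bar>\<epsilon> * (x $ i / \<epsilon> - of_int (k i))\<bar>"
          using \<epsilon> by (simp add: abs_mult)
        also have "\<epsilon> * (x $ i / \<epsilon> - of_int (k i)) = x $ i - \<epsilon> * of_int (k i)"
          using \<epsilon> by (simp add: right_diff_distrib)
        finally show ?thesis .
      qed
      moreover have "(norm (gradient (bump j k) x))\<^sup>2 \<le> (C / (\<epsilon> * scale j))\<^sup>2"
        by (intro power_mono norm_gradient_bump) simp
      ultimately show ?thesis by (simp add: p shift_def)
    qed simp
  qed
  finally show ?thesis by (simp add: split_beta mult_left_mono)
qed

section \<open>The large-scale cutoff\<close>

lemma cutoff_bounds: "0 \<le> cutoff x" "cutoff x \<le> 1"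
  by (simp_all add: cutoff_def \<theta>_bounds)

lemma cutoff_arg: "\<bar>((1 / (4 * \<epsilon> * N)) *\<^sub>R x + 0) $ i\<bar> = \<bar>x $ i\<bar> / (4 * \<epsilon> * N)"
  using \<epsilon> N by (simp add: abs_mult)

lemma cutoff_eq_1: "(\<And>i. \<bar>x $ i\<bar> \<le> \<epsilon> * N) \<Longrightarrow> cutoff x = 1"
proof -
  assume x: "\<And>i. \<bar>x $ i\<bar> \<le> \<epsilon> * N"
  have "\<bar>x $ i\<bar> / (4 * \<epsilon> * N) \<le> a" for i
  proof -
    have "\<bar>x $ i\<bar> / (4 * \<epsilon> * N) \<le> (\<epsilon> * N) / (4 * \<epsilon> * N)"
      using \<epsilon> N x[of i] by (intro divide_right_mono) auto
    also have "\<dots> = 1/4" using \<epsilon> N by simp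
    finally show ?thesis using ab by linarith
  qed
  then show ?thesis unfolding cutoff_def by (intro \<theta>_one) (simp only: cutoff_arg)
qed

lemma cutoff_nonzeroD:
  assumes "cutoff x \<noteq> 0"
  shows "\<bar>x $ i\<bar> \<le> \<epsilon> * (2 * N)"
proof -
  have "\<bar>x $ i\<bar> / (4 * \<epsilon> * N) < b"
    using assms \<theta>_zero[of "(1 / (4 * \<epsilon> * N)) *\<^sub>R x + 0" i] unfolding cutoff_def cutoff_arg by linarith
  then have "\<bar>x $ i\<bar> / (4 * \<epsilon> * N) \<le> 1/2" using ab by linarith
  then show ?thesis using \<epsilon> N by (simp add: field_simps)
qed

lemma gradient_cutoff:
  "gradient cutoff x = (1 / (4 * \<epsilon> * N)) *\<^sub>R gradient \<theta> ((1 / (4 * \<epsilon> * N)) *\<^sub>R x + 0)"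
  unfolding cutoff_def[abs_def] by (rule gradient_compose_affine[OF smooth_differentiable[OF smooth]])

lemma norm_gradient_cutoff:
  "(norm (gradient cutoff x))\<^sup>2 \<le> (C / (\<epsilon> * N))\<^sup>2 * indicator {x. \<forall>i. \<bar>x $ i - 0 $ i\<bar> \<le> \<epsilon> * (2 * N)} x"
proof (cases "gradient cutoff x = 0")
  case False
  then have "gradient \<theta> ((1 / (4 * \<epsilon> * N)) *\<^sub>R x + 0) \<noteq> 0" by (auto simp: gradient_cutoff)
  from gradient_outer[OF this] have "\<bar>x $ i\<bar> / (4 * \<epsilon> * N) \<le> 1/2" for i
    unfolding cutoff_arg using ab(2) by (meson less_imp_le order_trans)
  then have "\<bar>x $ i\<bar> \<le> \<epsilon> * (2 * N)" for i using \<epsilon> N by (simp add: field_simps)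
  moreover have "norm (gradient cutoff x) \<le> C / (\<epsilon> * N)"
  proof -
    have "norm (gradient cutoff x) = norm (gradient \<theta> ((1 / (4 * \<epsilon> * N)) *\<^sub>R x + 0)) / (4 * \<epsilon> * N)"
      using \<epsilon> by (simp add: gradient_cutoff)
    also have "\<dots> \<le> C / (\<epsilon> * N)"
      using gradient_bound C \<epsilon> N by (intro frac_le) auto
    finally show ?thesis .
  qed
  ultimately show ?thesis by (simp add: power_mono)
qed simp

section \<open>Energy and support of the profile\<close>

lemma norm_gradient_profile:
  "(norm (gradient profile x))\<^sup>2 \<le> 2 * (norm (gradient cutoff x))\<^sup>2 + 2 * (norm (gradient hole_part x))\<^sup>2"
proof -
  have "(profile has_derivative (\<lambda>h. cutoff x * (gradient hole_part x \<bullet> h) + (gradient cutoff x \<bullet> h) * hole_part x)) (at x)"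
    unfolding profile_def[abs_def]
    by (intro has_derivative_mult has_derivative_gradient smooth_differentiable smooth_cutoff smooth_hole_part)
  then have "gradient profile x = cutoff x *\<^sub>R gradient hole_part x + hole_part x *\<^sub>R gradient cutoff x"
    by (intro gradient_unique) (simp add: inner_add_left mult.commute)
  then have "norm (gradient profile x) \<le> cutoff x * norm (gradient hole_part x) + hole_part x * norm (gradient cutoff x)"
    using norm_triangle_ineq[of "cutoff x *\<^sub>R gradient hole_part x" "hole_part x *\<^sub>R gradient cutoff x"]
    by (simp add: cutoff_bounds hole_part_bounds)
  also have "\<dots> \<le> norm (gradient hole_part x) + norm (gradient cutoff x)"
    by (intro add_mono mult_left_le_one_le cutoff_bounds hole_part_bounds norm_ge_zero)
  finally have "(norm (gradient profile x))\<^sup>2 \<le> (norm (gradient hole_part x) + norm (gradient cutoff x))\<^sup>2"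
    by (rule power_mono) simp
  also have "\<dots> \<le> 2 * (norm (gradient cutoff x))\<^sup>2 + 2 * (norm (gradient hole_part x))\<^sup>2"
    using sum_squares_bound[of "norm (gradient hole_part x)" "norm (gradient cutoff x)"] by (simp add: power2_sum)
  finally show ?thesis .
qed

text \<open>The cutoff has squared gradient of order (\<epsilon> N)^(-2) on a cube of volume of
  order (\<epsilon> N)^d. Each of the at most (7 N)^d lattice points carries M layers, with squared
  gradient of order (\<epsilon> r)^(-2) on volume of order (\<epsilon> r)^d at scale r. Relative to
  the volume (\<epsilon> N)^d, \<epsilon>^(-2) times the last bracket remains.\<close>

lemma profile_energy:
  assumes d: "2 \<le> CARD('n)"
  shows "(\<integral>\<^sup>+x. ennreal ((norm (gradient profile x))\<^sup>2) \<partial>lborel) \<le>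
    ennreal (2 * C\<^sup>2 * 7 ^ CARD('n) * \<epsilon> ^ (CARD('n) - 2) * N ^ CARD('n) *
      (1 / (real N)\<^sup>2 + (\<Sum>j<M. scale j ^ (CARD('n) - 2)) / (real M)\<^sup>2))"
proof -
  let ?d = "CARD('n)"
  let ?Q = "{x::real^'n. \<forall>i. \<bar>x $ i - 0 $ i\<bar> \<le> \<epsilon> * (2 * N)}"
  let ?R = "\<lambda>p. {x. \<forall>i. \<bar>x $ i - (\<epsilon> *\<^sub>R shift (snd p)) $ i\<bar> \<le> \<epsilon> * (scale (fst p) / 2)}"
  let ?A = "2 * (C / (\<epsilon> * N))\<^sup>2" and ?B = "\<lambda>p. 2 * (1 / real M)\<^sup>2 * (C / (\<epsilon> * scale (fst p)))\<^sup>2"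
  have Q: "0 \<le> \<epsilon> * real (2 * N)" using \<epsilon> by simp
  have R: "0 \<le> \<epsilon> * (scale j / 2)" for j using \<epsilon> scale_pos[of j] by simp
  have [measurable]: "?Q \<in> sets borel" "?R p \<in> sets borel" for p
    using emeasure_cube(2)[OF Q] emeasure_cube(2)[OF R] by (auto intro: borel_closed compact_imp_closed)
  obtain e where e: "?d = e + 2" using d by (metis add.commute le_Suc_ex)
  have "(\<integral>\<^sup>+x. ennreal ((norm (gradient profile x))\<^sup>2) \<partial>lborel) \<le>
    (\<integral>\<^sup>+x. ennreal ?A * indicator ?Q x + (\<Sum>p\<in>{..<M} \<times> box. ennreal (?B p) * indicator (?R p) x) \<partial>lborel)"
  proof (rule nn_integral_mono)
    fix x
    have "(norm (gradient profile x))\<^sup>2 \<le> ?A * indicator ?Q x + (\<Sum>p\<in>{..<M} \<times> box. ?B p * indicator (?R p) x)"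
    proof -
      have "2 * (norm (gradient hole_part x))\<^sup>2 \<le> 2 * ((1 / real M)\<^sup>2 * (\<Sum>p\<in>{..<M} \<times> box. (C / (\<epsilon> * scale (fst p)))\<^sup>2 * indicator (?R p) x))"
        using norm_gradient_hole_part[of x] by (simp add: split_beta)
      also have "\<dots> = (\<Sum>p\<in>{..<M} \<times> box. ?B p * indicator (?R p) x)"
        by (simp add: sum_distrib_left mult.assoc)
      finally have "2 * (norm (gradient hole_part x))\<^sup>2 \<le> \<dots>" .
      moreover have "2 * (norm (gradient cutoff x))\<^sup>2 \<le> ?A * indicator ?Q x"
        using norm_gradient_cutoff[of x] by (simp only: mult.assoc)
      ultimately show ?thesis using norm_gradient_profile[of x] by linarith
    qed
    then have "ennreal ((norm (gradient profile x))\<^sup>2) \<le> ennreal (?A * indicator ?Q x + (\<Sum>p\<in>{..<M} \<times> box. ?B p * indicator (?R p) x))"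
      by (rule ennreal_leI)
    also have "\<dots> = ennreal (?A * indicator ?Q x) + ennreal (\<Sum>p\<in>{..<M} \<times> box. ?B p * indicator (?R p) x)"
      by (intro ennreal_plus sum_nonneg) auto
    also have "ennreal (\<Sum>p\<in>{..<M} \<times> box. ?B p * indicator (?R p) x) = (\<Sum>p\<in>{..<M} \<times> box. ennreal (?B p * indicator (?R p) x))"
      by (intro sum_ennreal[symmetric]) auto
    finally show "ennreal ((norm (gradient profile x))\<^sup>2) \<le> ennreal ?A * indicator ?Q x + (\<Sum>p\<in>{..<M} \<times> box. ennreal (?B p) * indicator (?R p) x)"
      by (simp only: ennreal_indicator ennreal_mult''[OF indicator_pos_le])
  qed
  also have "\<dots> = (\<integral>\<^sup>+x. ennreal ?A * indicator ?Q x \<partial>lborel) +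
      (\<integral>\<^sup>+x. (\<Sum>p\<in>{..<M} \<times> box. ennreal (?B p) * indicator (?R p) x) \<partial>lborel)"
    by (rule nn_integral_add) measurable
  also have "(\<integral>\<^sup>+x. ennreal ?A * indicator ?Q x \<partial>lborel) = ennreal ?A * emeasure lborel ?Q"
    by (rule nn_integral_cmult_indicator) simp
  also have "(\<integral>\<^sup>+x. (\<Sum>p\<in>{..<M} \<times> box. ennreal (?B p) * indicator (?R p) x) \<partial>lborel) =
      (\<Sum>p\<in>{..<M} \<times> box. ennreal (?B p) * emeasure lborel (?R p))"
    by (subst nn_integral_sum) (auto intro!: sum.cong nn_integral_cmult_indicator)
  also have "emeasure lborel ?Q = ennreal ((4 * \<epsilon> * N) ^ ?d)"
    by (subst emeasure_cube(1)[OF Q]) (simp add: mult_ac)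
  also have "(\<Sum>p\<in>{..<M} \<times> box. ennreal (?B p) * emeasure lborel (?R p)) =
      (\<Sum>p\<in>{..<M} \<times> box. ennreal (?B p * (\<epsilon> * scale (fst p)) ^ ?d))"
  proof (rule sum.cong[OF refl])
    fix p
    have "emeasure lborel (?R p) = ennreal ((2 * (\<epsilon> * (scale (fst p) / 2))) ^ ?d)"
      by (rule emeasure_cube(1)[OF R])
    also have "2 * (\<epsilon> * (scale (fst p) / 2)) = \<epsilon> * scale (fst p)" by simp
    finally have em: "emeasure lborel (?R p) = ennreal ((\<epsilon> * scale (fst p)) ^ ?d)" .
    show "ennreal (?B p) * emeasure lborel (?R p) = ennreal (?B p * (\<epsilon> * scale (fst p)) ^ ?d)"
      unfolding em using \<epsilon> scale_pos[of "fst p"] by (intro ennreal_mult[symmetric]) (auto simp: less_imp_le)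
  qed
  also have "\<dots> = ennreal (\<Sum>p\<in>{..<M} \<times> box. ?B p * (\<epsilon> * scale (fst p)) ^ ?d)"
    using \<epsilon> scale_pos by (intro sum_ennreal) (simp add: less_imp_le)
  also have "ennreal ?A * ennreal ((4 * \<epsilon> * N) ^ ?d) = ennreal (?A * (4 * \<epsilon> * N) ^ ?d)"
    using \<epsilon> by (intro ennreal_mult[symmetric]) auto
  also have "ennreal (?A * (4 * \<epsilon> * N) ^ ?d) + ennreal (\<Sum>p\<in>{..<M} \<times> box. ?B p * (\<epsilon> * scale (fst p)) ^ ?d) =
      ennreal (?A * (4 * \<epsilon> * N) ^ ?d + (\<Sum>p\<in>{..<M} \<times> box. ?B p * (\<epsilon> * scale (fst p)) ^ ?d))"
    using \<epsilon> scale_pos by (intro ennreal_plus[symmetric] sum_nonneg mult_nonneg_nonneg) (auto simp: less_imp_le)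
  also have "\<dots> \<le> ennreal (2 * C\<^sup>2 * 7 ^ ?d * \<epsilon> ^ e * N ^ ?d * (1 / (real N)\<^sup>2 + (\<Sum>j<M. scale j ^ e) / (real M)\<^sup>2))"
  proof (rule ennreal_leI)
    have "?A * (4 * \<epsilon> * N) ^ ?d = 2 * C\<^sup>2 * 4 ^ ?d * \<epsilon> ^ e * N ^ ?d * (1 / (real N)\<^sup>2)"
      using \<epsilon> N by (simp add: e power_add power_mult_distrib power_divide field_simps power2_eq_square)
    also have "\<dots> \<le> 2 * C\<^sup>2 * 7 ^ ?d * \<epsilon> ^ e * N ^ ?d * (1 / (real N)\<^sup>2)"
      using \<epsilon> by (intro mult_right_mono mult_left_mono power_mono) auto
    finally have 1: "?A * (4 * \<epsilon> * N) ^ ?d \<le> 2 * C\<^sup>2 * 7 ^ ?d * \<epsilon> ^ e * N ^ ?d * (1 / (real N)\<^sup>2)" .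
    have "(\<Sum>p\<in>{..<M} \<times> box. ?B p * (\<epsilon> * scale (fst p)) ^ ?d) =
        (\<Sum>p\<in>{..<M} \<times> box. 2 * C\<^sup>2 * \<epsilon> ^ e / (real M)\<^sup>2 * scale (fst p) ^ e)"
    proof (rule sum.cong[OF refl])
      fix p
      show "?B p * (\<epsilon> * scale (fst p)) ^ ?d = 2 * C\<^sup>2 * \<epsilon> ^ e / (real M)\<^sup>2 * scale (fst p) ^ e"
        using \<epsilon> scale_pos[of "fst p"] M by (simp add: e power_add power_mult_distrib power_divide field_simps power2_eq_square)
    qed
    also have "\<dots> = (\<Sum>j<M. \<Sum>k\<in>box. 2 * C\<^sup>2 * \<epsilon> ^ e / (real M)\<^sup>2 * scale j ^ e)"
      unfolding sum.cartesian_product by (intro sum.cong refl) auto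
    also have "\<dots> = real (card box) * (2 * C\<^sup>2 * \<epsilon> ^ e / (real M)\<^sup>2 * (\<Sum>j<M. scale j ^ e))"
      by (simp add: sum_distrib_left)
    also have "\<dots> \<le> (7 * real N) ^ ?d * (2 * C\<^sup>2 * \<epsilon> ^ e / (real M)\<^sup>2 * (\<Sum>j<M. scale j ^ e))"
      using \<epsilon> scale_pos by (intro mult_right_mono card_box mult_nonneg_nonneg sum_nonneg) (auto simp: less_imp_le)
    also have "\<dots> = 2 * C\<^sup>2 * 7 ^ ?d * \<epsilon> ^ e * N ^ ?d * ((\<Sum>j<M. scale j ^ e) / (real M)\<^sup>2)"
      by (simp add: power_mult_distrib)
    finally have 2: "(\<Sum>p\<in>{..<M} \<times> box. ?B p * (\<epsilon> * scale (fst p)) ^ ?d) \<le>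
        2 * C\<^sup>2 * 7 ^ ?d * \<epsilon> ^ e * N ^ ?d * ((\<Sum>j<M. scale j ^ e) / (real M)\<^sup>2)" .
    show "?A * (4 * \<epsilon> * N) ^ ?d + (\<Sum>p\<in>{..<M} \<times> box. ?B p * (\<epsilon> * scale (fst p)) ^ ?d) \<le>
        2 * C\<^sup>2 * 7 ^ ?d * \<epsilon> ^ e * N ^ ?d * (1 / (real N)\<^sup>2 + (\<Sum>j<M. scale j ^ e) / (real M)\<^sup>2)"
      using add_mono[OF 1 2] by (simp only: distrib_left)
  qed
  finally show ?thesis by (simp add: e)
qed

text \<open>Every scale is at least \<eta>, so all M bumps equal 1 on an open cube around each hole
  and the profile vanishes on that whole neighbourhood. This gives support at positive distance from
  the holes.\<close>

lemma profile_test_function: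
  fixes T :: "(real^'n) set"
  assumes T: "\<And>y i. y \<in> T \<Longrightarrow> \<bar>y $ i\<bar> < a"
  shows "profile \<in> test_functions (perforated_domain T \<epsilon> \<eta>)"
proof -
  let ?U = "\<lambda>k. {x::real^'n. \<forall>i. \<bar>x $ i / \<epsilon> - of_int (k i)\<bar> < \<eta> * a}"
  \<comment> \<open>The cube of the cutoff minus the open neighbourhoods of the holes: compact,
    disjoint from the holes, and containing all points where the profile is nonzero.\<close>
  define S where "S = {x::real^'n. \<forall>i. \<bar>x $ i - 0 $ i\<bar> \<le> \<epsilon> * (2 * N)} \<inter> (\<Inter>k\<in>box. - ?U k)"
  have "open (?U k)" for k :: "'n \<Rightarrow> int"
  proof -
    have "open {x::real^'n. \<bar>x $ i / \<epsilon> - of_int (k i)\<bar> < \<eta> * a}" for i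
      using \<epsilon> by (intro open_Collect_less continuous_intros) auto
    then have "open (\<Inter>i. {x::real^'n. \<bar>x $ i / \<epsilon> - of_int (k i)\<bar> < \<eta> * a})"
      by (intro open_INT) auto
    also have "(\<Inter>i. {x::real^'n. \<bar>x $ i / \<epsilon> - of_int (k i)\<bar> < \<eta> * a}) = ?U k" by blast
    finally show ?thesis .
  qed
  then have S: "compact S"
    unfolding S_def using \<epsilon> by (intro compact_Int_closed emeasure_cube(2) closed_INT ballI closed_Compl) auto
  have S\<Omega>: "S \<subseteq> perforated_domain T \<epsilon> \<eta>"
  proof
    fix x assume x: "x \<in> S"
    show "x \<in> perforated_domain T \<epsilon> \<eta>"
      unfolding perforated_domain_iff
    proof (intro ballI notI)
      fix k y assume k: "k \<in> integer_lattice" and y: "y \<in> T" and eq: "x = \<epsilon> *\<^sub>R k + (\<epsilon> * \<eta>) *\<^sub>R y"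
      define m where "m i = \<lfloor>k $ i\<rfloor>" for i
      have m: "k $ i = of_int (m i)" for i
        using k by (simp add: integer_lattice_def m_def of_int_floor_cancel)
      have diff: "x $ i / \<epsilon> - of_int (m i) = \<eta> * y $ i" for i
        unfolding eq using \<epsilon> by (simp add: m add_divide_distrib)
      have U: "\<bar>x $ i / \<epsilon> - of_int (m i)\<bar> < \<eta> * a" for i
        unfolding diff using T[OF y, of i] \<eta> by (simp add: abs_mult)
      have "\<eta> * a \<le> 1/2"
      proof -
        have "\<eta> * a \<le> 1 * a"
          using scale_ge[of 0] scale_le_1[OF M] ab by (intro mult_right_mono) auto
        then show ?thesis using ab by linarith
      qed
      \<comment> \<open>A hole meeting the cube is centred within 2 N + 1/2 of the origin in each
        coordinate, in units of \<epsilon>.\<close>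
      have "m \<in> box"
      proof (rule in_boxI)
        fix i
        have "\<bar>x $ i\<bar> \<le> \<epsilon> * (2 * N)" using x by (simp add: S_def)
        then have "\<bar>x $ i / \<epsilon>\<bar> \<le> 2 * N" using \<epsilon> by (simp add: abs_div_pos[symmetric] field_simps)
        then have "\<bar>real_of_int (m i)\<bar> \<le> 2 * real N + 1" using U[of i] \<open>\<eta> * a \<le> 1/2\<close> by linarith
        then show "\<bar>m i\<bar> \<le> int (2 * N + 1)" by linarith
      qed
      then show False using x U by (auto simp: S_def)
    qed
  qed
  show ?thesis
  proof (rule test_functionsI[OF smooth_profile S S\<Omega>])
    fix x assume nz: "profile x \<noteq> 0"
    then have "cutoff x \<noteq> 0" by (auto simp: profile_def)
    then have "\<bar>x $ i\<bar> \<le> \<epsilon> * (2 * N)" for i by (rule cutoff_nonzeroD)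
    moreover have False if k: "k \<in> box" "x \<in> ?U k" for k
    proof -
      have row: "(\<Sum>k\<in>box. bump j k x) = 1" if j: "j < M" for j
      proof -
        have "\<bar>x $ i / \<epsilon> - of_int (k i)\<bar> \<le> scale j * a" for i
        proof -
          have "\<eta> * a \<le> scale j * a" using scale_ge[of j] ab by (intro mult_right_mono) auto
          moreover have "\<bar>x $ i / \<epsilon> - of_int (k i)\<bar> < \<eta> * a" using k(2) by blast
          ultimately show ?thesis by linarith
        qed
        then have one: "bump j k x = 1" by (rule bump_eq_1)
        have "(\<Sum>k\<in>box. bump j k x) = (\<Sum>k\<in>{k}. bump j k x)"
        proof (rule sum.mono_neutral_right)
          show "\<forall>k'\<in>box - {k}. bump j k' x = 0"
          proof (rule ballI, rule ccontr)
            fix k' assume k': "k' \<in> box - {k}" "bump j k' x \<noteq> 0"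
            have "bump j k x \<noteq> 0" using one by simp
            then have "k = k'"
              using bump_nonzeroD[OF j] k'(2) by (intro lattice_separated[of x k k']) auto
            then show False using k'(1) by simp
          qed
        qed (use k finite_box in auto)
        then show ?thesis using one by simp
      qed
      have "(\<Sum>(j, k)\<in>{..<M} \<times> box. bump j k x) = (\<Sum>j<M. \<Sum>k\<in>box. bump j k x)"
        by (simp add: sum.cartesian_product)
      also have "\<dots> = real M" using row by simp
      finally have "hole_part x = 0" using M by (simp add: hole_part_def)
      then show False using nz by (simp add: profile_def)
    qed
    ultimately show "x \<in> S" by (auto simp: S_def)
  qed
qed

section \<open>The set on which the profile equals 1\<close>

definition plateau_box :: "('n \<Rightarrow> int) set" where
  "plateau_box = UNIV \<rightarrow>\<^sub>E {- int N ..< int N}"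

text \<open>Cubes around the cell centres k + 1/2. The index range is asymmetric so that each cell
  from k to k + 1 lies between -N and N, inside the region where the cutoff is 1. Points of these
  cubes stay at least b from the integers in every coordinate, out of reach of all bumps.\<close>

definition plateau :: "(real^'n) set" where
  "plateau = (\<Union>k\<in>plateau_box. {x. \<forall>i. \<bar>x $ i - (\<epsilon> *\<^sub>R (shift k + (\<chi> i. 1/2))) $ i\<bar> \<le> \<epsilon> * ((1/2 - b) / 2)})"

lemma plateau_memD:
  assumes "k \<in> plateau_box" "\<forall>i. \<bar>x $ i - (\<epsilon> *\<^sub>R (shift k + (\<chi> i. 1/2))) $ i\<bar> \<le> \<epsilon> * ((1/2 - b) / 2)"
  shows "\<bar>x $ i / \<epsilon> - (of_int (k i) + 1/2)\<bar> \<le> 1/2 - b"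
proof -
  have "\<bar>x $ i / \<epsilon> - (of_int (k i) + 1/2)\<bar> = \<bar>(x $ i - \<epsilon> * (of_int (k i) + 1/2)) / \<epsilon>\<bar>"
    using \<epsilon> by (simp add: diff_divide_distrib)
  also have "\<dots> = \<bar>x $ i - \<epsilon> * (of_int (k i) + 1/2)\<bar> / \<epsilon>" using \<epsilon> by simp
  also have "\<dots> \<le> (\<epsilon> * ((1/2 - b) / 2)) / \<epsilon>"
    using assms(2) \<epsilon> by (intro divide_right_mono) (auto simp: shift_def)
  also have "\<dots> \<le> 1/2 - b" using \<epsilon> ab by simp
  finally show ?thesis .
qed

lemma profile_plateau:
  assumes "x \<in> plateau"
  shows "profile x = 1"
proof -
  obtain k where k: "k \<in> plateau_box"
    and x: "\<And>i. \<bar>x $ i / \<epsilon> - (of_int (k i) + 1/2)\<bar> \<le> 1/2 - b"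
    using assms plateau_memD by (auto simp: plateau_def)
  have "cutoff x = 1"
  proof (rule cutoff_eq_1)
    fix i
    have "- int N \<le> k i" "k i < int N" using k by (auto simp: plateau_box_def PiE_def Pi_def)
    then have "- real N \<le> of_int (k i)" "of_int (k i) + 1 \<le> real N" by linarith+
    moreover have "\<bar>x $ i / \<epsilon> - (of_int (k i) + 1/2)\<bar> \<le> 1/2" using x[of i] ab by linarith
    ultimately have "\<bar>x $ i / \<epsilon>\<bar> \<le> N" unfolding abs_le_iff by linarith
    then show "\<bar>x $ i\<bar> \<le> \<epsilon> * N" using \<epsilon> by (simp add: abs_div_pos[symmetric] field_simps)
  qed
  moreover have "bump j k' x = 0" if "j < M" for j k'
  \<comment> \<open>One coordinate far from the integers is enough for a bump to vanish. Here every
    coordinate is, so an arbitrary index serves.\<close>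
  proof (rule bump_eq_0[of _ _ undefined])
    have "b \<le> \<bar>x $ i / \<epsilon> - of_int m\<bar>" for i and m :: int
    proof -
      have "m \<le> k i \<or> k i + 1 \<le> m" by linarith
      then have "of_int m \<le> (of_int (k i) :: real) \<or> of_int (k i) + 1 \<le> (of_int m :: real)" by linarith
      then show ?thesis
      proof
        assume "of_int m \<le> (of_int (k i) :: real)"
        then show ?thesis using x[of i] by linarith
      next
        assume "of_int (k i) + 1 \<le> (of_int m :: real)"
        then show ?thesis using x[of i] by linarith
      qed
    qed
    moreover have "scale j * b \<le> 1 * b"
      using scale_le_1[OF that] ab by (intro mult_right_mono) auto
    ultimately show "scale j * b \<le> \<bar>x $ undefined / \<epsilon> - of_int (k' undefined)\<bar>" by (metis mult_1 order_trans)
  qed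
  then have "hole_part x = 1" by (auto simp: hole_part_def intro!: sum.neutral)
  ultimately show ?thesis by (simp add: profile_def)
qed

lemma emeasure_plateau:
  "emeasure lborel plateau = ennreal ((2 * (1/2 - b) * \<epsilon> * N) ^ CARD('n))"
  and compact_plateau: "compact plateau"
proof -
  let ?r = "\<epsilon> * ((1/2 - b) / 2)"
  let ?P = "\<lambda>k. {x. \<forall>i. \<bar>x $ i - (\<epsilon> *\<^sub>R (shift k + (\<chi> i. 1/2))) $ i\<bar> \<le> ?r}"
  have r: "0 \<le> ?r" using \<epsilon> ab by simp
  have fin: "finite plateau_box" unfolding plateau_box_def by (intro finite_PiE) auto
  have card: "card plateau_box = (2 * N) ^ CARD('n)"
  proof -
    have "nat (int N - - int N) = 2 * N" by simp
    then show ?thesis unfolding plateau_box_def by (subst card_funcsetE) (simp_all only: finite card_atLeastLessThan_int)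
  qed
  have cpt: "compact (?P k)" for k by (rule emeasure_cube(2)[OF r])
  show "compact plateau" unfolding plateau_def by (intro compact_UN fin cpt)
  have disj: "disjoint_family_on ?P plateau_box"
    unfolding disjoint_family_on_def
  proof (intro ballI impI)
    fix k k' assume k: "k \<in> plateau_box" "k' \<in> plateau_box" "k \<noteq> k'"
    have False if x: "x \<in> ?P k" "x \<in> ?P k'" for x
    proof -
      have "k i = k' i" for i
      proof -
        have "\<bar>of_int (k i) - of_int (k' i) :: real\<bar> < 1"
          using plateau_memD[OF k(1), of x i, OF x(1)[unfolded mem_Collect_eq]]
            plateau_memD[OF k(2), of x i, OF x(2)[unfolded mem_Collect_eq]] ab(4) by linarith
        then show ?thesis by linarith
      qed
      then show False using k(3) by auto
    qed
    then show "?P k \<inter> ?P k' = {}" by (meson disjoint_iff)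
  qed
  have "emeasure lborel plateau = (\<Sum>k\<in>plateau_box. emeasure lborel (?P k))"
    unfolding plateau_def
  proof (rule sum_emeasure[symmetric, OF _ disj fin])
    have "?P k \<in> sets lborel" for k
      using borel_closed[OF compact_imp_closed[OF cpt]] by simp
    then show "?P ` plateau_box \<subseteq> sets lborel" by (rule image_subsetI)
  qed
  also have "\<dots> = (\<Sum>k\<in>plateau_box. ennreal ((2 * ?r) ^ CARD('n)))"
    by (intro sum.cong refl emeasure_cube(1)[OF r])
  also have "\<dots> = ennreal (real (card plateau_box) * (2 * ?r) ^ CARD('n))"
  proof -
    have "(\<Sum>k\<in>plateau_box. ennreal ((2 * ?r) ^ CARD('n))) = of_nat (card plateau_box) * ennreal ((2 * ?r) ^ CARD('n))"
      by (rule sum_constant)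
    also have "\<dots> = ennreal (real (card plateau_box)) * ennreal ((2 * ?r) ^ CARD('n))"
      by (simp only: ennreal_of_nat_eq_real_of_nat)
    also have "\<dots> = ennreal (real (card plateau_box) * (2 * ?r) ^ CARD('n))"
      using r by (intro ennreal_mult[symmetric]) auto
    finally show ?thesis .
  qed
  also have "real (card plateau_box) * (2 * ?r) ^ CARD('n) = (2 * (1/2 - b) * \<epsilon> * N) ^ CARD('n)"
  proof -
    have "real (card plateau_box) * (2 * ?r) ^ CARD('n) = (real (2 * N) * (2 * ?r)) ^ CARD('n)"
      unfolding card of_nat_power by (rule power_mult_distrib[symmetric])
    also have "real (2 * N) * (2 * ?r) = 2 * (1/2 - b) * \<epsilon> * N" by (simp add: field_simps)
    finally show ?thesis .
  qed
  finally show "emeasure lborel plateau = ennreal ((2 * (1/2 - b) * \<epsilon> * N) ^ CARD('n))" .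
qed

end

section \<open>The lower bound\<close>

text \<open>Convexity, derived from Young's inequality for the absolute value of u and t^(p-1),
  whose q-th power is t^p. This treats all signs of u at once.\<close>

lemma powr_tangent_le:
  fixes p t u :: real
  assumes "1 < p" "0 < t"
  shows "t powr p + p * t powr (p - 1) * (u - t) \<le> \<bar>u\<bar> powr p"
proof -
  define q where "q = p / (p - 1)"
  have q: "1 < q" "1 / p + 1 / q = 1" unfolding q_def using assms(1) by (simp_all add: field_simps)
  have "(p - 1) * q = p" using assms(1) by (simp add: q_def)
  then have tq: "(t powr (p - 1)) powr q = t powr p" by (simp add: powr_powr)
  have "\<bar>u\<bar> * t powr (p - 1) \<le> \<bar>u\<bar> powr p / p + t powr p / q"
    using Youngs_inequality[OF assms(1) q, of "\<bar>u\<bar>" "t powr (p - 1)"] by (simp add: tq)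
  then have "p * (\<bar>u\<bar> * t powr (p - 1)) \<le> p * (\<bar>u\<bar> powr p / p + t powr p / q)"
    using assms(1) by (intro mult_left_mono) auto
  also have "\<dots> = \<bar>u\<bar> powr p + (p - 1) * t powr p"
    using assms(1) by (simp add: q_def field_simps)
  finally have 1: "p * (\<bar>u\<bar> * t powr (p - 1)) \<le> \<bar>u\<bar> powr p + (p - 1) * t powr p" .
  have "u * t powr (p - 1) \<le> \<bar>u\<bar> * t powr (p - 1)" by (intro mult_right_mono) auto
  then have 2: "p * (u * t powr (p - 1)) \<le> p * (\<bar>u\<bar> * t powr (p - 1))"
    using assms(1) by (intro mult_left_mono) auto
  have t: "t powr (p - 1) * t = t powr p" using assms(2) powr_add[of t "p - 1" 1] by simp
  have "p * t powr (p - 1) * (u - t) = p * (u * t powr (p - 1)) - p * (t powr (p - 1) * t)"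
    by (simp add: algebra_simps)
  then show ?thesis using 1 2 unfolding t by (simp add: left_diff_distrib)
qed

text \<open>The source is a normalised indicator. A test function \<open>\<psi>\<close> equal to \<open>1\<close> there bounds the energy of the solution from
  below, and the convexity of \<open>\<bar>s\<bar> powr p\<close> turns this into a bound of the norm for every \<open>p\<close> at once.\<close>

lemma D_const_lower_bound:
  fixes T :: "(real^'n) set" and p \<epsilon> \<eta> :: real
  defines "\<omega> \<equiv> perforated_domain T \<epsilon> \<eta>"
  assumes p: "1 < p" and op: "open \<omega>" and K: "poincare_on \<omega> K"
    and \<psi>: "\<psi> \<in> test_functions \<omega>" and E: "compact E" "emeasure lborel E = ennreal m" "0 < m"
    and one: "\<And>x. x \<in> E \<Longrightarrow> \<psi> x = 1"
    and \<kappa>: "0 < \<kappa>"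
    and energy: "(\<integral>\<^sup>+x. ennreal ((norm (gradient \<psi> x))\<^sup>2) \<partial>lborel) \<le> ennreal (m / \<kappa>)"
  shows "ennreal \<kappa> \<le> D_const p T \<epsilon> \<eta>"
proof -
  let ?M = "lebesgue_on \<omega>"
  note \<omega> = lebesgue_sets_open[OF op]
  have Es: "E \<in> sets lebesgue" by (rule lebesgue_sets_compact[OF E(1)])
  have Eb: "E \<in> sets borel" by (rule borel_closed[OF compact_imp_closed[OF E(1)]])
  have E\<omega>: "E \<subseteq> \<omega>" using one test_functions_zero_outside(1)[OF \<psi>] by fastforce
  have EM: "E \<in> sets ?M" using Es E\<omega> by (auto simp: sets_restrict_space)
  have emE: "emeasure ?M E = ennreal m"
    using \<omega> E\<omega> Eb E(2) by (simp add: emeasure_restrict_space)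
  have int1: "integrable ?M (indicator E :: _ \<Rightarrow> real)"
    using EM emE by (intro integrable_real_indicator) auto
  have LINT1: "(LINT x|?M. indicator E x) = m"
    using EM emE E(3) E\<omega> by (simp add: measure_def Int_absorb2 space_restrict_space)
  then have meas: "measure ?M (E \<inter> \<omega>) = m" by simp
  \<comment> \<open>The height at which the indicator of a set of measure \<open>m\<close> has L^p
    norm 1.\<close>
  define s where "s = m powr (- (1 / p))"
  have s: "0 < s" "s powr p * m = 1" "s * s * m * m = m powr (2 - 2 / p)"
  proof -
    show "0 < s" using E(3) by (simp add: s_def)
    have "s powr p = m powr (- 1)" unfolding s_def powr_powr using p by simp
    then show "s powr p * m = 1" using E(3) by (simp add: powr_minus)
    have "s * s * m * m = m powr (- (1 / p)) * m powr (- (1 / p)) * m powr 1 * m powr 1"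
      using E(3) by (simp add: s_def)
    also have "\<dots> = m powr (2 - 2 / p)" unfolding powr_add[symmetric] by (simp add: algebra_simps)
    finally show "s * s * m * m = m powr (2 - 2 / p)" .
  qed
  define F :: "real^'n \<Rightarrow> real" where "F x = s * indicator E x" for x
  have [measurable]: "(indicator E :: _ \<Rightarrow> real) \<in> borel_measurable ?M" using EM by simp
  have Fm: "F \<in> borel_measurable ?M" unfolding F_def by measurable
  have Fp: "(\<integral>\<^sup>+x. ennreal (norm (F x) powr p) \<partial>?M) = 1"
  proof -
    have "(\<integral>\<^sup>+x. ennreal (norm (F x) powr p) \<partial>?M) = (\<integral>\<^sup>+x. ennreal (s powr p) * indicator E x \<partial>?M)"
      using s(1) by (intro nn_integral_cong) (auto simp: F_def split: split_indicator)
    also have "\<dots> = ennreal (s powr p) * ennreal m"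
      using EM emE by (simp add: nn_integral_cmult_indicator)
    also have "\<dots> = ennreal (s powr p * m)" using E(3) by (simp add: ennreal_mult)
    finally show ?thesis using s(2) by simp
  qed
  have F1: "Lp_norm p \<omega> F = 1" using Fp p by (subst Lp_norm_eq_1_iff) auto
  have FLp: "F \<in> Lp_space p \<omega>" using Fm F1 by (simp add: Lp_space_def)
  have Fsq: "square_integrable ?M F"
  proof -
    have "(\<lambda>x. (norm (F x))\<^sup>2) = (\<lambda>x. s\<^sup>2 * indicator E x)"
      by (auto simp: F_def power_mult_distrib split: split_indicator)
    then show ?thesis using Fm int1 by (simp add: square_integrable_def)
  qed
  obtain u where sol: "weak_solution \<omega> F u" and u: "square_integrable ?M u"
    and dual: "\<And>\<psi>. \<psi> \<in> test_functions \<omega> \<Longrightarrow> (LINT x|?M. F x * \<psi> x)\<^sup>2 \<le>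
      (LINT x|?M. F x * u x) * (L2norm ?M (gradient \<psi>))\<^sup>2"
    using weak_solution_exists[OF op K Fsq] by auto
  have intEu: "integrable ?M (\<lambda>x. indicator E x * u x)"
    using square_integrable_inner[OF Fsq u] s(1) by (simp add: F_def mult.assoc)
  define U where "U = (LINT x|?M. indicator E x * u x)"
  have "(L2norm ?M (gradient \<psi>))\<^sup>2 \<le> m / \<kappa>"
  proof -
    have "ennreal ((L2norm ?M (gradient \<psi>))\<^sup>2) = (\<integral>\<^sup>+x. ennreal ((norm (gradient \<psi> x))\<^sup>2) \<partial>?M)"
      by (rule nn_integral_eq_L2norm[symmetric, OF test_functions_square_integrable(2)[OF \<psi> \<omega>]])
    also have "\<dots> = (\<integral>\<^sup>+x. ennreal ((norm (gradient \<psi> x))\<^sup>2) \<partial>lborel)"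
    proof (rule nn_integral_lebesgue_on[OF \<omega>])
      have "gradient \<psi> \<in> borel_measurable borel"
        by (rule borel_measurable_smooth(2)[OF test_functions_smooth[OF \<psi>]])
      then show "(\<lambda>x. ennreal ((norm (gradient \<psi> x))\<^sup>2)) \<in> borel_measurable borel" by measurable
    qed (simp add: test_functions_zero_outside[OF \<psi>])
    finally have "ennreal ((L2norm ?M (gradient \<psi>))\<^sup>2) \<le> ennreal (m / \<kappa>)" using energy by simp
    then show ?thesis using E(3) \<kappa> by (simp add: ennreal_le_iff)
  qed
  moreover have "(LINT x|?M. F x * \<psi> x) = s * m"
  proof -
    have "(LINT x|?M. F x * \<psi> x) = (LINT x|?M. s * indicator E x)"
      by (intro Bochner_Integration.integral_cong refl) (auto simp: F_def one split: split_indicator)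
    then show ?thesis by (simp add: meas)
  qed
  moreover have FU: "(LINT x|?M. F x * u x) = s * U"
    by (simp add: F_def U_def mult.assoc)
  ultimately have dual\<psi>: "(s * m)\<^sup>2 \<le> s * U * (L2norm ?M (gradient \<psi>))\<^sup>2" "(L2norm ?M (gradient \<psi>))\<^sup>2 \<le> m / \<kappa>"
    using dual[OF \<psi>] by simp_all
  \<comment> \<open>The sign is needed to insert the upper bound for the energy of \<psi> into the
    dual inequality. A negative \<open>U\<close> would contradict that inequality itself.\<close>
  have U0: "0 \<le> U"
  proof (rule ccontr)
    assume "\<not> 0 \<le> U"
    then have "s * U * (L2norm ?M (gradient \<psi>))\<^sup>2 \<le> 0"
      using s(1) by (intro mult_nonpos_nonneg mult_nonneg_nonpos) auto
    moreover have "0 < (s * m)\<^sup>2" using s(1) E(3) by simp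
    ultimately show False using dual\<psi>(1) by linarith
  qed
  have "(s * m)\<^sup>2 \<le> s * U * (m / \<kappa>)"
    using dual\<psi>(1) mult_left_mono[OF dual\<psi>(2), of "s * U"] s(1) U0 by (simp add: mult_nonneg_nonneg)
  then have "s * m * (s * m) \<le> (U / \<kappa>) * (s * m)" by (simp add: power2_eq_square mult_ac)
  then have "s * m \<le> U / \<kappa>" using s(1) E(3) by (intro mult_right_le_imp_le[of "s * m" "s * m" "U / \<kappa>"]) auto
  then have U: "\<kappa> * s * m \<le> U" using \<kappa> by (simp add: field_simps)
  \<comment> \<open>By the last bound on \<open>U\<close>, the mean of \<open>u\<close> over
    \<open>E\<close> is at least \<open>t\<close>. The tangent is taken at this value, so the linear
    term integrates to something nonnegative, and \<open>t powr p * m\<close> is exactly the p-th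
    power of \<kappa>.\<close>
  define t where "t = \<kappa> * s"
  have t: "0 < t" using \<kappa> s(1) by (simp add: t_def)
  have [measurable]: "u \<in> borel_measurable ?M" using u by (rule square_integrable_measurable)
  have "ennreal (\<kappa> powr p) \<le> (\<integral>\<^sup>+x. ennreal (norm (u x) powr p) \<partial>?M)"
  proof (cases "(\<integral>\<^sup>+x. ennreal (norm (u x) powr p) \<partial>?M) = \<infinity>")
    case False
    then have int: "integrable ?M (\<lambda>x. norm (u x) powr p)"
      by (intro integrableI_bounded) (auto simp: top.not_eq_extremum)
    have "\<kappa> powr p = t powr p * m"
      using s(2) \<kappa> s(1) by (simp add: t_def powr_mult mult.assoc)
    also have "\<dots> \<le> t powr p * m + p * t powr (p - 1) * (U - t * m)"
      using U p t by (simp add: t_def mult.assoc)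
    also have "\<dots> = (LINT x|?M. (t powr p - p * t powr (p - 1) * t) * indicator E x + p * t powr (p - 1) * (indicator E x * u x))"
    proof -
      have "(LINT x|?M. A * indicator E x + B * (indicator E x * u x)) = A * m + B * U" for A B
        using int1 intEu by (simp add: meas U_def)
      then show ?thesis by (simp only:) (simp add: algebra_simps)
    qed
    also have "\<dots> \<le> (LINT x|?M. norm (u x) powr p)"
    proof (rule integral_mono[OF _ int])
      show "integrable ?M (\<lambda>x. (t powr p - p * t powr (p - 1) * t) * indicator E x + p * t powr (p - 1) * (indicator E x * u x))"
        using int1 intEu by simp
      show "(t powr p - p * t powr (p - 1) * t) * indicator E x + p * t powr (p - 1) * (indicator E x * u x) \<le> norm (u x) powr p" for x
        using powr_tangent_le[OF p t, of "u x"] by (auto simp: algebra_simps split: split_indicator)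
    qed
    finally have "ennreal (\<kappa> powr p) \<le> ennreal (LINT x|?M. norm (u x) powr p)" by (rule ennreal_leI)
    also have "\<dots> = (\<integral>\<^sup>+x. ennreal (norm (u x) powr p) \<partial>?M)"
      using int by (intro nn_integral_eq_integral[symmetric]) auto
    finally show ?thesis .
  qed simp
  then have "ennreal \<kappa> \<le> Lp_norm p \<omega> u" using p \<kappa> by (subst Lp_norm_ge_iff) auto
  also have "\<dots> \<le> D_const p T \<epsilon> \<eta>"
    unfolding D_const_def Let_def \<omega>_def[symmetric]
    by (rule Sup_upper) (use FLp Fsq F1 sol in \<open>auto simp: square_integrable_Lp_space\<close>)
  finally show ?thesis .
qed

text \<open>In the plane every layer has the same energy, so as many dyadic scales as fit between
  \<eta> and 1 are used, about the logarithm of 1/\<eta>. In higher dimension the single scale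
  \<eta> suffices.\<close>

lemma dyadic_scales:
  assumes d: "2 \<le> d" and \<eta>: "0 < \<eta>" "\<eta> \<le> 1" and \<epsilon>: "0 < \<epsilon>"
  obtains M :: nat where "0 < M" "2 ^ (M - 1) * \<eta> \<le> 1"
    "(\<Sum>j<M. (2 ^ j * \<eta>) ^ (d - 2)) / (real M)\<^sup>2 \<le> 2 * \<epsilon>\<^sup>2 / rate d \<epsilon> \<eta>"
proof (cases "d = 2")
  case True
  define l where "l = log 2 (1 / \<eta>)"
  define M where "M = nat \<lfloor>l\<rfloor> + 1"
  have l0: "0 \<le> l" using \<eta> by (simp add: l_def zero_le_log_cancel_iff)
  have "real (nat \<lfloor>l\<rfloor>) \<le> l" using l0 by linarith
  then have "2 powr real (nat \<lfloor>l\<rfloor>) \<le> 2 powr l" by (intro powr_mono) auto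
  also have "2 powr l = 1 / \<eta>" using \<eta> by (simp add: l_def)
  finally have "2 ^ nat \<lfloor>l\<rfloor> \<le> 1 / \<eta>" by (simp add: powr_realpow)
  then have M1: "2 ^ (M - 1) * \<eta> \<le> 1" using \<eta> by (simp add: M_def field_simps)
  have "\<bar>ln (\<eta> / 2)\<bar> = ln 2 * (1 + l)"
  proof -
    have "ln \<eta> \<le> 0" using \<eta> by simp
    then have "\<bar>ln (\<eta> / 2)\<bar> = ln 2 - ln \<eta>" using \<eta> by (simp add: ln_div)
    also have "\<dots> = ln 2 * (1 + l)" using \<eta> by (simp add: l_def log_def ln_div field_simps)
    finally show ?thesis .
  qed
  \<comment> \<open>ln 2 is at most 1, and 1 + l is at most 2 M because l < M and M is at least
    1.\<close>
  also have "\<dots> \<le> 1 * (2 * real M)"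
  proof (intro mult_mono)
    show "ln 2 \<le> (1::real)" using ln_2_less_1 by simp
    have "real M = of_int \<lfloor>l\<rfloor> + 1" using l0 by (simp add: M_def)
    moreover have "1 \<le> real M" by (simp add: M_def)
    ultimately show "1 + l \<le> 2 * real M"
      using real_of_int_floor_add_one_gt[of l] by linarith
  qed (use l0 in auto)
  finally have ln: "\<bar>ln (\<eta> / 2)\<bar> \<le> 2 * real M" by simp
  have lnpos: "0 < \<bar>ln (\<eta> / 2)\<bar>" using ln_less_zero[of "\<eta> / 2"] \<eta> by auto
  have "(\<Sum>j<M. (2 ^ j * \<eta>) ^ (d - 2)) / (real M)\<^sup>2 = 1 / real M"
    using True by (simp add: power2_eq_square M_def)
  also have "\<dots> \<le> 2 / \<bar>ln (\<eta> / 2)\<bar>"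
    using ln lnpos by (simp add: M_def field_simps)
  also have "\<dots> = 2 * \<epsilon>\<^sup>2 / rate d \<epsilon> \<eta>" using True \<epsilon> by (simp add: rate_def)
  finally show ?thesis using that[of M] M1 by (simp add: M_def)
next
  case False
  have "rate d \<epsilon> \<eta> * \<eta> ^ (d - 2) = \<epsilon>\<^sup>2"
    using False d \<eta> by (simp add: rate_def power_int_def nat_diff_distrib power_inverse)
  then have "\<eta> ^ (d - 2) = \<epsilon>\<^sup>2 / rate d \<epsilon> \<eta>"
    using rate_pos[OF \<epsilon> \<eta>, of d] by (simp add: field_simps)
  moreover have "0 \<le> \<epsilon>\<^sup>2 / rate d \<epsilon> \<eta>" using rate_pos[OF \<epsilon> \<eta>, of d] by simp
  ultimately show ?thesis using that[of 1] \<eta> by simp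
qed

lemma poincare_on_perforated:
  assumes d: "2 \<le> CARD('n::finite)" and c0: "0 < c0"
  obtains C where "0 < C"
    "\<And>(T :: (real^'n) set) \<epsilon> \<eta>. admissible_hole c0 T \<Longrightarrow> 0 < \<epsilon> \<Longrightarrow> 0 < \<eta> \<Longrightarrow> \<eta> \<le> 1 \<Longrightarrow>
      poincare_on (perforated_domain T \<epsilon> \<eta>) (C * rate (CARD('n)) \<epsilon> \<eta>)"
proof (rule poincare_perforated[OF d c0])
  fix C assume C: "0 < C"
    "\<And>(T :: (real^'n) set) \<epsilon> \<eta> \<psi>. admissible_hole c0 T \<Longrightarrow> 0 < \<epsilon> \<Longrightarrow> 0 < \<eta> \<Longrightarrow> \<eta> \<le> 1 \<Longrightarrow>
      \<psi> \<in> test_functions (perforated_domain T \<epsilon> \<eta>) \<Longrightarrow>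
      (\<integral>\<^sup>+x. ennreal ((\<psi> x)\<^sup>2) \<partial>lborel) \<le>
        ennreal (C * rate (CARD('n)) \<epsilon> \<eta>) * (\<integral>\<^sup>+x. ennreal ((norm (gradient \<psi> x))\<^sup>2) \<partial>lborel)"
  show thesis
  proof (rule that[OF C(1)])
    fix T :: "(real^'n) set" and \<epsilon> \<eta> :: real
    assume T: "admissible_hole c0 T" and \<epsilon>: "0 < \<epsilon>" and \<eta>: "0 < \<eta>" "\<eta> \<le> 1"
    have op: "open (perforated_domain T \<epsilon> \<eta>)"
      by (rule open_perforated_domain[OF admissible_holeD(1)[OF T c0]])
    show "poincare_on (perforated_domain T \<epsilon> \<eta>) (C * rate (CARD('n)) \<epsilon> \<eta>)"
      using C(1) rate_pos[OF \<epsilon> \<eta>, of "CARD('n)"] C(2)[OF T \<epsilon> \<eta>]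
      by (intro poincare_onI lebesgue_sets_open[OF op]) auto
  qed
qed

text \<open>The source is placed on the plateau. The ratio of its volume to the energy of the
  profile is of the order of the rate, uniformly in the period, since the plateau and the number of
  cells both grow like N^d.\<close>

lemma D_const_ge_rate:
  fixes p c0 :: real
  assumes d: "2 \<le> CARD('n::finite)" and p: "1 < p" and c0: "0 < c0"
  obtains c where "0 < c" "\<And>(T :: (real^'n) set) \<epsilon> \<eta>. admissible_hole c0 T \<Longrightarrow> 0 < \<epsilon> \<Longrightarrow> 0 < \<eta> \<Longrightarrow> \<eta> \<le> 1 \<Longrightarrow>
    ennreal (c * rate (CARD('n)) \<epsilon> \<eta>) \<le> D_const p T \<epsilon> \<eta>"
proof -
  let ?d = "CARD('n)"
  \<comment> \<open>The gap \<open>c0\<close> between the hole and the cell boundary holds three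
    widths \<delta>: between hole and \<open>a\<close>, between \<open>a\<close> and
    \<open>b\<close>, between \<open>b\<close> and 1/2. The cap 1/8 ensures
    \<open>1/4 \<le> a\<close> and \<open>b < 2 * a\<close>.\<close>
  define \<delta> where "\<delta> = min c0 (1/8) / 3"
  define a b where "a = 1/2 - 2 * \<delta>" and "b = 1/2 - \<delta>"
  have \<delta>: "0 < \<delta>" "\<delta> \<le> 1/24" "3 * \<delta> \<le> c0" using c0 by (auto simp: \<delta>_def)
  have ab: "0 < a" "a < b" "1/4 \<le> a" "b < 1/2" "b < 2 * a" "0 < b"
    using \<delta> by (simp_all add: a_def b_def)
  obtain \<theta> :: "real^'n \<Rightarrow> real" and C where \<theta>:
    "smooth \<theta>" "0 \<le> C" "\<And>x. 0 \<le> \<theta> x" "\<And>x. \<theta> x \<le> 1"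
    "\<And>x. (\<And>i. \<bar>x $ i\<bar> \<le> a) \<Longrightarrow> \<theta> x = 1" "\<And>x i. b \<le> \<bar>x $ i\<bar> \<Longrightarrow> \<theta> x = 0"
    "\<And>x. norm (gradient \<theta> x) \<le> C"
    "\<And>x i. gradient \<theta> x \<noteq> 0 \<Longrightarrow> \<bar>x $ i\<bar> \<le> b" "\<And>x. gradient \<theta> x \<noteq> 0 \<Longrightarrow> \<exists>i. a \<le> \<bar>x $ i\<bar>"
    apply (rule cutoff_exists[OF ab(1,2), where 'n = 'n])
    subgoal premises prems by (rule prems(1)) (fact prems)+
    done
  obtain CP where CP: "0 < CP"
    "\<And>(T :: (real^'n) set) \<epsilon> \<eta>. admissible_hole c0 T \<Longrightarrow> 0 < \<epsilon> \<Longrightarrow> 0 < \<eta> \<Longrightarrow> \<eta> \<le> 1 \<Longrightarrow>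
      poincare_on (perforated_domain T \<epsilon> \<eta>) (CP * rate ?d \<epsilon> \<eta>)"
    apply (rule poincare_on_perforated[OF d c0])
    subgoal premises prems by (rule prems(1)) (fact prems)+
    done
  \<comment> \<open>The 6 is the 2 of the energy bound times the 3 from summing the cutoff and layer
    terms; the denominator comes from the plateau volume. Adding 1 keeps \<open>B\<close> positive
    when C = 0.\<close>
  define B where "B = 6 * C\<^sup>2 * 7 ^ ?d / (2 * \<delta>) ^ ?d + 1"
  have B: "0 < B" using \<delta> by (auto simp: B_def intro!: add_nonneg_pos)
  have "ennreal (1 / B * rate ?d \<epsilon> \<eta>) \<le> D_const p T \<epsilon> \<eta>"
    if T: "admissible_hole c0 T" and \<epsilon>: "0 < \<epsilon>" and \<eta>: "0 < \<eta>" "\<eta> \<le> 1" for T :: "(real^'n) set" and \<epsilon> \<eta>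
  proof -
    let ?\<omega> = "perforated_domain T \<epsilon> \<eta>"
    let ?r = "rate ?d \<epsilon> \<eta>"
    have r: "0 < ?r" by (rule rate_pos[OF \<epsilon> \<eta>])
    obtain M :: nat where M: "0 < M" "2 ^ (M - 1) * \<eta> \<le> 1"
      "(\<Sum>j<M. (2 ^ j * \<eta>) ^ (?d - 2)) / (real M)\<^sup>2 \<le> 2 * \<epsilon>\<^sup>2 / ?r"
      apply (rule dyadic_scales[OF d \<eta> \<epsilon>])
    subgoal premises prems by (rule prems(1)) (fact prems)+
    done
    \<comment> \<open>So many cells that the energy of the outer cutoff, of relative order N^(-2),
      is at most \<epsilon>^2 divided by the rate and does not dominate the energy near the
      holes.\<close>
    define N where "N = nat \<lceil>?r / \<epsilon>\<^sup>2\<rceil> + 1"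
    have N: "0 < N" "1 \<le> real N" "?r / \<epsilon>\<^sup>2 \<le> real N" by (simp_all add: N_def) linarith
    interpret P: lattice_profile \<theta> a b C \<epsilon> \<eta> M N
      by unfold_locales (use \<theta> ab \<epsilon> \<eta> M N in auto)
    have op: "open ?\<omega>" by (rule open_perforated_domain[OF admissible_holeD(1)[OF T c0]])
    note K = CP(2)[OF T \<epsilon> \<eta>]
    have \<psi>: "P.profile \<in> test_functions ?\<omega>"
    proof (rule P.profile_test_function)
      fix y i assume "y \<in> T"
      then show "\<bar>y $ i\<bar> < a" using admissible_holeD(3)[OF T c0, of y i] \<delta> by (simp add: a_def)
    qed
    define m where "m = (2 * \<delta> * \<epsilon> * N) ^ ?d"
    have m: "0 < m" using \<delta> \<epsilon> N by (simp add: m_def)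
    have em: "emeasure lborel P.plateau = ennreal m"
      using P.emeasure_plateau by (simp add: m_def b_def)
    have "1 / (real N)\<^sup>2 \<le> \<epsilon>\<^sup>2 / ?r"
    proof -
      have "real N * 1 \<le> real N * real N" by (intro mult_left_mono N(2)) simp
      then have "?r / \<epsilon>\<^sup>2 \<le> (real N)\<^sup>2" using N(3) by (simp add: power2_eq_square[of "real N"])
      then have "1 / (real N)\<^sup>2 \<le> 1 / (?r / \<epsilon>\<^sup>2)"
        using r \<epsilon> N(1) by (intro divide_left_mono mult_pos_pos divide_pos_pos) auto
      then show ?thesis by simp
    qed
    moreover have "(\<Sum>j<M. P.scale j ^ (?d - 2)) / (real M)\<^sup>2 \<le> 2 * \<epsilon>\<^sup>2 / ?r"
      using M(3) by (simp add: P.scale_def)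
    ultimately have S: "1 / (real N)\<^sup>2 + (\<Sum>j<M. P.scale j ^ (?d - 2)) / (real M)\<^sup>2 \<le> 3 * \<epsilon>\<^sup>2 / ?r"
      by (simp add: add_divide_distrib)
    have "(\<integral>\<^sup>+x. ennreal ((norm (gradient P.profile x))\<^sup>2) \<partial>lborel) \<le>
      ennreal (2 * C\<^sup>2 * 7 ^ ?d * \<epsilon> ^ (?d - 2) * N ^ ?d *
        (1 / (real N)\<^sup>2 + (\<Sum>j<M. P.scale j ^ (?d - 2)) / (real M)\<^sup>2))"
      by (rule P.profile_energy[OF d])
    also have "\<dots> \<le> ennreal (m / (1 / B * ?r))"
    proof (rule ennreal_leI)
      have ed: "\<epsilon> ^ ?d = \<epsilon> ^ (?d - 2) * \<epsilon>\<^sup>2"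
        using power_add[of \<epsilon> "?d - 2" 2] unfolding le_add_diff_inverse2[OF d] .
      have "2 * C\<^sup>2 * 7 ^ ?d * \<epsilon> ^ (?d - 2) * N ^ ?d * (1 / (real N)\<^sup>2 + (\<Sum>j<M. P.scale j ^ (?d - 2)) / (real M)\<^sup>2) \<le>
          2 * C\<^sup>2 * 7 ^ ?d * \<epsilon> ^ (?d - 2) * N ^ ?d * (3 * \<epsilon>\<^sup>2 / ?r)"
        using \<epsilon> by (intro mult_left_mono S) simp
      also have "\<dots> = (6 * C\<^sup>2 * 7 ^ ?d / (2 * \<delta>) ^ ?d) * (m / ?r)"
        using \<delta> by (simp add: m_def ed power_mult_distrib field_simps)
      also have "\<dots> \<le> B * (m / ?r)"
        using m r by (intro mult_right_mono) (auto simp: B_def)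
      finally show "2 * C\<^sup>2 * 7 ^ ?d * \<epsilon> ^ (?d - 2) * N ^ ?d * (1 / (real N)\<^sup>2 + (\<Sum>j<M. P.scale j ^ (?d - 2)) / (real M)\<^sup>2) \<le>
          m / (1 / B * ?r)" by (simp add: mult.commute)
    qed
    finally show ?thesis
      using D_const_lower_bound[OF p op K \<psi> P.compact_plateau em m P.profile_plateau, of "1 / B * ?r"] B r by simp
  qed
  then show thesis using that[of "1 / B"] B by simp
qed

lemma D_const_le_rate:
  fixes p c0 :: real
  assumes d: "2 \<le> CARD('n::finite)" and p: "1 < p" and c0: "0 < c0"
  obtains C where "0 < C" "\<And>(T :: (real^'n) set) \<epsilon> \<eta>. admissible_hole c0 T \<Longrightarrow> 0 < \<epsilon> \<Longrightarrow> 0 < \<eta> \<Longrightarrow> \<eta> \<le> 1 \<Longrightarrow>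
    D_const p T \<epsilon> \<eta> \<le> ennreal (C * rate (CARD('n)) \<epsilon> \<eta>)"
proof -
  let ?d = "CARD('n)"
  obtain CP where CP: "0 < CP"
    "\<And>(T :: (real^'n) set) \<epsilon> \<eta>. admissible_hole c0 T \<Longrightarrow> 0 < \<epsilon> \<Longrightarrow> 0 < \<eta> \<Longrightarrow> \<eta> \<le> 1 \<Longrightarrow>
      poincare_on (perforated_domain T \<epsilon> \<eta>) (CP * rate ?d \<epsilon> \<eta>)"
    apply (rule poincare_on_perforated[OF d c0])
    subgoal premises prems by (rule prems(1)) (fact prems)+
    done
  obtain C where C: "0 < C"
    "\<And>(\<Omega> :: (real^'n) set) K F u. open \<Omega> \<Longrightarrow> poincare_on \<Omega> K \<Longrightarrow> F \<in> Lp_space p \<Omega> \<Longrightarrow>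
      Lp_norm p \<Omega> F = 1 \<Longrightarrow> weak_solution \<Omega> F u \<Longrightarrow> Lp_norm p \<Omega> u \<le> ennreal (C * K)"
    apply (rule weak_solution_Lp_bound[OF p, where 'n = 'n])
    subgoal premises prems by (rule prems(1)) (fact prems)+
    done
  have "D_const p T \<epsilon> \<eta> \<le> ennreal (C * CP * rate ?d \<epsilon> \<eta>)"
    if T: "admissible_hole c0 T" and \<epsilon>: "0 < \<epsilon>" and \<eta>: "0 < \<eta>" "\<eta> \<le> 1" for T :: "(real^'n) set" and \<epsilon> \<eta>
  proof -
    let ?\<omega> = "perforated_domain T \<epsilon> \<eta>"
    have op: "open ?\<omega>" by (rule open_perforated_domain[OF admissible_holeD(1)[OF T c0]])
    note K = CP(2)[OF T \<epsilon> \<eta>]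
    show ?thesis
      unfolding D_const_def Let_def
    proof (rule Sup_least)
      fix y assume "y \<in> {Lp_norm p ?\<omega> u |u F. F \<in> Lp_space p ?\<omega> \<inter> Lp_space 2 ?\<omega> \<and> Lp_norm p ?\<omega> F = 1 \<and> weak_solution ?\<omega> F u}"
      then obtain u F where "y = Lp_norm p ?\<omega> u" "F \<in> Lp_space p ?\<omega>" "Lp_norm p ?\<omega> F = 1" "weak_solution ?\<omega> F u"
        by auto
      then show "y \<le> ennreal (C * CP * rate ?d \<epsilon> \<eta>)"
        using C(2)[OF op K] by (simp add: mult.assoc)
    qed
  qed
  then show thesis using that[of "C * CP"] C(1) CP(1) by simp
qed

theorem theorem4p5:
  fixes p c0 :: real
  assumes "2 \<le> CARD('n::finite)" and "1 < p" and "0 < c0"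
  shows "\<exists>c C. 0 < c \<and> 0 < C \<and>
    (\<forall>(T :: (real^'n) set) \<epsilon> \<eta>.
       admissible_hole c0 T \<and> 0 < \<epsilon> \<and> \<epsilon> \<le> 1 \<and> 0 < \<eta> \<and> \<eta> \<le> 1 \<longrightarrow>
       (3 \<le> CARD('n) \<longrightarrow>
          ennreal (c * \<epsilon>\<^sup>2 * \<eta> powi (2 - int CARD('n))) \<le> D_const p T \<epsilon> \<eta> \<and>
          D_const p T \<epsilon> \<eta> \<le> ennreal (C * \<epsilon>\<^sup>2 * \<eta> powi (2 - int CARD('n)))) \<and>
       (CARD('n) = 2 \<longrightarrow>
          ennreal (c * \<epsilon>\<^sup>2 * \<bar>ln (\<eta> / 2)\<bar>) \<le> D_const p T \<epsilon> \<eta> \<and>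
          D_const p T \<epsilon> \<eta> \<le> ennreal (C * \<epsilon>\<^sup>2 * \<bar>ln (\<eta> / 2)\<bar>)))"
proof -
  obtain c where c: "0 < c" "\<And>(T :: (real^'n) set) \<epsilon> \<eta>. admissible_hole c0 T \<Longrightarrow> 0 < \<epsilon> \<Longrightarrow> 0 < \<eta> \<Longrightarrow> \<eta> \<le> 1 \<Longrightarrow>
      ennreal (c * rate (CARD('n)) \<epsilon> \<eta>) \<le> D_const p T \<epsilon> \<eta>"
    apply (rule D_const_ge_rate[OF assms])
    subgoal premises prems by (rule prems(1)) (fact prems)+
    done
  obtain C where C: "0 < C" "\<And>(T :: (real^'n) set) \<epsilon> \<eta>. admissible_hole c0 T \<Longrightarrow> 0 < \<epsilon> \<Longrightarrow> 0 < \<eta> \<Longrightarrow> \<eta> \<le> 1 \<Longrightarrow>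
      D_const p T \<epsilon> \<eta> \<le> ennreal (C * rate (CARD('n)) \<epsilon> \<eta>)"
    apply (rule D_const_le_rate[OF assms])
    subgoal premises prems by (rule prems(1)) (fact prems)+
    done
  have "k * rate (CARD('n)) \<epsilon> \<eta> = k * \<epsilon>\<^sup>2 * \<eta> powi (2 - int CARD('n))" if "3 \<le> CARD('n)" for k \<epsilon> \<eta>
    using that by (simp add: rate_def mult.assoc)
  moreover have "k * rate (CARD('n)) \<epsilon> \<eta> = k * \<epsilon>\<^sup>2 * \<bar>ln (\<eta> / 2)\<bar>" if "CARD('n) = 2" for k \<epsilon> \<eta>
    using that by (simp add: rate_def mult.assoc)
  ultimately show ?thesis
    using c C by (intro exI[of _ c] exI[of _ C]) (metis (no_types, lifting))
qed

end
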